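(* Let $G$ be a simply connected nilpotent Lie group of dimension $n$ equipped with a left-invariant Riemannian metric $h$. A left-invariant vector field on $G$ is one-harmonic (with respect to $h$) if and only if it is a Killing vector field of $(G,h)$.
   Context: A vector field $X$ on a Riemannian manifold $(M,g)$ is a Killing field if $\mathcal{L}_X g=0$, where $\mathcal{L}_X$ is the Lie derivative with respect to $X$. The tension field of a smooth map $\varphi:(M,g)\to(N,h)$ between Riemannian manifolds is $\tau(\varphi)=\operatorname{tr}(\nabla d\varphi)$. A vector field $X$ on $(M,g)$ is called one-harmonic if the local one-parameter group of diffeomorphisms $\{\varphi_t\}$ it generates satisfies $\frac{d}{dt}\tau(\varphi_t)\big|_{t=0}=0$. By a known characterization, with $\nabla$ the Levi-Civita connection of $g$, $X$ is one-harmonic if and only if $\operatorname{tr}(\mathcal{L}_X\nabla)=0$, i.e. $\sum_i(\mathcal{L}_X\nabla)(e_i,e_i)=0$ for any local orthonormal frame $\{e_i\}$, where $(\mathcal{L}_X\nabla)(Y,Z)=[X,\nabla_YZ]-\nabla_{[X,Y]}Z-\nabla_Y[X,Z]$. Equivalently, $\Delta X=\operatorname{Ric}(X)$, where $\operatorname{Ric}$ is the Ricci operator and $\Delta X=-\sum_i(\nabla_{e_i}\nabla_{e_i}X-\nabla_{\nabla_{e_i}e_i}X)$. *)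

theory Defs
  imports "HOL-Analysis.Analysis" "HOL-Algebra.Generated_Groups"
begin

section \<open>Smooth manifolds\<close>

text \<open>\<open>Ck_on k S f\<close> says that \<open>f\<close> is k times continuously differentiable; it is only used
  for open sets \<open>S\<close> of a finite-dimensional space, where continuity of all iterated directional
  derivatives is the usual notion.\<close>

primrec Ck_on :: "nat \<Rightarrow> 'e::euclidean_space set \<Rightarrow> ('e \<Rightarrow> 'f::real_normed_vector) \<Rightarrow> bool" where
  "Ck_on 0 S f \<longleftrightarrow> continuous_on S f"
| "Ck_on (Suc k) S f \<longleftrightarrow>
     (\<forall>x\<in>S. f differentiable (at x)) \<and> (\<forall>v. Ck_on k S (\<lambda>x. frechet_derivative f (at x) v))"

definition smooth_on :: "'e::euclidean_space set \<Rightarrow> ('e \<Rightarrow> 'f::real_normed_vector) \<Rightarrow> bool" where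
  "smooth_on S f \<longleftrightarrow> (\<forall>k. Ck_on k S f)"

text \<open>A chart is a pair of its domain and its coordinate map; the values of the coordinate map
  outside the domain are irrelevant. The points of a manifold are the elements of the type \<open>'a\<close>,
  and its dimension is \<open>DIM('e)\<close>.\<close>

type_synonym ('a, 'e) chart = "'a set \<times> ('a \<Rightarrow> 'e)"

definition chart_inv :: "('a, 'e) chart \<Rightarrow> 'e \<Rightarrow> 'a" where
  "chart_inv c = inv_into (fst c) (snd c)"

definition is_chart :: "('a::topological_space, 'e::euclidean_space) chart \<Rightarrow> bool" where
  "is_chart c \<longleftrightarrow> open (fst c) \<and> open (snd c ` fst c) \<and>
     homeomorphism (fst c) (snd c ` fst c) (snd c) (chart_inv c)"

definition local_rep :: "('a, 'e) chart \<Rightarrow> ('b, 'f) chart \<Rightarrow> ('a \<Rightarrow> 'b) \<Rightarrow> 'e \<Rightarrow> 'f" where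
  "local_rep c d f = snd d \<circ> f \<circ> chart_inv c"

definition smooth_atlas ::
    "('a::{t2_space,second_countable_topology}, 'e::euclidean_space) chart set \<Rightarrow> bool" where
  "smooth_atlas A \<longleftrightarrow> (\<forall>c\<in>A. is_chart c) \<and> (\<Union>c\<in>A. fst c) = UNIV \<and>
     (\<forall>c\<in>A. \<forall>d\<in>A. smooth_on (snd c ` (fst c \<inter> fst d)) (local_rep c d id))"

definition euclidean_atlas :: "('e::euclidean_space, 'e) chart set" where
  "euclidean_atlas = {(UNIV, id)}"

definition prod_atlas ::
    "('a, 'e) chart set \<Rightarrow> ('b, 'f) chart set \<Rightarrow> ('a \<times> 'b, 'e \<times> 'f) chart set" where
  "prod_atlas A B = {(fst c \<times> fst d, map_prod (snd c) (snd d)) | c d. c \<in> A \<and> d \<in> B}"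

text \<open>Smoothness of a map on an open subset \<open>W\<close> of a manifold.\<close>

definition smooth_map_on ::
    "('a::topological_space, 'e::euclidean_space) chart set \<Rightarrow>
     ('b::topological_space, 'f::euclidean_space) chart set \<Rightarrow> 'a set \<Rightarrow> ('a \<Rightarrow> 'b) \<Rightarrow> bool" where
  "smooth_map_on A B W f \<longleftrightarrow> continuous_on W f \<and>
     (\<forall>c\<in>A. \<forall>d\<in>B. smooth_on (snd c ` (fst c \<inter> W \<inter> f -` fst d)) (local_rep c d f))"

definition smooth_near ::
    "('a::topological_space, 'e::euclidean_space) chart set \<Rightarrow> 'a \<Rightarrow> ('a \<Rightarrow> real) \<Rightarrow> bool" where
  "smooth_near A p f \<longleftrightarrow> (\<exists>W. open W \<and> p \<in> W \<and> smooth_map_on A euclidean_atlas W f)"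


section \<open>Tangent vectors and vector fields\<close>

text \<open>A tangent vector at \<open>p\<close> is the directional derivative that it induces on the functions
  which are smooth near \<open>p\<close>. The functional is set to 0 on all other functions, so that equality
  of functionals is equality of tangent vectors. \<open>coord_vec A c p u\<close> is the tangent vector with
  components \<open>u\<close> in the chart \<open>c\<close>.\<close>

type_synonym 'a tvec = "('a \<Rightarrow> real) \<Rightarrow> real"

definition coord_vec ::
    "('a::topological_space, 'e::euclidean_space) chart set \<Rightarrow> ('a, 'e) chart \<Rightarrow> 'a \<Rightarrow> 'e \<Rightarrow> 'a tvec"
  where
  "coord_vec A c p u = (\<lambda>f. if smooth_near A p f
     then frechet_derivative (f \<circ> chart_inv c) (at (snd c p)) u else 0)"

definition tangent_space ::
    "('a::topological_space, 'e::euclidean_space) chart set \<Rightarrow> 'a \<Rightarrow> 'a tvec set" where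
  "tangent_space A p = {coord_vec A c p u | c u. c \<in> A \<and> p \<in> fst c}"

definition components ::
    "('a::topological_space, 'e::euclidean_space) chart set \<Rightarrow> ('a, 'e) chart \<Rightarrow> 'a \<Rightarrow> 'a tvec \<Rightarrow> 'e"
  where
  "components A c p v = (THE u. v = coord_vec A c p u)"

text \<open>\<open>pushforward B \<psi> p v\<close> is the image of the tangent vector \<open>v\<close> at \<open>p\<close> under the differential
  of \<open>\<psi>\<close>, where \<open>B\<close> is the atlas of the target.\<close>

definition pushforward ::
    "('b::topological_space, 'f::euclidean_space) chart set \<Rightarrow> ('a \<Rightarrow> 'b) \<Rightarrow> 'a \<Rightarrow> 'a tvec \<Rightarrow> 'b tvec"
  where
  "pushforward B \<psi> p v = (\<lambda>f. if smooth_near B (\<psi> p) f then v (f \<circ> \<psi>) else 0)"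

definition vector_field ::
    "('a::topological_space, 'e::euclidean_space) chart set \<Rightarrow> ('a \<Rightarrow> 'a tvec) \<Rightarrow> bool" where
  "vector_field A X \<longleftrightarrow> (\<forall>p. X p \<in> tangent_space A p) \<and>
     (\<forall>c\<in>A. smooth_on (snd c ` fst c) (\<lambda>y. components A c (chart_inv c y) (X (chart_inv c y))))"

text \<open>\<open>\<phi>\<close>, defined on the open neighbourhood \<open>D\<close> of \<open>{0} \<times> M\<close>, is the local one-parameter group
  generated by \<open>X\<close>. The group law on \<open>D\<close> follows from the uniqueness of integral curves.\<close>

definition local_flow ::
    "('a::topological_space, 'e::euclidean_space) chart set \<Rightarrow> ('a \<Rightarrow> 'a tvec) \<Rightarrow>
     (real \<times> 'a) set \<Rightarrow> (real \<Rightarrow> 'a \<Rightarrow> 'a) \<Rightarrow> bool" where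
  "local_flow A X D \<phi> \<longleftrightarrow> open D \<and>
     (\<forall>x. (0, x) \<in> D \<and> \<phi> 0 x = x \<and> is_interval {t. (t, x) \<in> D}) \<and>
     smooth_map_on (prod_atlas euclidean_atlas A) A D (\<lambda>(t, x). \<phi> t x) \<and>
     (\<forall>(t, x)\<in>D. \<forall>f. smooth_near A (\<phi> t x) f \<longrightarrow>
        ((\<lambda>s. f (\<phi> s x)) has_real_derivative X (\<phi> t x) f) (at t))"


section \<open>Riemannian metrics and the tension field\<close>

type_synonym 'a metric = "'a \<Rightarrow> 'a tvec \<Rightarrow> 'a tvec \<Rightarrow> real"

definition metric_rep ::
    "('a::topological_space, 'e::euclidean_space) chart set \<Rightarrow> 'a metric \<Rightarrow> ('a, 'e) chart \<Rightarrow>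
     'e \<Rightarrow> 'e \<Rightarrow> 'e \<Rightarrow> real" where
  "metric_rep A g c y u v =
     g (chart_inv c y) (coord_vec A c (chart_inv c y) u) (coord_vec A c (chart_inv c y) v)"

definition riemannian_metric ::
    "('a::topological_space, 'e::euclidean_space) chart set \<Rightarrow> 'a metric \<Rightarrow> bool" where
  "riemannian_metric A g \<longleftrightarrow>
     (\<forall>p. \<forall>u\<in>tangent_space A p. \<forall>v\<in>tangent_space A p. g p u v = g p v u) \<and>
     (\<forall>p. \<forall>u\<in>tangent_space A p. \<forall>v\<in>tangent_space A p. \<forall>w\<in>tangent_space A p. \<forall>a b.
        g p (\<lambda>f. a * u f + b * v f) w = a * g p u w + b * g p v w) \<and>
     (\<forall>p. \<forall>u\<in>tangent_space A p. u \<noteq> (\<lambda>f. 0) \<longrightarrow> g p u u > 0) \<and>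
     (\<forall>c\<in>A. \<forall>u v. smooth_on (snd c ` fst c) (\<lambda>y. metric_rep A g c y u v))"

text \<open>The Levi-Civita connection in a chart is \<open>\<nabla>\<^sub>u V = DV u + \<Gamma> u V\<close>, where \<open>\<Gamma>\<close> is symmetric (no
  torsion) and makes the metric parallel.\<close>

definition christoffel ::
    "('a::topological_space, 'e::euclidean_space) chart set \<Rightarrow> 'a metric \<Rightarrow> ('a, 'e) chart \<Rightarrow>
     'e \<Rightarrow> 'e \<Rightarrow> 'e \<Rightarrow> 'e" where
  "christoffel A g c y = (THE \<Gamma>. bilinear \<Gamma> \<and> (\<forall>u v. \<Gamma> u v = \<Gamma> v u) \<and>
     (\<forall>u v w. frechet_derivative (\<lambda>z. metric_rep A g c z u v) (at y) w =
        metric_rep A g c y (\<Gamma> w u) v + metric_rep A g c y u (\<Gamma> w v)))"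

definition orthonormal_basis :: "('e::euclidean_space \<Rightarrow> 'e \<Rightarrow> real) \<Rightarrow> 'e set \<Rightarrow> bool" where
  "orthonormal_basis b E \<longleftrightarrow> finite E \<and> card E = DIM('e) \<and>
     (\<forall>u\<in>E. \<forall>v\<in>E. b u v = (if u = v then 1 else 0))"

text \<open>The trace of a bilinear map \<open>S\<close> with respect to an inner product \<open>b\<close> does not depend on the
  choice of the orthonormal basis.\<close>

definition metric_trace ::
    "('e::euclidean_space \<Rightarrow> 'e \<Rightarrow> real) \<Rightarrow> ('e \<Rightarrow> 'e \<Rightarrow> 'f::real_vector) \<Rightarrow> 'f" where
  "metric_trace b S = (\<Sum>e\<in>(SOME E. orthonormal_basis b E). S e e)"

text \<open>\<open>second_fundamental_form A g B h c d \<psi> y\<close> is \<open>\<nabla>d\<psi>\<close> for \<open>\<psi>: (M,g) \<rightarrow> (N,h)\<close> at the point with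
  coordinates \<open>y\<close> in \<open>c\<close>; its values, vectors tangent to \<open>N\<close>, are given by components in \<open>d\<close>. The
  connection on the bundle of linear maps from \<open>TM\<close> to \<open>\<psi>\<^sup>*TN\<close> contributes the two Christoffel
  terms.\<close>

definition second_fundamental_form ::
    "('a::topological_space, 'e::euclidean_space) chart set \<Rightarrow> 'a metric \<Rightarrow>
     ('b::topological_space, 'f::euclidean_space) chart set \<Rightarrow> 'b metric \<Rightarrow>
     ('a, 'e) chart \<Rightarrow> ('b, 'f) chart \<Rightarrow> ('a \<Rightarrow> 'b) \<Rightarrow> 'e \<Rightarrow> 'e \<Rightarrow> 'e \<Rightarrow> 'f" where
  "second_fundamental_form A g B h c d \<psi> y u v =
     (let F = local_rep c d \<psi>; DF = (\<lambda>z. frechet_derivative F (at z)) in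
        frechet_derivative (\<lambda>z. DF z v) (at y) u
        - DF y (christoffel A g c y u v)
        + christoffel B h d (F y) (DF y u) (DF y v))"

definition tension_field ::
    "('a::topological_space, 'e::euclidean_space) chart set \<Rightarrow> 'a metric \<Rightarrow>
     ('b::topological_space, 'f::euclidean_space) chart set \<Rightarrow> 'b metric \<Rightarrow>
     ('a, 'e) chart \<Rightarrow> ('b, 'f) chart \<Rightarrow> ('a \<Rightarrow> 'b) \<Rightarrow> 'a \<Rightarrow> 'f" where
  "tension_field A g B h c d \<psi> p =
     metric_trace (metric_rep A g c (snd c p)) (second_fundamental_form A g B h c d \<psi> (snd c p))"

text \<open>\<open>\<tau>(\<phi>\<^sub>t)(p)\<close> is tangent at \<open>\<phi>\<^sub>t(p)\<close>. As \<open>\<tau>(\<phi>\<^sub>0) = 0\<close>, its derivative at \<open>t = 0\<close> is a well-defined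
  vector tangent at \<open>p\<close>: differentiation of the components in any chart and covariant
  differentiation along \<open>t \<mapsto> \<phi>\<^sub>t(p)\<close> agree there. Any two local flows of \<open>X\<close> agree near
  \<open>{0} \<times> M\<close>, so the choice of \<open>D\<close> and \<open>\<phi>\<close> does not matter here and below.\<close>

definition one_harmonic_field ::
    "('a::topological_space, 'e::euclidean_space) chart set \<Rightarrow> 'a metric \<Rightarrow> ('a \<Rightarrow> 'a tvec) \<Rightarrow> bool"
  where
  "one_harmonic_field A g X \<longleftrightarrow> vector_field A X \<and> (\<exists>D \<phi>. local_flow A X D \<phi> \<and>
     (\<forall>p. \<forall>c\<in>A. p \<in> fst c \<longrightarrow>
        ((\<lambda>t. tension_field A g A g c c (\<phi> t) p) has_vector_derivative 0) (at 0)))"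

definition pullback_metric ::
    "('b::topological_space, 'f::euclidean_space) chart set \<Rightarrow> ('a \<Rightarrow> 'b) \<Rightarrow> 'b metric \<Rightarrow> 'a metric"
  where
  "pullback_metric B \<psi> h p u v = h (\<psi> p) (pushforward B \<psi> p u) (pushforward B \<psi> p v)"

text \<open>The Lie derivative of \<open>g\<close> is the derivative of \<open>\<phi>\<^sub>t\<^sup>*g\<close> at \<open>t = 0\<close>.\<close>

definition killing_field ::
    "('a::topological_space, 'e::euclidean_space) chart set \<Rightarrow> 'a metric \<Rightarrow> ('a \<Rightarrow> 'a tvec) \<Rightarrow> bool"
  where
  "killing_field A g X \<longleftrightarrow> vector_field A X \<and> (\<exists>D \<phi>. local_flow A X D \<phi> \<and>
     (\<forall>p. \<forall>u\<in>tangent_space A p. \<forall>v\<in>tangent_space A p.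
        ((\<lambda>t. pullback_metric A (\<phi> t) g p u v) has_real_derivative 0) (at 0)))"


section \<open>Lie groups\<close>

definition lie_group ::
    "'a::{t2_space,second_countable_topology} monoid \<Rightarrow> ('a, 'e::euclidean_space) chart set \<Rightarrow> bool"
  where
  "lie_group G A \<longleftrightarrow> group G \<and> carrier G = UNIV \<and> smooth_atlas A \<and>
     smooth_map_on (prod_atlas A A) A UNIV (\<lambda>(x, y). x \<otimes>\<^bsub>G\<^esub> y) \<and>
     smooth_map_on A A UNIV (\<lambda>x. inv\<^bsub>G\<^esub> x)"

primrec lower_central :: "'a monoid \<Rightarrow> nat \<Rightarrow> 'a set" where
  "lower_central G 0 = carrier G"
| "lower_central G (Suc k) = generate G
     {x \<otimes>\<^bsub>G\<^esub> y \<otimes>\<^bsub>G\<^esub> inv\<^bsub>G\<^esub> x \<otimes>\<^bsub>G\<^esub> inv\<^bsub>G\<^esub> y | x y. x \<in> lower_central G k \<and> y \<in> carrier G}"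

definition nilpotent_group :: "'a monoid \<Rightarrow> bool" where
  "nilpotent_group G \<longleftrightarrow> (\<exists>k. lower_central G k = {\<one>\<^bsub>G\<^esub>})"

definition left_invariant_metric ::
    "'a::topological_space monoid \<Rightarrow> ('a, 'e::euclidean_space) chart set \<Rightarrow> 'a metric \<Rightarrow> bool" where
  "left_invariant_metric G A h \<longleftrightarrow> riemannian_metric A h \<and>
     (\<forall>a p. \<forall>u\<in>tangent_space A p. \<forall>v\<in>tangent_space A p.
        pullback_metric A (\<lambda>x. a \<otimes>\<^bsub>G\<^esub> x) h p u v = h p u v)"

definition left_invariant_field ::
    "'a::topological_space monoid \<Rightarrow> ('a, 'e::euclidean_space) chart set \<Rightarrow> ('a \<Rightarrow> 'a tvec) \<Rightarrow> bool"
  where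
  "left_invariant_field G A X \<longleftrightarrow> vector_field A X \<and>
     (\<forall>a p. pushforward A (\<lambda>x. a \<otimes>\<^bsub>G\<^esub> x) p (X p) = X (a \<otimes>\<^bsub>G\<^esub> p))"

end

theory Submission
  imports Defs
begin

text \<open>Let \<open>S = L\<^sub>X h\<close>. The derivative at \<open>t = 0\<close> of the tension field of the flow of \<open>X\<close>, with its index lowered, is
the trace over \<open>u = v\<close> of
  \<open>T(u,v,w) = ((\<nabla>\<^sub>u S)(v,w) + (\<nabla>\<^sub>v S)(u,w) - (\<nabla>\<^sub>w S)(u,v)) / 2\<close>,
which is \<open>h((L\<^sub>X \<nabla>)(u,v), w)\<close> written in terms of \<open>S\<close> (\<open>tension_variation_eq\<close>,
\<open>second_form_has_real_derivative\<close>). So a Killing field, for which \<open>S = 0\<close>, is one-harmonic on every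
Riemannian manifold.

The converse is Yano's form of the Bochner argument: for an orthonormal frame, \<open>\<Sum> T(e,e,X)\<close> is \<open>-|S|\<^sup>2/2\<close>
up to the divergence of \<open>S(X,_)\<close> and a derivative of the trace of \<open>S\<close>. On a closed manifold these terms
are treated by integration. On a Lie group, \<open>X\<close>, \<open>h\<close> and hence \<open>S\<close> are left-invariant; then the trace of
\<open>S\<close> is constant, the divergence of a left-invariant field \<open>z\<close> is, up to sign, the trace of
\<open>u \<mapsto> [u,z]\<close>, and if these traces vanish then \<open>\<Sum> T(e,e,X) = -|S|\<^sup>2/2\<close> holds pointwise
(\<open>lie_metric_eq_0_of_divergence_free\<close>). This gives \<open>S = 0\<close> at the unit, and by left-invariance everywhere.

The traces vanish because \<open>G\<close> is nilpotent (\<open>linear_trace_bracket_eq_0\<close>). The commutator map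
\<open>x \<mapsto> x a x\<^sup>-\<^sup>1 a\<^sup>-\<^sup>1\<close> fixes the unit, and some iterate of it is constant, since its iterates take values in
the lower central series. Hence its differential \<open>K\<^sub>a\<close> at the unit is nilpotent and has trace 0.
As \<open>K\<^sub>a\<close> vanishes for \<open>a = 1\<close> and has the derivative \<open>u \<mapsto> [u,z]\<close> in the direction \<open>a' = z\<close>,
the trace of \<open>u \<mapsto> [u,z]\<close> is 0 as well.

The computations take place in charts. Both properties of \<open>X\<close> involve the local flow only through its
first derivative in \<open>t\<close> at \<open>t = 0\<close> (also of its space derivatives), which is \<open>X\<close> by definition; so they
become equations for the components of \<open>X\<close> and \<open>h\<close> (\<open>killing_field_iff\<close>, \<open>one_harmonic_field_iff\<close>).\<close>

section \<open>Calculus of smooth maps\<close>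

abbreviation dird :: "'e::real_normed_vector \<Rightarrow> ('e \<Rightarrow> 'f::real_normed_vector) \<Rightarrow> 'e \<Rightarrow> 'f" where
  "dird v f x \<equiv> frechet_derivative f (at x) v"

lemma dird_eqI: "(f has_derivative f') (at x) \<Longrightarrow> dird v f x = f' v"
  by (metis frechet_derivative_at)

lemma dird_has_derivative: "f differentiable at x \<Longrightarrow> (f has_derivative (\<lambda>v. dird v f x)) (at x)"
  using frechet_derivative_works[of f "at x"] by simp

lemma has_derivative_cong_open:
  assumes "open S" "x \<in> S" "\<And>y. y \<in> S \<Longrightarrow> f y = g y"
  shows "(f has_derivative f') (at x) \<longleftrightarrow> (g has_derivative f') (at x)"
  using assms by (metis has_derivative_transform_within_open)

lemma dird_cong_open:
  assumes "open S" "x \<in> S" "\<And>y. y \<in> S \<Longrightarrow> f y = g y"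
  shows "dird v f x = dird v g x"
  unfolding frechet_derivative_def using has_derivative_cong_open[OF assms] by simp

lemma differentiable_cong_open:
  assumes "open S" "x \<in> S" "\<And>y. y \<in> S \<Longrightarrow> f y = g y"
  shows "f differentiable at x \<longleftrightarrow> g differentiable at x"
  unfolding differentiable_def using has_derivative_cong_open[OF assms] by simp

lemma Ck_on_cong:
  assumes "open S" "\<And>y. y \<in> S \<Longrightarrow> f y = g y"
  shows "Ck_on k S f \<longleftrightarrow> Ck_on k S g"
  using assms(2)
proof (induction k arbitrary: f g)
  case 0
  then show ?case by (simp cong: continuous_on_cong)
next
  case (Suc k)
  have "dird v f x = dird v g x" if "x \<in> S" for v x
    using dird_cong_open[OF \<open>open S\<close> that Suc.prems] by simp
  then have "Ck_on k S (dird v f) \<longleftrightarrow> Ck_on k S (dird v g)" for v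
    by (intro Suc.IH)
  then show ?case
    using differentiable_cong_open[OF \<open>open S\<close> _ Suc.prems] by auto
qed

lemma Ck_on_subset: "Ck_on k S f \<Longrightarrow> T \<subseteq> S \<Longrightarrow> Ck_on k T f"
  by (induction k arbitrary: f) (auto intro: continuous_on_subset)

lemma Ck_on_local:
  assumes "\<And>x. x \<in> S \<Longrightarrow> \<exists>T. open T \<and> x \<in> T \<and> Ck_on k T f"
  shows "Ck_on k S f"
  using assms
proof (induction k arbitrary: f)
  case 0
  have "isCont f x" if "x \<in> S" for x
    using 0[OF that] by (auto simp: continuous_on_eq_continuous_at)
  then show ?case by (simp add: continuous_at_imp_continuous_on)
next
  case (Suc k)
  have "Ck_on k S (dird v f)" for v
    by (rule Suc.IH) (use Suc.prems in \<open>auto, blast\<close>)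
  moreover have "f differentiable at x" if "x \<in> S" for x
    using Suc.prems[OF that] by auto
  ultimately show ?case by simp
qed

lemma Ck_on_Suc_D: "Ck_on (Suc k) S f \<Longrightarrow> Ck_on k S f"
proof (induction k arbitrary: f)
  case 0
  then show ?case
    by (auto intro!: continuous_at_imp_continuous_on differentiable_imp_continuous_within)
next
  case (Suc k)
  show ?case
    unfolding Ck_on.simps
  proof (intro conjI allI)
    show "\<forall>x\<in>S. f differentiable at x" using Suc.prems by simp
    fix v
    have "Ck_on (Suc k) S (dird v f)" using Suc.prems by (metis Ck_on.simps(2))
    then show "Ck_on k S (dird v f)" by (rule Suc.IH)
  qed
qed

lemma Ck_on_const: "Ck_on k S (\<lambda>x. c)"
  by (induction k arbitrary: c) auto

lemma Ck_on_linear: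
  assumes "open S" "bounded_linear L" "Ck_on k S f"
  shows "Ck_on k S (\<lambda>x. L (f x))"
  using assms(3)
proof (induction k arbitrary: f)
  case 0
  then show ?case using assms by (auto intro: bounded_linear.continuous_on)
next
  case (Suc k)
  have d: "((\<lambda>x. L (f x)) has_derivative (\<lambda>v. L (dird v f x))) (at x)" if "x \<in> S" for x
    using Suc.prems that by (intro bounded_linear.has_derivative[OF assms(2)] dird_has_derivative) auto
  then have "dird v (\<lambda>x. L (f x)) x = L (dird v f x)" if "x \<in> S" for x v
    using that by (intro dird_eqI[of _ "\<lambda>v. L (dird v f x)"]) auto
  then have "Ck_on k S (dird v (\<lambda>x. L (f x))) \<longleftrightarrow> Ck_on k S (\<lambda>x. L (dird v f x))" for v
    by (intro Ck_on_cong[OF \<open>open S\<close>])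
  then show ?case using Suc d by (auto intro: differentiableI)
qed

lemma Ck_on_add:
  assumes "open S" "Ck_on k S f" "Ck_on k S g"
  shows "Ck_on k S (\<lambda>x. f x + g x)"
  using assms(2,3)
proof (induction k arbitrary: f g)
  case 0
  then show ?case by (auto intro: continuous_on_add)
next
  case (Suc k)
  have d: "((\<lambda>x. f x + g x) has_derivative (\<lambda>v. dird v f x + dird v g x)) (at x)" if "x \<in> S" for x
    using Suc.prems that by (intro has_derivative_add dird_has_derivative) auto
  then have "dird v (\<lambda>x. f x + g x) x = dird v f x + dird v g x" if "x \<in> S" for x v
    using that by (intro dird_eqI[of _ "\<lambda>v. dird v f x + dird v g x"]) auto
  then have "Ck_on k S (dird v (\<lambda>x. f x + g x)) \<longleftrightarrow> Ck_on k S (\<lambda>x. dird v f x + dird v g x)" for v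
    by (intro Ck_on_cong[OF \<open>open S\<close>])
  then show ?case using Suc d by (auto intro: differentiableI)
qed

lemma Ck_on_scaleR:
  assumes "open S" "Ck_on k S r" "Ck_on k S g"
  shows "Ck_on k S (\<lambda>x. r x *\<^sub>R g x)"
  using assms(2,3)
proof (induction k arbitrary: r g)
  case 0
  then show ?case by (auto intro: continuous_on_scaleR)
next
  case (Suc k)
  have d: "((\<lambda>x. r x *\<^sub>R g x) has_derivative (\<lambda>v. r x *\<^sub>R dird v g x + dird v r x *\<^sub>R g x)) (at x)"
    if "x \<in> S" for x
    using Suc.prems that by (intro has_derivative_scaleR dird_has_derivative) auto
  then have "dird v (\<lambda>x. r x *\<^sub>R g x) x = r x *\<^sub>R dird v g x + dird v r x *\<^sub>R g x" if "x \<in> S" for x v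
    using that by (intro dird_eqI[of _ "\<lambda>v. r x *\<^sub>R dird v g x + dird v r x *\<^sub>R g x"]) auto
  then have "Ck_on k S (dird v (\<lambda>x. r x *\<^sub>R g x)) \<longleftrightarrow>
      Ck_on k S (\<lambda>x. r x *\<^sub>R dird v g x + dird v r x *\<^sub>R g x)" for v
    by (intro Ck_on_cong[OF \<open>open S\<close>])
  moreover have "Ck_on k S (\<lambda>x. r x *\<^sub>R dird v g x + dird v r x *\<^sub>R g x)" for v
    using Suc.prems by (intro Ck_on_add[OF \<open>open S\<close>] Suc.IH) (auto dest: Ck_on_Suc_D simp del: Ck_on.simps(2), auto)
  ultimately show ?case using Suc d by (auto intro: differentiableI)
qed

lemma Ck_on_sum:
  assumes "open S" "finite I" "\<And>i. i \<in> I \<Longrightarrow> Ck_on k S (f i)"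
  shows "Ck_on k S (\<lambda>x. \<Sum>i\<in>I. f i x)"
  using assms(2,3) by (induction I rule: finite_induct) (auto intro: Ck_on_const Ck_on_add[OF \<open>open S\<close>])

text \<open>The chain rule gives \<open>D(g \<circ> f) v = \<Sum>\<^sub>b (Df v \<bullet> b) (D\<^sub>b g \<circ> f)\<close>, which has the form covered by the rules for sums
and products and by the induction hypothesis.\<close>

lemma Ck_on_compose:
  fixes f :: "'e::euclidean_space \<Rightarrow> 'f::euclidean_space" and g :: "'f \<Rightarrow> 'g::real_normed_vector"
  assumes "open S" "open T" "f ` S \<subseteq> T" "Ck_on k S f" "Ck_on k T g"
  shows "Ck_on k S (\<lambda>x. g (f x))"
  using assms(4,5)
proof (induction k arbitrary: g)
  case 0
  then show ?case using continuous_on_compose2[of T g S f] assms(3) by auto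
next
  case (Suc k)
  have fx: "f x \<in> T" if "x \<in> S" for x using assms(3) that by auto
  have lin: "bounded_linear (\<lambda>v. dird v g (f x))" if "x \<in> S" for x
    using fx[OF that] Suc.prems(2) has_derivative_bounded_linear[OF dird_has_derivative[of g "f x"]] by simp
  have d: "((\<lambda>x. g (f x)) has_derivative (\<lambda>v. dird (dird v f x) g (f x))) (at x)" if "x \<in> S" for x
    using diff_chain_at[of f "\<lambda>v. dird v f x" x g "\<lambda>v. dird v g (f x)"] Suc.prems that fx[OF that]
    by (auto simp: dird_has_derivative o_def)
  have "dird v (\<lambda>x. g (f x)) x = (\<Sum>b\<in>Basis. (dird v f x \<bullet> b) *\<^sub>R dird b g (f x))" if "x \<in> S" for x v
  proof -
    have "dird v (\<lambda>x. g (f x)) x = dird (dird v f x) g (f x)"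
      using d[OF that] by (rule dird_eqI)
    also have "\<dots> = dird (\<Sum>b\<in>Basis. (dird v f x \<bullet> b) *\<^sub>R b) g (f x)"
      by (simp add: euclidean_representation)
    also have "\<dots> = (\<Sum>b\<in>Basis. (dird v f x \<bullet> b) *\<^sub>R dird b g (f x))"
      using bounded_linear.linear[OF lin[OF that]] by (simp only: linear_sum linear_scale)
    finally show ?thesis .
  qed
  then have "Ck_on k S (dird v (\<lambda>x. g (f x))) \<longleftrightarrow>
      Ck_on k S (\<lambda>x. \<Sum>b\<in>Basis. (dird v f x \<bullet> b) *\<^sub>R dird b g (f x))" for v
    by (intro Ck_on_cong[OF \<open>open S\<close>])
  moreover have "Ck_on k S (\<lambda>x. \<Sum>b\<in>Basis. (dird v f x \<bullet> b) *\<^sub>R dird b g (f x))" for v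
  proof (intro Ck_on_sum Ck_on_scaleR \<open>open S\<close> finite_Basis)
    fix b :: 'f assume "b \<in> Basis"
    show "Ck_on k S (\<lambda>x. dird v f x \<bullet> b)"
      using Suc.prems(1) by (intro Ck_on_linear[OF \<open>open S\<close> bounded_linear_inner_left]) auto
    show "Ck_on k S (\<lambda>x. dird b g (f x))"
      using Suc.prems by (intro Suc.IH Ck_on_Suc_D[of k S f]) (blast, simp)
  qed
  ultimately show ?case using d by (auto intro: differentiableI)
qed

lemma smooth_on_cong:
  assumes "open S" "\<And>y. y \<in> S \<Longrightarrow> f y = g y"
  shows "smooth_on S f \<longleftrightarrow> smooth_on S g"
  unfolding smooth_on_def using Ck_on_cong[of S f g] assms by metis

lemma smooth_on_subset: "smooth_on S f \<Longrightarrow> T \<subseteq> S \<Longrightarrow> smooth_on T f"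
  unfolding smooth_on_def using Ck_on_subset by blast

lemma smooth_on_local:
  assumes "\<And>x. x \<in> S \<Longrightarrow> \<exists>T. open T \<and> x \<in> T \<and> smooth_on T f"
  shows "smooth_on S f"
  unfolding smooth_on_def using assms by (intro allI Ck_on_local) (auto simp: smooth_on_def)

lemma smooth_on_const: "smooth_on S (\<lambda>x. c)"
  by (simp add: smooth_on_def Ck_on_const)

lemma smooth_on_ident: "smooth_on S (\<lambda>x. x)"
proof -
  have "Ck_on k S (\<lambda>x. x)" for k
    by (cases k) (auto simp: Ck_on_const)
  then show ?thesis by (simp add: smooth_on_def)
qed

lemma smooth_on_linear:
  assumes "open S" "bounded_linear L" "smooth_on S f"
  shows "smooth_on S (\<lambda>x. L (f x))"
  using assms by (auto simp: smooth_on_def intro: Ck_on_linear)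

lemma smooth_on_add:
  assumes "open S" "smooth_on S f" "smooth_on S g"
  shows "smooth_on S (\<lambda>x. f x + g x)"
  using assms by (auto simp: smooth_on_def intro: Ck_on_add)

lemma smooth_on_diff:
  assumes "open S" "smooth_on S f" "smooth_on S g"
  shows "smooth_on S (\<lambda>x. f x - g x)"
  using smooth_on_add[OF assms(1,2) smooth_on_linear[OF assms(1) bounded_linear_minus[OF bounded_linear_ident] assms(3)]]
  by simp

lemma smooth_on_Pair:
  fixes f :: "'e::euclidean_space \<Rightarrow> 'f::real_normed_vector" and g :: "'e \<Rightarrow> 'g::real_normed_vector"
  assumes "open S" "smooth_on S f" "smooth_on S g"
  shows "smooth_on S (\<lambda>x. (f x, g x))"
proof -
  have "bounded_linear (\<lambda>y::'f. (y, 0::'g))" "bounded_linear (\<lambda>y::'g. (0::'f, y))"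
    by (intro bounded_linear_Pair bounded_linear_ident bounded_linear_zero)+
  then have "smooth_on S (\<lambda>x. (f x, 0) + (0, g x))"
    using assms smooth_on_linear[of S "\<lambda>y::'f. (y, 0::'g)" f] smooth_on_linear[of S "\<lambda>y::'g. (0::'f, y)" g]
    by (intro smooth_on_add)
  then show ?thesis by simp
qed

lemma smooth_on_compose:
  fixes f :: "'e::euclidean_space \<Rightarrow> 'f::euclidean_space" and g :: "'f \<Rightarrow> 'g::real_normed_vector"
  assumes "open S" "open T" "f ` S \<subseteq> T" "smooth_on S f" "smooth_on T g"
  shows "smooth_on S (\<lambda>x. g (f x))"
  using assms by (auto simp: smooth_on_def intro: Ck_on_compose)

lemma smooth_on_continuous: "smooth_on S f \<Longrightarrow> continuous_on S f"
  unfolding smooth_on_def by (metis Ck_on.simps(1))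

lemma smooth_on_differentiable: "smooth_on S f \<Longrightarrow> x \<in> S \<Longrightarrow> f differentiable at x"
  unfolding smooth_on_def by (metis Ck_on.simps(2))

lemma smooth_on_dird: "smooth_on S f \<Longrightarrow> smooth_on S (dird v f)"
  unfolding smooth_on_def by (metis Ck_on.simps(2))

lemma smooth_on_has_derivative:
  "smooth_on S f \<Longrightarrow> x \<in> S \<Longrightarrow> (f has_derivative (\<lambda>v. dird v f x)) (at x)"
  using smooth_on_differentiable dird_has_derivative by blast

lemma dird_linear: "f differentiable at x \<Longrightarrow> linear (\<lambda>v. dird v f x)"
  by (rule linear_frechet_derivative)

text \<open>The second difference quotient in the directions \<open>u\<close> and \<open>v\<close> does not depend on their order, while
the mean value theorem, applied first in one direction and then in the other, turns it into a value of
one of the two mixed second derivatives. This is the classical proof that they agree.\<close>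

lemma second_difference_mean_value:
  fixes f :: "'e::euclidean_space \<Rightarrow> real"
  assumes f: "smooth_on S f" and S: "ball x r \<subseteq> S" and h: "h > 0" "h * (norm u + norm v) < r"
  shows "\<exists>p\<in>ball x r. f (x + h *\<^sub>R u + h *\<^sub>R v) - f (x + h *\<^sub>R u) - f (x + h *\<^sub>R v) + f x
           = h * (h * dird v (dird u f) p)"
proof -
  have inS: "x + s *\<^sub>R u + t *\<^sub>R v \<in> ball x r" if "0 \<le> s" "s \<le> h" "0 \<le> t" "t \<le> h" for s t
  proof -
    have "norm (s *\<^sub>R u + t *\<^sub>R v) \<le> s * norm u + t * norm v"
      using norm_triangle_ineq[of "s *\<^sub>R u" "t *\<^sub>R v"] that by simp
    also have "\<dots> \<le> h * norm u + h * norm v"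
      using that by (intro add_mono mult_right_mono) auto
    also have "\<dots> < r" using h by (simp add: algebra_simps)
    finally have "norm (s *\<^sub>R u + t *\<^sub>R v) < r" .
    then show ?thesis by (simp add: dist_norm algebra_simps norm_minus_commute)
  qed
  define \<phi> where "\<phi> s = f (x + s *\<^sub>R u + h *\<^sub>R v) - f (x + s *\<^sub>R u + 0 *\<^sub>R v)" for s
  have D: "((\<lambda>s. g (x + s *\<^sub>R u + t *\<^sub>R v)) has_real_derivative dird u g (x + s *\<^sub>R u + t *\<^sub>R v)) (at s)"
    if "g differentiable at (x + s *\<^sub>R u + t *\<^sub>R v)" for s t and g :: "'e \<Rightarrow> real" and u v x
  proof -
    have "((\<lambda>s. x + s *\<^sub>R u + t *\<^sub>R v) has_derivative (\<lambda>s. s *\<^sub>R u)) (at s)"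
      by (auto intro!: derivative_eq_intros)
    from diff_chain_at[OF this dird_has_derivative[OF that]]
    show ?thesis
      using linear_scale[OF dird_linear[OF that]]
      by (simp add: has_field_derivative_def o_def mult_commute_abs)
  qed
  have "\<exists>s. 0 < s \<and> s < h \<and> \<phi> h - \<phi> 0 =
      (h - 0) * (dird u f (x + s *\<^sub>R u + h *\<^sub>R v) - dird u f (x + s *\<^sub>R u + 0 *\<^sub>R v))"
  proof (intro MVT2 h)
    fix s assume "0 \<le> s" "s \<le> h"
    then show "(\<phi> has_real_derivative dird u f (x + s *\<^sub>R u + h *\<^sub>R v) - dird u f (x + s *\<^sub>R u + 0 *\<^sub>R v)) (at s)"
      unfolding \<phi>_def using h S inS[of s h] inS[of s 0]
      by (intro DERIV_diff D smooth_on_differentiable[OF f]) auto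
  qed
  then obtain s where s: "0 < s" "s < h" and
    e1: "\<phi> h - \<phi> 0 = h * (dird u f (x + s *\<^sub>R u + h *\<^sub>R v) - dird u f (x + s *\<^sub>R u + 0 *\<^sub>R v))" by auto
  define \<psi> where "\<psi> t = dird u f (x + t *\<^sub>R v + s *\<^sub>R u)" for t
  have "\<exists>t. 0 < t \<and> t < h \<and> \<psi> h - \<psi> 0 = (h - 0) * dird v (dird u f) (x + t *\<^sub>R v + s *\<^sub>R u)"
  proof (intro MVT2 h)
    fix t assume "0 \<le> t" "t \<le> h"
    then show "(\<psi> has_real_derivative dird v (dird u f) (x + t *\<^sub>R v + s *\<^sub>R u)) (at t)"
      unfolding \<psi>_def using h s S inS[of s t]
      by (intro D smooth_on_differentiable[OF smooth_on_dird[OF f]]) (auto simp: algebra_simps)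
  qed
  then obtain t where t: "0 < t" "t < h" and
    e2: "\<psi> h - \<psi> 0 = h * dird v (dird u f) (x + t *\<^sub>R v + s *\<^sub>R u)" by auto
  have "x + t *\<^sub>R v + s *\<^sub>R u \<in> ball x r" using inS[of s t] s t by (simp add: algebra_simps)
  moreover have "f (x + h *\<^sub>R u + h *\<^sub>R v) - f (x + h *\<^sub>R u) - f (x + h *\<^sub>R v) + f x
      = h * (h * dird v (dird u f) (x + t *\<^sub>R v + s *\<^sub>R u))"
    using e1 e2 by (simp add: \<phi>_def \<psi>_def algebra_simps)
  ultimately show ?thesis by blast
qed

lemma dird_commute_real:
  fixes f :: "'e::euclidean_space \<Rightarrow> real"
  assumes f: "smooth_on S f" and S: "open S" "x \<in> S"
  shows "dird u (dird v f) x = dird v (dird u f) x"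
proof (rule ccontr)
  define a where "a = dird u (dird v f) x"
  define b where "b = dird v (dird u f) x"
  assume "\<not> ?thesis"
  then have e: "\<bar>a - b\<bar> / 2 > 0" by (simp add: a_def b_def)
  have cont: "isCont (dird u (dird v f)) x" "isCont (dird v (dird u f)) x"
    using S smooth_on_continuous[OF smooth_on_dird[OF smooth_on_dird[OF f]]]
    by (auto simp: continuous_on_eq_continuous_at)
  obtain d1 where d1: "d1 > 0" "\<And>y. dist y x < d1 \<Longrightarrow> \<bar>dird u (dird v f) y - a\<bar> < \<bar>a - b\<bar> / 2"
    using cont(1) e unfolding continuous_at_eps_delta dist_real_def a_def by blast
  obtain d2 where d2: "d2 > 0" "\<And>y. dist y x < d2 \<Longrightarrow> \<bar>dird v (dird u f) y - b\<bar> < \<bar>a - b\<bar> / 2"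
    using cont(2) e unfolding continuous_at_eps_delta dist_real_def b_def by blast
  obtain d3 where d3: "d3 > 0" "ball x d3 \<subseteq> S" using S openE by blast
  define r where "r = Min {d1, d2, d3}"
  have r: "r > 0" "r \<le> d1" "r \<le> d2" "r \<le> d3" using d1 d2 d3 by (auto simp: r_def)
  \<comment> \<open>The summand 1 avoids a division by zero if \<open>u = v = 0\<close>.\<close>
  define h where "h = r / (norm u + norm v + 1)"
  have pos: "norm u + norm v + 1 > 0" by (simp add: add_nonneg_pos)
  have h: "h > 0" "h * (norm u + norm v) < r"
    using r pos by (auto simp: h_def field_simps)
  have bS: "ball x r \<subseteq> S" using d3 r by auto
  obtain p where p: "p \<in> ball x r"
    "f (x + h *\<^sub>R u + h *\<^sub>R v) - f (x + h *\<^sub>R u) - f (x + h *\<^sub>R v) + f x = h * (h * dird v (dird u f) p)"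
    using second_difference_mean_value[OF f bS h] by blast
  have h': "h * (norm v + norm u) < r" using h by (simp add: add.commute)
  obtain q where q: "q \<in> ball x r"
    "f (x + h *\<^sub>R v + h *\<^sub>R u) - f (x + h *\<^sub>R v) - f (x + h *\<^sub>R u) + f x = h * (h * dird u (dird v f) q)"
    using second_difference_mean_value[OF f bS h(1) h'] by blast
  have "h * (h * dird v (dird u f) p) = h * (h * dird u (dird v f) q)"
    using p(2) q(2) by (simp add: algebra_simps)
  then have "dird v (dird u f) p = dird u (dird v f) q" using h by simp
  moreover have "\<bar>dird v (dird u f) p - b\<bar> < \<bar>a - b\<bar> / 2"
    using p(1) r by (intro d2) (auto simp: dist_commute)
  moreover have "\<bar>dird u (dird v f) q - a\<bar> < \<bar>a - b\<bar> / 2"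
    using q(1) r by (intro d1) (auto simp: dist_commute)
  ultimately show False using abs_triangle_ineq4[of "dird v (dird u f) p - b" "dird v (dird u f) p - a"] by simp
qed

lemma dird_linear_image:
  assumes "bounded_linear L" "f differentiable at x"
  shows "dird v (\<lambda>y. L (f y)) x = L (dird v f x)"
  using bounded_linear.has_derivative[OF assms(1) dird_has_derivative[OF assms(2)]] by (rule dird_eqI)

lemma dird_commute:
  fixes f :: "'e::euclidean_space \<Rightarrow> 'f::euclidean_space"
  assumes f: "smooth_on S f" and S: "open S" "x \<in> S"
  shows "dird u (dird v f) x = dird v (dird u f) x"
proof (rule euclidean_eqI)
  fix b :: 'f assume "b \<in> Basis"
  have *: "dird u (dird v f) x \<bullet> b = dird u (dird v (\<lambda>y. f y \<bullet> b)) x" for u v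
  proof -
    have "dird u (dird v (\<lambda>y. f y \<bullet> b)) x = dird u (\<lambda>y. dird v f y \<bullet> b) x"
      using S by (intro dird_cong_open[of S] dird_linear_image bounded_linear_inner_left
          smooth_on_differentiable[OF f])
    also have "\<dots> = dird u (dird v f) x \<bullet> b"
      by (intro dird_linear_image bounded_linear_inner_left smooth_on_differentiable[OF smooth_on_dird[OF f] S(2)])
    finally show ?thesis by simp
  qed
  have "smooth_on S (\<lambda>y. f y \<bullet> b)"
    using smooth_on_linear[OF S(1) bounded_linear_inner_left f] .
  then show "dird u (dird v f) x \<bullet> b = dird v (dird u f) x \<bullet> b"
    using dird_commute_real[OF _ S] * by simp
qed

lemma has_derivative_slice_right:
  assumes "F differentiable at (t, z)"
  shows "((\<lambda>x. F (t, x)) has_derivative (\<lambda>v. dird (0, v) F (t, z))) (at z)"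
proof -
  have "((\<lambda>x. (t, x)) has_derivative (\<lambda>v. (0, v))) (at z)"
    by (auto intro!: derivative_eq_intros)
  from diff_chain_at[OF this dird_has_derivative[OF assms]] show ?thesis by (simp add: o_def)
qed

lemma has_derivative_slice_left:
  assumes "F differentiable at (t, z)"
  shows "((\<lambda>s. F (s, z)) has_derivative (\<lambda>v. dird (v, 0) F (t, z))) (at t)"
proof -
  have "((\<lambda>x. (x, z)) has_derivative (\<lambda>v. (v, 0))) (at t)"
    by (auto intro!: derivative_eq_intros)
  from diff_chain_at[OF this dird_has_derivative[OF assms]] show ?thesis by (simp add: o_def)
qed

lemma has_vector_derivative_slice_left:
  fixes F :: "real \<times> 'e::real_normed_vector \<Rightarrow> 'f::real_normed_vector"
  assumes "F differentiable at (t, z)"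
  shows "((\<lambda>s. F (s, z)) has_vector_derivative dird (1, 0) F (t, z)) (at t)"
proof -
  have "((\<lambda>s. (s, z)) has_derivative (\<lambda>h. (h, 0))) (at t)"
    by (auto intro!: derivative_eq_intros)
  from diff_chain_at[OF this dird_has_derivative[OF assms]]
  have "((\<lambda>s. F (s, z)) has_derivative (\<lambda>h. dird (h, 0) F (t, z))) (at t)" by (simp add: o_def)
  moreover have "(\<lambda>h. dird (h, 0) F (t, z)) = (\<lambda>h. h *\<^sub>R dird (1, 0) F (t, z))"
  proof
    fix h show "dird (h, 0) F (t, z) = h *\<^sub>R dird (1, 0) F (t, z)"
      using linear_scale[OF dird_linear[OF assms], of h "(1, 0)"] by simp
  qed
  ultimately show ?thesis by (simp only: has_vector_derivative_def)
qed

lemma open_slice_right: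
  assumes "open N"
  shows "open {z. (t, z) \<in> N}"
proof -
  have "continuous_on UNIV (\<lambda>z. (t, z))" by (intro continuous_intros)
  from open_vimage[OF assms this] show ?thesis by (simp add: vimage_def)
qed

lemma open_slice_left:
  assumes "open N"
  shows "open {t. (t, z) \<in> N}"
proof -
  have "continuous_on UNIV (\<lambda>t. (t, z))" by (intro continuous_intros)
  from open_vimage[OF assms this] show ?thesis by (simp add: vimage_def)
qed

text \<open>The product rule for the derivative of \<open>f\<close> along a varying vector \<open>w\<close>. The first term contains a second derivative of \<open>f\<close>,
written in the order that keeps the direction of differentiation innermost; this uses the symmetry of
second derivatives.\<close>

lemma dird_along_field_has_derivative:
  fixes f :: "'e::euclidean_space \<Rightarrow> 'f::euclidean_space" and w :: "'e \<Rightarrow> 'e"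
  assumes f: "smooth_on S f" and S: "open S" "y \<in> S" and w: "(w has_derivative w') (at y)"
  shows "((\<lambda>x. dird (w x) f x) has_derivative (\<lambda>u. dird (w y) (dird u f) y + dird (w' u) f y)) (at y)"
proof -
  have exp: "dird v f x = (\<Sum>b\<in>Basis. (v \<bullet> b) *\<^sub>R dird b f x)" if "x \<in> S" for v x
  proof -
    have lin: "linear (\<lambda>v. dird v f x)" by (rule dird_linear[OF smooth_on_differentiable[OF f that]])
    have "dird v f x = dird (\<Sum>b\<in>Basis. (v \<bullet> b) *\<^sub>R b) f x" by (simp add: euclidean_representation)
    also have "\<dots> = (\<Sum>b\<in>Basis. (v \<bullet> b) *\<^sub>R dird b f x)"
      using linear_sum[OF lin, of "\<lambda>b. (v \<bullet> b) *\<^sub>R b" Basis] linear_scale[OF lin] by simp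
    finally show ?thesis .
  qed
  have exp2: "dird (w y) (dird u f) y = (\<Sum>b\<in>Basis. (w y \<bullet> b) *\<^sub>R dird u (dird b f) y)" for u
  proof -
    have lin: "linear (\<lambda>v. dird v (dird u f) y)"
      by (rule dird_linear[OF smooth_on_differentiable[OF smooth_on_dird[OF f] S(2)]])
    have "dird (w y) (dird u f) y = dird (\<Sum>b\<in>Basis. (w y \<bullet> b) *\<^sub>R b) (dird u f) y" by (simp add: euclidean_representation)
    also have "\<dots> = (\<Sum>b\<in>Basis. (w y \<bullet> b) *\<^sub>R dird b (dird u f) y)"
      using linear_sum[OF lin, of "\<lambda>b. (w y \<bullet> b) *\<^sub>R b" Basis] linear_scale[OF lin] by simp
    also have "\<dots> = (\<Sum>b\<in>Basis. (w y \<bullet> b) *\<^sub>R dird u (dird b f) y)"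
      by (intro sum.cong refl arg_cong2[where f = scaleR] dird_commute[OF f S])
    finally show ?thesis .
  qed
  have "((\<lambda>x. \<Sum>b\<in>Basis. (w x \<bullet> b) *\<^sub>R dird b f x) has_derivative
      (\<lambda>u. \<Sum>b\<in>Basis. (w y \<bullet> b) *\<^sub>R dird u (dird b f) y + (w' u \<bullet> b) *\<^sub>R dird b f y)) (at y)"
    by (intro has_derivative_sum has_derivative_scaleR has_derivative_inner_left w
        smooth_on_has_derivative[OF smooth_on_dird[OF f] S(2)])
  moreover have "(\<lambda>u. \<Sum>b\<in>Basis. (w y \<bullet> b) *\<^sub>R dird u (dird b f) y + (w' u \<bullet> b) *\<^sub>R dird b f y)
     = (\<lambda>u. dird (w y) (dird u f) y + dird (w' u) f y)"
  proof
    fix u show "(\<Sum>b\<in>Basis. (w y \<bullet> b) *\<^sub>R dird u (dird b f) y + (w' u \<bullet> b) *\<^sub>R dird b f y) = dird (w y) (dird u f) y + dird (w' u) f y"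
      unfolding sum.distrib exp2[symmetric] exp[OF S(2), symmetric] ..
  qed
  ultimately show ?thesis
    using has_derivative_cong_open[OF S, of "\<lambda>x. \<Sum>b\<in>Basis. (w x \<bullet> b) *\<^sub>R dird b f x" "\<lambda>x. dird (w x) f x"] exp
    by simp
qed

text \<open>By the chain rule, the differential of an iterate at a fixed point is the iterate of the differential.\<close>

lemma funpow_derivative_zero:
  fixes f :: "'e::euclidean_space \<Rightarrow> 'e"
  assumes f: "(f has_derivative f') (at a)" "f a = a" and k: "\<forall>\<^sub>F x in nhds a. (f ^^ k) x = a"
  shows "(f' ^^ k) v = 0"
proof -
  have fixed: "(f ^^ j) a = a" for j by (induction j) (auto simp: f(2))
  have d: "((f ^^ j) has_derivative (f' ^^ j)) (at a)" for j
  proof (induction j)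
    case 0
    then show ?case by (simp add: has_derivative_ident id_def)
  next
    case (Suc j)
    have "(f has_derivative f') (at ((f ^^ j) a))" using f(1) fixed by simp
    from diff_chain_at[OF Suc this] show ?case by (simp add: o_def)
  qed
  obtain S where S: "open S" "a \<in> S" "\<And>x. x \<in> S \<Longrightarrow> (f ^^ k) x = a"
    using k unfolding eventually_nhds by blast
  have "((f ^^ k) has_derivative (\<lambda>x. 0)) (at a)"
    using has_derivative_cong_open[OF S(1,2), of "f ^^ k" "\<lambda>x. a"] S(3) by simp
  then have "f' ^^ k = (\<lambda>x. 0)" using d[of k] has_derivative_unique by blast
  then show ?thesis by simp
qed

section \<open>Inner products and traces\<close>

text \<open>Inner products other than the one of the type class: the metric of a manifold at a point.\<close>

definition inner_form :: "('e::euclidean_space \<Rightarrow> 'e \<Rightarrow> real) \<Rightarrow> bool" where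
  "inner_form b \<longleftrightarrow> bilinear b \<and> (\<forall>u v. b u v = b v u) \<and> (\<forall>u. u \<noteq> 0 \<longrightarrow> b u u > 0)"

lemma inner_formD:
  assumes "inner_form b"
  shows inner_form_bilinear: "bilinear b"
    and inner_form_commute: "b u v = b v u"
    and inner_form_pos: "u \<noteq> 0 \<Longrightarrow> b u u > 0"
  using assms by (auto simp: inner_form_def)

lemma bilinear_linear_left: "bilinear b \<Longrightarrow> linear (\<lambda>u. b u v)"
  and bilinear_linear_right: "bilinear b \<Longrightarrow> linear (\<lambda>v. b u v)"
  by (simp_all add: bilinear_def)

lemma bilinear_combination_left:
  fixes b :: "'e::real_vector \<Rightarrow> 'f::real_vector \<Rightarrow> real"
  assumes "bilinear b"
  shows "b (\<Sum>x\<in>A. c x *\<^sub>R f x) v = (\<Sum>x\<in>A. c x * b (f x) v)"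
  using linear_sum[OF bilinear_linear_left[OF assms, of v], of "\<lambda>x. c x *\<^sub>R f x" A]
    linear_scale[OF bilinear_linear_left[OF assms, of v]] by simp

lemma bilinear_combination_right:
  fixes b :: "'e::real_vector \<Rightarrow> 'f::real_vector \<Rightarrow> real"
  assumes "bilinear b"
  shows "b v (\<Sum>x\<in>A. c x *\<^sub>R f x) = (\<Sum>x\<in>A. c x * b v (f x))"
  using linear_sum[OF bilinear_linear_right[OF assms, of v], of "\<lambda>x. c x *\<^sub>R f x" A]
    linear_scale[OF bilinear_linear_right[OF assms, of v]] by simp

lemma bilinear_basis_expansion:
  fixes b :: "'e::euclidean_space \<Rightarrow> 'e \<Rightarrow> real"
  assumes "bilinear b"
  shows "b u v = (\<Sum>i\<in>Basis. \<Sum>j\<in>Basis. (u \<bullet> i) * ((v \<bullet> j) * b i j))"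
proof -
  have "b u v = b (\<Sum>i\<in>Basis. (u \<bullet> i) *\<^sub>R i) v" by (simp add: euclidean_representation)
  also have "\<dots> = (\<Sum>i\<in>Basis. (u \<bullet> i) * b i v)"
    by (rule bilinear_combination_left[OF assms])
  also have "\<dots> = (\<Sum>i\<in>Basis. (u \<bullet> i) * b i (\<Sum>j\<in>Basis. (v \<bullet> j) *\<^sub>R j))"
    by (simp add: euclidean_representation)
  also have "\<dots> = (\<Sum>i\<in>Basis. (u \<bullet> i) * (\<Sum>j\<in>Basis. (v \<bullet> j) * b i j))"
    by (simp only: bilinear_combination_right[OF assms])
  finally show ?thesis by (simp add: sum_distrib_left)
qed

lemma inner_form_nondegenerate:
  assumes "inner_form b" "\<And>w. b u w = b v w"
  shows "u = v"
proof (rule ccontr)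
  assume "u \<noteq> v"
  then have "b (u - v) (u - v) > 0" using assms(1) by (simp add: inner_form_def)
  moreover have "b (u - v) (u - v) = b u (u - v) - b v (u - v)"
    using linear_diff[OF bilinear_linear_left[OF inner_form_bilinear[OF assms(1)]]] .
  ultimately show False using assms(2) by simp
qed

lemma orthonormal_coefficient:
  fixes b :: "'e::euclidean_space \<Rightarrow> 'e \<Rightarrow> real"
  assumes b: "bilinear b" and E: "finite E" "\<forall>u\<in>E. \<forall>v\<in>E. b u v = (if u = v then 1 else 0)" and v: "v \<in> E"
  shows "b (\<Sum>e\<in>E. c e *\<^sub>R e) v = c v"
proof -
  have "b (\<Sum>e\<in>E. c e *\<^sub>R e) v = (\<Sum>e\<in>E. c e * b e v)"
    by (rule bilinear_combination_left[OF b])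
  also have "\<dots> = (\<Sum>e\<in>E. if e = v then c e else 0)"
    using E v by (intro sum.cong) auto
  finally show ?thesis using E v by simp
qed

lemma orthonormal_independent:
  fixes b :: "'e::euclidean_space \<Rightarrow> 'e \<Rightarrow> real"
  assumes "bilinear b" "finite E" "\<forall>u\<in>E. \<forall>v\<in>E. b u v = (if u = v then 1 else 0)"
  shows "independent E"
proof (rule independent_if_scalars_zero[OF assms(2)])
  fix c and x :: 'e assume "(\<Sum>e\<in>E. c e *\<^sub>R e) = 0" "x \<in> E"
  then show "c x = 0"
    using orthonormal_coefficient[OF assms(1-3) \<open>x \<in> E\<close>, of c] linear_0[OF bilinear_linear_left[OF assms(1)]] by simp
qed

text \<open>One step of the Gram-Schmidt process adds a vector to an orthonormal set that does not yet span.\<close>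

lemma orthonormal_set_exists:
  fixes b :: "'e::euclidean_space \<Rightarrow> 'e \<Rightarrow> real"
  assumes b: "inner_form b" and "n \<le> DIM('e)"
  shows "\<exists>E. finite E \<and> card E = n \<and> (\<forall>u\<in>E. \<forall>v\<in>E. b u v = (if u = v then 1 else 0))"
  using assms(2)
proof (induction n)
  case 0
  then show ?case by (intro exI[of _ "{}"]) auto
next
  case (Suc n)
  then obtain E where E: "finite E" "card E = n" "\<forall>u\<in>E. \<forall>v\<in>E. b u v = (if u = v then 1 else 0)"
    by auto
  note bil = inner_form_bilinear[OF b]
  have "dim E < DIM('e)" using E Suc.prems dim_le_card'[OF E(1)] by linarith
  then have "span E \<noteq> UNIV" by (metis dim_span dim_UNIV less_irrefl)
  then obtain x where x: "x \<notin> span E" by auto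
  define y where "y = x - (\<Sum>e\<in>E. b x e *\<^sub>R e)"
  have "y \<notin> span E"
  proof
    assume "y \<in> span E"
    moreover have "(\<Sum>e\<in>E. b x e *\<^sub>R e) \<in> span E"
      by (intro span_sum span_scale span_base)
    ultimately have "y + (\<Sum>e\<in>E. b x e *\<^sub>R e) \<in> span E" by (rule span_add)
    then show False using x by (simp add: y_def)
  qed
  then have "y \<noteq> 0" by (metis span_zero)
  then have pos: "b y y > 0" using b by (simp add: inner_form_def)
  have y0: "b y e = 0" if "e \<in> E" for e
    unfolding y_def using linear_diff[OF bilinear_linear_left[OF bil]] orthonormal_coefficient[OF bil E(1,3) that]
    by simp
  define z where "z = (1 / sqrt (b y y)) *\<^sub>R y"
  have sc: "b (r *\<^sub>R y) v = r * b y v" "b v (r *\<^sub>R y) = r * b v y" for r v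
    using linear_scale[OF bilinear_linear_left[OF bil]] linear_scale[OF bilinear_linear_right[OF bil]] by auto
  have zz: "b z z = 1" using pos by (simp add: z_def sc)
  have z0: "b z e = 0" "b e z = 0" if "e \<in> E" for e
    using y0[OF that] inner_form_commute[OF b, of e z] by (auto simp: z_def sc)
  have "z \<notin> E" using z0 zz by force
  then show ?case
    using E z0 zz by (intro exI[of _ "insert z E"]) auto
qed

lemma orthonormal_basis_exists:
  assumes "inner_form b"
  shows "\<exists>E. orthonormal_basis b E"
  using orthonormal_set_exists[OF assms order_refl] by (auto simp: orthonormal_basis_def)

lemma orthonormal_basis_expansion:
  fixes b :: "'e::euclidean_space \<Rightarrow> 'e \<Rightarrow> real"
  assumes b: "bilinear b" and E: "orthonormal_basis b E"
  shows "u = (\<Sum>e\<in>E. b u e *\<^sub>R e)"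
proof -
  have E': "finite E" "card E = DIM('e)" "\<forall>u\<in>E. \<forall>v\<in>E. b u v = (if u = v then 1 else 0)"
    using E by (auto simp: orthonormal_basis_def)
  have "UNIV \<subseteq> span E"
    using orthonormal_independent[OF b E'(1,3)] E'(2) by (intro card_ge_dim_independent) auto
  then obtain c where c: "u = (\<Sum>e\<in>E. c e *\<^sub>R e)"
    using span_finite[OF E'(1)] by auto
  have "(\<Sum>e\<in>E. b u e *\<^sub>R e) = (\<Sum>e\<in>E. c e *\<^sub>R e)"
    unfolding c using orthonormal_coefficient[OF b E'(1,3)] by (intro sum.cong) auto
  then show ?thesis using c by simp
qed

definition linear_trace :: "('e::euclidean_space \<Rightarrow> 'e) \<Rightarrow> real" where
  "linear_trace f = (\<Sum>b\<in>Basis. f b \<bullet> b)"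

lemma linear_trace_compose_commute:
  fixes f g :: "'e::euclidean_space \<Rightarrow> 'e"
  assumes "linear f" "linear g"
  shows "linear_trace (f \<circ> g) = linear_trace (g \<circ> f)"
proof -
  have *: "f (g b) \<bullet> b = (\<Sum>c\<in>Basis. (g b \<bullet> c) * (f c \<bullet> b))" if "linear f" for f g :: "'e \<Rightarrow> 'e" and b
  proof -
    have "f (g b) \<bullet> b = f (\<Sum>c\<in>Basis. (g b \<bullet> c) *\<^sub>R c) \<bullet> b" by (simp add: euclidean_representation)
    also have "\<dots> = (\<Sum>c\<in>Basis. (g b \<bullet> c) * (f c \<bullet> b))"
      using that by (simp add: linear_sum linear_scale inner_sum_left)
    finally show ?thesis .
  qed
  have "linear_trace (f \<circ> g) = (\<Sum>b\<in>Basis. \<Sum>c\<in>Basis. (g b \<bullet> c) * (f c \<bullet> b))"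
    by (simp add: linear_trace_def *[OF assms(1)])
  also have "\<dots> = (\<Sum>c\<in>Basis. \<Sum>b\<in>Basis. (f c \<bullet> b) * (g b \<bullet> c))"
    by (subst sum.swap) (simp add: mult.commute)
  also have "\<dots> = linear_trace (g \<circ> f)"
    by (simp add: linear_trace_def *[OF assms(2)])
  finally show ?thesis .
qed

text \<open>Choose a linear \<open>h\<close> with \<open>f h f = f\<close>. Then \<open>f = (f h) f\<close> and \<open>m = f (f h)\<close> have the same trace, and
\<open>m\<close> is nilpotent of smaller order, because \<open>m\<close> maps into the range of \<open>f\<close> and agrees with \<open>f\<close> there.\<close>

lemma linear_trace_nilpotent:
  fixes f :: "'e::euclidean_space \<Rightarrow> 'e"
  assumes "linear f" "\<And>x. (f ^^ k) x = 0"
  shows "linear_trace f = 0"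
  using assms
proof (induction k arbitrary: f)
  case 0
  then have "f b = 0" for b by (metis funpow_0)
  then show ?case by (simp add: linear_trace_def)
next
  case (Suc k)
  show ?case
  proof (cases k)
    case 0
    then have "f b = 0" for b using Suc.prems(2)[of b] by simp
    then show ?thesis by (simp add: linear_trace_def)
  next
    case k: (Suc j)
    obtain h where h: "linear h" "\<And>x. f (h (f x)) = f x"
      using linear_exists_right_inverse_on[OF Suc.prems(1) subspace_UNIV] by auto
    define m where "m = f \<circ> (f \<circ> h)"
    have lin: "linear (f \<circ> h)" "linear m"
      using Suc.prems(1) h(1) by (auto simp: m_def linear_compose)
    have "linear_trace f = linear_trace ((f \<circ> h) \<circ> f)" by (simp add: linear_trace_def h(2))
    also have "\<dots> = linear_trace m"
      unfolding m_def by (rule linear_trace_compose_commute[OF lin(1) Suc.prems(1)])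
    also have "\<dots> = 0"
    proof (rule Suc.IH[OF lin(2)])
      have mf: "m (f x) = f (f x)" for x by (simp add: m_def h(2))
      have *: "(m ^^ i) (f x) = (f ^^ i) (f x)" for i x
      proof (induction i arbitrary: x)
        case (Suc i)
        show ?case by (simp add: funpow_Suc_right mf Suc.IH del: funpow.simps)
      qed simp
      show "(m ^^ k) x = 0" for x
      proof -
        have "(m ^^ k) x = (m ^^ j) (m x)" by (simp add: k funpow_Suc_right del: funpow.simps)
        also have "\<dots> = (f ^^ j) (f (f (h x)))" using * by (simp add: m_def)
        also have "\<dots> = (f ^^ Suc k) (h x)" by (simp add: k funpow_Suc_right del: funpow.simps)
        finally show ?thesis using Suc.prems(2) by simp
      qed
    qed
    finally show ?thesis .
  qed
qed

text \<open>The trace of an endomorphism does not depend on the inner product by which it is computed.\<close>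

lemma linear_trace_orthonormal_basis:
  fixes b :: "'e::euclidean_space \<Rightarrow> 'e \<Rightarrow> real"
  assumes b: "inner_form b" and E: "orthonormal_basis b E" and f: "linear f"
  shows "(\<Sum>e\<in>E. b (f e) e) = linear_trace f"
proof -
  note bil = inner_form_bilinear[OF b]
  have "linear_trace f = (\<Sum>c\<in>Basis. f (\<Sum>e\<in>E. b c e *\<^sub>R e) \<bullet> c)"
    unfolding linear_trace_def by (metis orthonormal_basis_expansion[OF bil E])
  also have "\<dots> = (\<Sum>c\<in>Basis. \<Sum>e\<in>E. b c e * (f e \<bullet> c))"
    using f by (simp add: linear_sum linear_scale inner_sum_left)
  also have "\<dots> = (\<Sum>e\<in>E. \<Sum>c\<in>Basis. (f e \<bullet> c) * b c e)"
    by (subst sum.swap) (simp add: mult.commute)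
  also have "\<dots> = (\<Sum>e\<in>E. b (\<Sum>c\<in>Basis. (f e \<bullet> c) *\<^sub>R c) e)"
    by (simp only: bilinear_combination_left[OF bil])
  finally show ?thesis by (simp add: euclidean_representation)
qed

section \<open>Differentiation of bilinear families\<close>

lemma bilinear_family_dird_expansion:
  fixes q :: "'e::euclidean_space \<Rightarrow> 'f::euclidean_space \<Rightarrow> 'f \<Rightarrow> real"
  assumes S: "open S" "z \<in> S" and bil: "\<And>x. x \<in> S \<Longrightarrow> bilinear (q x)"
    and dif: "\<And>u v. (\<lambda>x. q x u v) differentiable at z"
  shows "dird w (\<lambda>x. q x u v) z =
    (\<Sum>i\<in>Basis. \<Sum>j\<in>Basis. (u \<bullet> i) * ((v \<bullet> j) * dird w (\<lambda>x. q x i j) z))"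
proof -
  have "dird w (\<lambda>x. q x u v) z = dird w (\<lambda>x. \<Sum>i\<in>Basis. \<Sum>j\<in>Basis. (u \<bullet> i) * ((v \<bullet> j) * q x i j)) z"
    using S by (rule dird_cong_open) (rule bilinear_basis_expansion[OF bil])
  also have "\<dots> = (\<Sum>i\<in>Basis. \<Sum>j\<in>Basis. (u \<bullet> i) * ((v \<bullet> j) * dird w (\<lambda>x. q x i j) z))"
    by (rule dird_eqI)
      (intro has_derivative_sum has_derivative_mult_right dird_has_derivative dif)
  finally show ?thesis .
qed

lemma bilinear_family_dird:
  fixes q :: "'e::euclidean_space \<Rightarrow> 'f::euclidean_space \<Rightarrow> 'f \<Rightarrow> real"
  assumes "open S" "z \<in> S" "\<And>x. x \<in> S \<Longrightarrow> bilinear (q x)"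
    and "\<And>u v. (\<lambda>x. q x u v) differentiable at z"
  shows "bilinear (\<lambda>u v. dird w (\<lambda>x. q x u v) z)"
proof -
  define d where "d i j = dird w (\<lambda>x. q x i j) z" for i j
  have "(\<lambda>u v. dird w (\<lambda>x. q x u v) z) = (\<lambda>u v. \<Sum>i\<in>Basis. \<Sum>j\<in>Basis. (u \<bullet> i) * ((v \<bullet> j) * d i j))"
    unfolding d_def by (intro ext bilinear_family_dird_expansion[OF assms])
  then show ?thesis
    by (simp add: bilinear_def linear_iff inner_add_left algebra_simps sum.distrib sum_distrib_left)
qed

text \<open>A family of bilinear forms is only known to be differentiable after evaluation at fixed vectors. Expansion
in the standard basis reduces varying vectors to that case. With \<open>q\<close> a metric, its derivatives or its
Christoffel symbols of the first kind, this is the product rule behind all computations below.\<close>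

lemma bilinear_family_has_derivative:
  fixes q :: "'e::euclidean_space \<Rightarrow> 'f::euclidean_space \<Rightarrow> 'f \<Rightarrow> real" and y :: "'t::real_normed_vector \<Rightarrow> 'e"
  assumes S: "open S" "y t \<in> S" and bil: "\<And>x. x \<in> S \<Longrightarrow> bilinear (q x)"
    and dif: "\<And>u v. (\<lambda>x. q x u v) differentiable at (y t)"
    and y: "(y has_derivative y') (at t)" and u: "(u has_derivative u') (at t)" and v: "(v has_derivative v') (at t)"
  shows "((\<lambda>s. q (y s) (u s) (v s)) has_derivative
    (\<lambda>h. dird (y' h) (\<lambda>x. q x (u t) (v t)) (y t) + q (y t) (u' h) (v t) + q (y t) (u t) (v' h))) (at t)"
proof -
  have "((\<lambda>s. \<Sum>i\<in>Basis. \<Sum>j\<in>Basis. (u s \<bullet> i) * ((v s \<bullet> j) * q (y s) i j)) has_derivative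
     (\<lambda>h. \<Sum>i\<in>Basis. \<Sum>j\<in>Basis. (u t \<bullet> i) * ((v t \<bullet> j) * dird (y' h) (\<lambda>x. q x i j) (y t) + (v' h \<bullet> j) * q (y t) i j)
        + (u' h \<bullet> i) * ((v t \<bullet> j) * q (y t) i j))) (at t)"
  proof (intro has_derivative_sum has_derivative_mult)
    fix i j :: 'f
    show "((\<lambda>s. u s \<bullet> i) has_derivative (\<lambda>h. u' h \<bullet> i)) (at t)" using u by (rule has_derivative_inner_left)
    show "((\<lambda>s. v s \<bullet> j) has_derivative (\<lambda>h. v' h \<bullet> j)) (at t)" using v by (rule has_derivative_inner_left)
    show "((\<lambda>s. q (y s) i j) has_derivative (\<lambda>h. dird (y' h) (\<lambda>x. q x i j) (y t))) (at t)"
      using diff_chain_at[OF y dird_has_derivative[OF dif]] by (simp add: o_def)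
  qed
  moreover have "(\<Sum>i\<in>Basis. \<Sum>j\<in>Basis. (u t \<bullet> i) * ((v t \<bullet> j) * dird (y' h) (\<lambda>x. q x i j) (y t) + (v' h \<bullet> j) * q (y t) i j)
        + (u' h \<bullet> i) * ((v t \<bullet> j) * q (y t) i j)) =
     dird (y' h) (\<lambda>x. q x (u t) (v t)) (y t) + q (y t) (u' h) (v t) + q (y t) (u t) (v' h)" for h
  proof -
    have e1: "dird (y' h) (\<lambda>x. q x (u t) (v t)) (y t) =
        (\<Sum>i\<in>Basis. \<Sum>j\<in>Basis. (u t \<bullet> i) * ((v t \<bullet> j) * dird (y' h) (\<lambda>x. q x i j) (y t)))"
      by (rule bilinear_family_dird_expansion[OF S bil dif])
    note e2 = bilinear_basis_expansion[OF bil[OF S(2)], of "u' h" "v t"]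
    note e3 = bilinear_basis_expansion[OF bil[OF S(2)], of "u t" "v' h"]
    show ?thesis
      unfolding e1 e2 e3 sum.distrib[symmetric] by (rule sum.cong[OF refl], rule sum.cong[OF refl]) (simp only: distrib_left add.assoc)
  qed
  ultimately have "((\<lambda>s. \<Sum>i\<in>Basis. \<Sum>j\<in>Basis. (u s \<bullet> i) * ((v s \<bullet> j) * q (y s) i j)) has_derivative
      (\<lambda>h. dird (y' h) (\<lambda>x. q x (u t) (v t)) (y t) + q (y t) (u' h) (v t) + q (y t) (u t) (v' h))) (at t)"
    by (simp only:)
  moreover have "\<forall>\<^sub>F s in at t. (\<Sum>i\<in>Basis. \<Sum>j\<in>Basis. (u s \<bullet> i) * ((v s \<bullet> j) * q (y s) i j)) = q (y s) (u s) (v s)"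
  proof -
    have "(y \<longlongrightarrow> y t) (at t)" using has_derivative_continuous[OF y] by (simp add: continuous_at)
    then have "\<forall>\<^sub>F s in at t. y s \<in> S" using S by (rule topological_tendstoD)
    then show ?thesis by eventually_elim (rule bilinear_basis_expansion[OF bil, symmetric])
  qed
  ultimately show ?thesis
    by (rule has_derivative_transform_eventually) (rule bilinear_basis_expansion[OF bil[OF S(2)], symmetric], rule UNIV_I)
qed

lemma bilinear_family_has_real_derivative:
  fixes q :: "'e::euclidean_space \<Rightarrow> 'f::euclidean_space \<Rightarrow> 'f \<Rightarrow> real" and y :: "real \<Rightarrow> 'e"
  assumes S: "open S" "y t \<in> S" and bil: "\<And>x. x \<in> S \<Longrightarrow> bilinear (q x)"
    and dif: "\<And>u v. (\<lambda>x. q x u v) differentiable at (y t)"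
    and y: "(y has_vector_derivative y') (at t)"
    and u: "(u has_vector_derivative u') (at t)" and v: "(v has_vector_derivative v') (at t)"
  shows "((\<lambda>s. q (y s) (u s) (v s)) has_real_derivative
    dird y' (\<lambda>x. q x (u t) (v t)) (y t) + q (y t) u' (v t) + q (y t) (u t) v') (at t)"
proof -
  have "((\<lambda>s. q (y s) (u s) (v s)) has_derivative
    (\<lambda>h. dird (h *\<^sub>R y') (\<lambda>x. q x (u t) (v t)) (y t) + q (y t) (h *\<^sub>R u') (v t) + q (y t) (u t) (h *\<^sub>R v'))) (at t)"
    using y u v unfolding has_vector_derivative_def
    by (intro bilinear_family_has_derivative[where q = q and y = y and u = u and v = v, OF S bil dif])
  moreover have "dird (h *\<^sub>R y') (\<lambda>x. q x (u t) (v t)) (y t) + q (y t) (h *\<^sub>R u') (v t) + q (y t) (u t) (h *\<^sub>R v')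
      = h *\<^sub>R (dird y' (\<lambda>x. q x (u t) (v t)) (y t) + q (y t) u' (v t) + q (y t) (u t) v')" for h
    using linear_scale[OF dird_linear[OF dif]] linear_scale[OF bilinear_linear_left[OF bil[OF S(2)]]]
      linear_scale[OF bilinear_linear_right[OF bil[OF S(2)]]]
    by (simp add: distrib_left)
  ultimately show ?thesis
    by (simp add: has_real_derivative_iff_has_vector_derivative has_vector_derivative_def)
qed

section \<open>Riemannian geometry in a coordinate domain\<close>

text \<open>A Riemannian metric on an open set of a Euclidean space, as given by a chart. The constants below are the
classical local expressions: \<open>dg z w u v\<close> is the derivative of \<open>g(u,v)\<close> in the direction \<open>w\<close>, \<open>koszul\<close>
is the Christoffel symbol of the first kind, and \<open>gamma\<close> the one of the second kind.\<close>

locale coordinate_metric =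
  fixes U :: "'e::euclidean_space set" and g :: "'e \<Rightarrow> 'e \<Rightarrow> 'e \<Rightarrow> real"
  assumes open_U: "open U"
    and inner_form_g: "z \<in> U \<Longrightarrow> inner_form (g z)"
    and smooth_g: "smooth_on U (\<lambda>z. g z u v)"
begin

lemma bilinear_g: "z \<in> U \<Longrightarrow> bilinear (g z)"
  using inner_form_g inner_form_bilinear by blast

lemma g_commute: "z \<in> U \<Longrightarrow> g z u v = g z v u"
  using inner_form_g inner_form_commute by blast

lemma g_differentiable: "z \<in> U \<Longrightarrow> (\<lambda>x. g x u v) differentiable at z"
  using smooth_g smooth_on_differentiable by blast

definition dg :: "'e \<Rightarrow> 'e \<Rightarrow> 'e \<Rightarrow> 'e \<Rightarrow> real" where
  "dg z w u v = dird w (\<lambda>x. g x u v) z"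

lemma smooth_dg: "smooth_on U (\<lambda>z. dg z w u v)"
  unfolding dg_def by (rule smooth_on_dird[OF smooth_g])

lemma dg_differentiable: "z \<in> U \<Longrightarrow> (\<lambda>x. dg x w u v) differentiable at z"
  using smooth_dg smooth_on_differentiable by blast

lemma bilinear_dg: "z \<in> U \<Longrightarrow> bilinear (dg z w)"
  unfolding dg_def by (rule bilinear_family_dird[OF open_U _ bilinear_g g_differentiable])

lemma linear_dg: "z \<in> U \<Longrightarrow> linear (\<lambda>w. dg z w u v)"
  unfolding dg_def by (rule dird_linear[OF g_differentiable])

lemma dg_commute: "z \<in> U \<Longrightarrow> dg z w u v = dg z w v u"
  unfolding dg_def by (rule dird_cong_open[OF open_U _ g_commute])

lemma bilinear_dg_left: "z \<in> U \<Longrightarrow> bilinear (\<lambda>w u. dg z w u v)"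
  using bilinear_linear_left[OF bilinear_dg] linear_dg by (simp add: bilinear_def)

lemmas dg_linear_simps =
  linear_add[OF bilinear_linear_left[OF bilinear_dg]] linear_add[OF bilinear_linear_right[OF bilinear_dg]]
  linear_add[OF linear_dg] linear_scale[OF bilinear_linear_left[OF bilinear_dg]]
  linear_scale[OF bilinear_linear_right[OF bilinear_dg]] linear_scale[OF linear_dg]

definition koszul :: "'e \<Rightarrow> 'e \<Rightarrow> 'e \<Rightarrow> 'e \<Rightarrow> real" where
  "koszul z u v w = (dg z u v w + dg z v u w - dg z w u v) / 2"

lemma koszul_commute: "z \<in> U \<Longrightarrow> koszul z u v w = koszul z v u w"
  unfolding koszul_def by (simp add: dg_commute[of z w])

lemma bilinear_koszul: "z \<in> U \<Longrightarrow> bilinear (\<lambda>u v. koszul z u v w)"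
  by (simp add: bilinear_def linear_iff koszul_def dg_linear_simps algebra_simps add_divide_distrib diff_divide_distrib)

lemma linear_koszul: "z \<in> U \<Longrightarrow> linear (koszul z u v)"
  by (simp add: linear_iff koszul_def dg_linear_simps algebra_simps add_divide_distrib diff_divide_distrib)

lemma smooth_koszul: "smooth_on U (\<lambda>z. koszul z u v w)"
  unfolding koszul_def
  by (rule smooth_on_linear[OF open_U bounded_linear_divide])
    (rule smooth_on_diff[OF open_U smooth_on_add[OF open_U smooth_dg smooth_dg] smooth_dg])

definition gamma :: "'e \<Rightarrow> 'e \<Rightarrow> 'e \<Rightarrow> 'e" where
  "gamma z = (THE \<Gamma>. bilinear \<Gamma> \<and> (\<forall>u v. \<Gamma> u v = \<Gamma> v u) \<and>
     (\<forall>u v w. dg z w u v = g z (\<Gamma> w u) v + g z u (\<Gamma> w v)))"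

lemma koszul_formula:
  assumes z: "z \<in> U" and sym: "\<forall>u v. \<Gamma> u v = \<Gamma> v u"
    and compat: "\<forall>u v w. dg z w u v = g z (\<Gamma> w u) v + g z u (\<Gamma> w v)"
  shows "g z (\<Gamma> u v) w = koszul z u v w"
proof -
  have "dg z u v w = g z (\<Gamma> u v) w + g z (\<Gamma> u w) v"
    using compat g_commute[OF z, of v "\<Gamma> u w"] by simp
  moreover have "dg z v u w = g z (\<Gamma> u v) w + g z u (\<Gamma> v w)"
    using compat sym[rule_format, of v u] by simp
  moreover have "dg z w u v = g z (\<Gamma> u w) v + g z u (\<Gamma> v w)"
    using compat sym[rule_format, of w u] sym[rule_format, of w v] by simp
  ultimately show ?thesis by (simp add: koszul_def)
qed

text \<open>The Christoffel symbols of the first kind determine \<open>\<Gamma>\<close> as \<open>g\<close> is nondegenerate; conversely, raising their index in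
an orthonormal basis defines a \<open>\<Gamma>\<close> with the required properties. This legitimates the definite description
in the definition.\<close>

lemma gamma_unique:
  assumes z: "z \<in> U"
  shows "\<exists>!\<Gamma>. bilinear \<Gamma> \<and> (\<forall>u v. \<Gamma> u v = \<Gamma> v u) \<and>
     (\<forall>u v w. dg z w u v = g z (\<Gamma> w u) v + g z u (\<Gamma> w v))"
proof (rule ex_ex1I)
  obtain E where E: "orthonormal_basis (g z) E"
    using orthonormal_basis_exists[OF inner_form_g[OF z]] by blast
  define \<Gamma> where "\<Gamma> u v = (\<Sum>e\<in>E. koszul z u v e *\<^sub>R e)" for u v
  have \<Gamma>: "g z (\<Gamma> u v) w = koszul z u v w" for u v w
  proof -
    have "g z (\<Gamma> u v) w = (\<Sum>e\<in>E. koszul z u v e * g z e w)"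
      unfolding \<Gamma>_def by (rule bilinear_combination_left[OF bilinear_g[OF z]])
    also have "\<dots> = (\<Sum>e\<in>E. g z w e * koszul z u v e)"
      using g_commute[OF z] by (simp add: mult.commute)
    also have "\<dots> = koszul z u v (\<Sum>e\<in>E. g z w e *\<^sub>R e)"
      using linear_sum[OF linear_koszul[OF z], of u v "\<lambda>e. g z w e *\<^sub>R e" E] linear_scale[OF linear_koszul[OF z]]
      by simp
    finally show ?thesis using orthonormal_basis_expansion[OF bilinear_g[OF z] E, of w] by simp
  qed
  have "bilinear \<Gamma>"
    using bilinear_koszul[OF z]
    by (simp add: bilinear_def linear_iff \<Gamma>_def scaleR_add_left sum.distrib scaleR_sum_right)
  moreover have "\<Gamma> u v = \<Gamma> v u" for u v
    unfolding \<Gamma>_def by (simp add: koszul_commute[OF z, of u v])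
  moreover have "dg z w u v = g z (\<Gamma> w u) v + g z u (\<Gamma> w v)" for u v w
    unfolding g_commute[OF z, of u] \<Gamma>
    by (simp add: koszul_def dg_commute[OF z, of w v u] dg_commute[OF z, of u w v] dg_commute[OF z, of v w u] field_simps)
  ultimately show "\<exists>\<Gamma>. bilinear \<Gamma> \<and> (\<forall>u v. \<Gamma> u v = \<Gamma> v u) \<and>
     (\<forall>u v w. dg z w u v = g z (\<Gamma> w u) v + g z u (\<Gamma> w v))" by blast
next
  fix \<Gamma> \<Delta>
  assume "bilinear \<Gamma> \<and> (\<forall>u v. \<Gamma> u v = \<Gamma> v u) \<and> (\<forall>u v w. dg z w u v = g z (\<Gamma> w u) v + g z u (\<Gamma> w v))"
    and "bilinear \<Delta> \<and> (\<forall>u v. \<Delta> u v = \<Delta> v u) \<and> (\<forall>u v w. dg z w u v = g z (\<Delta> w u) v + g z u (\<Delta> w v))"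
  then have "g z (\<Gamma> u v) w = g z (\<Delta> u v) w" for u v w
    using koszul_formula[OF z, of \<Gamma> u v w] koszul_formula[OF z, of \<Delta> u v w] by simp
  then show "\<Gamma> = \<Delta>"
    by (intro ext inner_form_nondegenerate[OF inner_form_g[OF z]])
qed

lemma gamma:
  assumes "z \<in> U"
  shows "g z (gamma z u v) w = koszul z u v w" and "bilinear (gamma z)"
proof -
  have G: "bilinear (gamma z) \<and> (\<forall>u v. gamma z u v = gamma z v u) \<and>
     (\<forall>u v w. dg z w u v = g z (gamma z w u) v + g z u (gamma z w v))"
    unfolding gamma_def by (rule theI'[OF gamma_unique[OF assms]])
  show "g z (gamma z u v) w = koszul z u v w"
    by (rule koszul_formula[OF assms]) (use G in blast)+
  show "bilinear (gamma z)" using G by blast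
qed

text \<open>The Lie derivative of \<open>g\<close> with respect to \<open>\<xi>\<close>.\<close>

definition lie_metric :: "('e \<Rightarrow> 'e) \<Rightarrow> 'e \<Rightarrow> 'e \<Rightarrow> 'e \<Rightarrow> real" where
  "lie_metric \<xi> z u v = dg z (\<xi> z) u v + g z (dird u \<xi> z) v + g z u (dird v \<xi> z)"

lemma lie_metric_commute: "z \<in> U \<Longrightarrow> lie_metric \<xi> z u v = lie_metric \<xi> z v u"
  unfolding lie_metric_def
  using dg_commute[of z "\<xi> z" u v] g_commute[of z u "dird v \<xi> z"] g_commute[of z "dird u \<xi> z" v] by linarith

lemma bilinear_lie_metric:
  assumes "z \<in> U" "\<xi> differentiable at z"
  shows "bilinear (lie_metric \<xi> z)"
proof -
  note [simp] = linear_add[OF dird_linear[OF assms(2)]] linear_scale[OF dird_linear[OF assms(2)]]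
    bilinear_ladd[OF bilinear_g[OF assms(1)]] bilinear_radd[OF bilinear_g[OF assms(1)]]
    linear_scale[OF bilinear_linear_left[OF bilinear_g[OF assms(1)]]]
    linear_scale[OF bilinear_linear_right[OF bilinear_g[OF assms(1)]]]
  show ?thesis
    using assms(1) by (simp add: bilinear_def linear_iff lie_metric_def dg_linear_simps algebra_simps)
qed

definition ddg :: "'e \<Rightarrow> 'e \<Rightarrow> 'e \<Rightarrow> 'e \<Rightarrow> 'e \<Rightarrow> real" where
  "ddg z a b u v = dird a (\<lambda>x. dg x b u v) z"

lemma ddg_commute: "z \<in> U \<Longrightarrow> ddg z a b u v = ddg z b a u v"
  unfolding ddg_def dg_def by (rule dird_commute[OF smooth_g open_U])

lemma lie_metric_has_derivative:
  assumes z: "z \<in> U" and \<xi>: "smooth_on U \<xi>"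
  shows "((\<lambda>x. lie_metric \<xi> x u v) has_derivative (\<lambda>w.
     ddg z w (\<xi> z) u v + dg z (dird w \<xi> z) u v
      + (dg z w (dird u \<xi> z) v + g z (dird w (dird u \<xi>) z) v)
      + (dg z w u (dird v \<xi> z) + g z u (dird w (dird v \<xi>) z)))) (at z)"
proof -
  have id: "((\<lambda>x. x) has_derivative (\<lambda>w. w)) (at z)" by (rule has_derivative_ident)
  have c: "((\<lambda>x. a) has_derivative (\<lambda>w. 0)) (at z)" for a :: 'e by (rule has_derivative_const)
  have d\<xi>: "(\<xi> has_derivative (\<lambda>w. dird w \<xi> z)) (at z)" by (rule smooth_on_has_derivative[OF \<xi> z])
  have dd\<xi>: "(dird u \<xi> has_derivative (\<lambda>w. dird w (dird u \<xi>) z)) (at z)" for u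
    by (rule smooth_on_has_derivative[OF smooth_on_dird[OF \<xi>] z])
  have g0: "g z 0 v = 0" "g z v 0 = 0" "dg z a 0 v = 0" "dg z a v 0 = 0" for a v
    using bilinear_lzero[OF bilinear_g[OF z]] bilinear_rzero[OF bilinear_g[OF z]]
      bilinear_lzero[OF bilinear_dg[OF z]] bilinear_rzero[OF bilinear_dg[OF z]] by auto
  show ?thesis
    unfolding lie_metric_def
  proof (intro has_derivative_add)
    show "((\<lambda>x. dg x (\<xi> x) u v) has_derivative (\<lambda>w. ddg z w (\<xi> z) u v + dg z (dird w \<xi> z) u v)) (at z)"
      using bilinear_family_has_derivative[where q = "\<lambda>x a b. dg x a b v" and y = "\<lambda>x. x" and u = \<xi> and v = "\<lambda>x. u",
          OF open_U z bilinear_dg_left dg_differentiable[OF z] id d\<xi> c]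
      by (simp add: ddg_def g0)
    show "((\<lambda>x. g x (dird u \<xi> x) v) has_derivative (\<lambda>w. dg z w (dird u \<xi> z) v + g z (dird w (dird u \<xi>) z) v)) (at z)"
      using bilinear_family_has_derivative[where q = g and y = "\<lambda>x. x" and u = "dird u \<xi>" and v = "\<lambda>x. v",
          OF open_U z bilinear_g g_differentiable[OF z] id dd\<xi> c]
      by (simp add: dg_def g0)
    show "((\<lambda>x. g x u (dird v \<xi> x)) has_derivative (\<lambda>w. dg z w u (dird v \<xi> z) + g z u (dird w (dird v \<xi>) z))) (at z)"
      using bilinear_family_has_derivative[where q = g and y = "\<lambda>x. x" and u = "\<lambda>x. u" and v = "dird v \<xi>",
          OF open_U z bilinear_g g_differentiable[OF z] id c dd\<xi>]
      by (simp add: dg_def g0)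
  qed
qed

text \<open>This is \<open>g((L\<^sub>\<xi> \<nabla>)(u,v), w)\<close>, expressed by the Lie derivative \<open>S\<close> of \<open>g\<close> alone. If the partial derivatives are replaced by
covariant ones, then the terms with \<open>\<Gamma>\<close> cancel except for \<open>S(\<Gamma>(u,v), w)\<close>.\<close>

definition tension_variation :: "('e \<Rightarrow> 'e) \<Rightarrow> 'e \<Rightarrow> 'e \<Rightarrow> 'e \<Rightarrow> 'e \<Rightarrow> real" where
  "tension_variation \<xi> z u v w =
     (dird u (\<lambda>x. lie_metric \<xi> x v w) z + dird v (\<lambda>x. lie_metric \<xi> x u w) z
        - dird w (\<lambda>x. lie_metric \<xi> x u v) z) / 2
     - lie_metric \<xi> z (gamma z u v) w"

text \<open>The right-hand side is what differentiation of the second fundamental form of a flow yields. The second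
derivatives of \<open>g\<close> and \<open>\<xi>\<close> match by the symmetry of second derivatives, and the first-order terms combine
to Christoffel symbols of the first kind.\<close>

lemma tension_variation_eq:
  assumes z: "z \<in> U" and \<xi>: "smooth_on U \<xi>"
  shows "tension_variation \<xi> z u v w =
     g z (dird u (dird v \<xi>) z) w - g z (dird (gamma z u v) \<xi> z) w - dg z (\<xi> z) (gamma z u v) w
     + (ddg z (\<xi> z) u v w + ddg z (\<xi> z) v u w - ddg z (\<xi> z) w u v) / 2
     + koszul z (dird u \<xi> z) v w + koszul z u (dird v \<xi> z) w"
proof -
  have L: "dird a (\<lambda>x. lie_metric \<xi> x b c) z =
     ddg z (\<xi> z) a b c + dg z (dird a \<xi> z) b c
      + (dg z a (dird b \<xi> z) c + g z (dird a (dird b \<xi>) z) c)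
      + (dg z a b (dird c \<xi> z) + g z b (dird a (dird c \<xi>) z))" for a b c
    using dird_eqI[OF lie_metric_has_derivative[OF z \<xi>]] by (simp add: ddg_commute[OF z, of a])
  have c: "dird a (dird b \<xi>) z = dird b (dird a \<xi>) z" for a b
    by (rule dird_commute[OF \<xi> open_U z])
  have "lie_metric \<xi> z (gamma z u v) w =
      dg z (\<xi> z) (gamma z u v) w + g z (dird (gamma z u v) \<xi> z) w + koszul z u v (dird w \<xi> z)"
    by (simp add: lie_metric_def gamma(1)[OF z])
  moreover have "2 * koszul z a b c = dg z a b c + dg z b a c - dg z c a b" for a b c
    by (simp add: koszul_def)
  note this[of "dird u \<xi> z" v w] this[of u "dird v \<xi> z" w] this[of u v "dird w \<xi> z"]
  moreover have "g z v (dird u (dird w \<xi>) z) = g z (dird w (dird u \<xi>) z) v"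
    using g_commute[OF z] c by metis
  moreover have "g z u (dird v (dird w \<xi>) z) = g z u (dird w (dird v \<xi>) z)"
    "g z (dird v (dird u \<xi>) z) w = g z (dird u (dird v \<xi>) z) w"
    using c by metis+
  moreover have "2 * tension_variation \<xi> z u v w =
      dird u (\<lambda>x. lie_metric \<xi> x v w) z + dird v (\<lambda>x. lie_metric \<xi> x u w) z
      - dird w (\<lambda>x. lie_metric \<xi> x u v) z - 2 * lie_metric \<xi> z (gamma z u v) w"
    by (simp add: tension_variation_def)
  moreover note L[where a = u and b = v and c = w] L[where a = v and b = u and c = w] L[where a = w and b = u and c = v]
  ultimately show ?thesis by argo
qed

text \<open>At \<open>z\<close> itself the bound is the minimum of \<open>g\<close> on the unit sphere; near \<open>z\<close> the coefficients of \<open>g\<close> differ little.\<close>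

lemma inner_form_lower_bound:
  assumes "z \<in> U"
  shows "\<exists>c>0. \<forall>\<^sub>F x in nhds z. \<forall>u. c * (norm u)\<^sup>2 \<le> g x u u"
proof -
  have lin: "linear (\<lambda>u. g z u v)" "linear (\<lambda>u. g z v u)" for v
    using bilinear_g[OF assms] by (auto simp: bilinear_def)
  have "continuous_on (sphere 0 1) (\<lambda>u. g z u u)"
    using bilinear_continuous_on_compose[of "sphere 0 1" "\<lambda>u. u" "\<lambda>u. u" "g z"] 
    by (simp add: bilinear_conv_bounded_bilinear[symmetric] bilinear_g[OF assms])
  have "\<exists>c>0. \<forall>u. c * (norm u)\<^sup>2 \<le> g z u u"
  proof -
    obtain c where c: "c > 0" "\<And>u. u \<in> sphere 0 1 \<Longrightarrow> c \<le> g z u u"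
    proof (cases "sphere (0::'e) 1 = {}")
      case True
      then show ?thesis using that[of 1] by auto
    next
      case False
      obtain u0 where u0: "u0 \<in> sphere 0 1" "\<And>u. u \<in> sphere 0 1 \<Longrightarrow> g z u0 u0 \<le> g z u u"
        using continuous_attains_inf[OF compact_sphere False \<open>continuous_on (sphere 0 1) (\<lambda>u. g z u u)\<close>] by blast
      have "u0 \<noteq> 0" using u0(1) by auto
      then show ?thesis using that[of "g z u0 u0"] u0 inner_form_pos[OF inner_form_g[OF assms]] by blast
    qed
    have "c * (norm u)\<^sup>2 \<le> g z u u" for u
    proof (cases "u = 0")
      case True
      then show ?thesis using linear_0[OF lin(1)] by simp
    next
      case False
      have "c \<le> g z (u /\<^sub>R norm u) (u /\<^sub>R norm u)" using False by (intro c(2)) simp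
      also have "\<dots> = g z u u / (norm u)\<^sup>2"
        by (simp add: linear_scale[OF lin(1)] linear_scale[OF lin(2)] power2_eq_square divide_inverse)
      finally show ?thesis using False by (simp add: field_simps)
    qed
    then show ?thesis using c(1) by blast
  qed
  then obtain c where c: "c > 0" "\<And>u. c * (norm u)\<^sup>2 \<le> g z u u" by blast
  define \<delta> where "\<delta> x = (\<Sum>i\<in>Basis. \<Sum>j\<in>Basis. \<bar>g x i j - g z i j\<bar>)" for x
  have "isCont (\<lambda>x. g x i j) z" for i j
    using differentiable_imp_continuous_within[OF g_differentiable[OF assms]] .
  then have "isCont \<delta> z" unfolding \<delta>_def by (intro continuous_intros)
  then have "(\<delta> \<longlongrightarrow> \<delta> z) (nhds z)" by (simp add: tendsto_at_iff_tendsto_nhds[symmetric] isCont_def)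
  then have "\<forall>\<^sub>F x in nhds z. \<delta> x < c / 2"
    using c(1) by (intro order_tendstoD(2)[of \<delta> "\<delta> z"]) (auto simp: \<delta>_def)
  moreover have "\<forall>\<^sub>F x in nhds z. x \<in> U" using open_U assms by (rule eventually_nhds_in_open)
  ultimately have "\<forall>\<^sub>F x in nhds z. \<forall>u. (c / 2) * (norm u)\<^sup>2 \<le> g x u u"
  proof eventually_elim
    case (elim x)
    show ?case
    proof
      fix u
      have "g z u u - g x u u = (\<Sum>i\<in>Basis. \<Sum>j\<in>Basis. (u \<bullet> i) * ((u \<bullet> j) * (g z i j - g x i j)))"
        unfolding bilinear_basis_expansion[OF bilinear_g[OF assms], of u u]
          bilinear_basis_expansion[OF bilinear_g[OF elim(2)], of u u]
        by (simp add: sum_subtractf[symmetric] right_diff_distrib)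
      also have "\<dots> \<le> (\<Sum>i\<in>Basis. \<Sum>j\<in>Basis. norm u * (norm u * \<bar>g x i j - g z i j\<bar>))"
      proof (intro sum_mono)
        fix i j :: 'e assume ij: "i \<in> Basis" "j \<in> Basis"
        have "(u \<bullet> i) * ((u \<bullet> j) * (g z i j - g x i j)) \<le> \<bar>u \<bullet> i\<bar> * (\<bar>u \<bullet> j\<bar> * \<bar>g z i j - g x i j\<bar>)"
          by (metis abs_ge_self abs_mult)
        also have "\<dots> \<le> norm u * (norm u * \<bar>g x i j - g z i j\<bar>)"
          unfolding abs_minus_commute[of "g z i j"]
          by (intro mult_mono mult_right_mono Basis_le_norm ij) auto
        finally show "(u \<bullet> i) * ((u \<bullet> j) * (g z i j - g x i j)) \<le> norm u * (norm u * \<bar>g x i j - g z i j\<bar>)" .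
      qed
      also have "\<dots> = (norm u)\<^sup>2 * \<delta> x"
        by (simp add: \<delta>_def sum_distrib_left power2_eq_square mult.assoc)
      also have "\<dots> \<le> (norm u)\<^sup>2 * (c / 2)" using elim(1) by (intro mult_left_mono) auto
      finally show "(c / 2) * (norm u)\<^sup>2 \<le> g x u u" using c(2)[of u] by (simp add: algebra_simps)
    qed
  qed
  then show ?thesis using c(1) half_gt_zero by blast
qed

text \<open>A curve of vectors \<open>\<tau>\<close> with \<open>g(\<tau>, w) = o(t)\<close> for every \<open>w\<close> is itself \<open>o(t)\<close>. The reason is the bound
\<open>c |\<tau>|\<^sup>2 \<le> g(\<tau>,\<tau>)\<close>, with \<open>c\<close> independent of \<open>t\<close>, together with the expansion of the second argument in the standard basis.\<close>

lemma raise_index_derivative_zero: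
  fixes y \<tau> :: "real \<Rightarrow> 'e"
  assumes y: "isCont y 0" "y 0 \<in> U" and \<tau>: "\<tau> 0 = 0"
    and d: "\<And>w. ((\<lambda>t. g (y t) (\<tau> t) w) has_real_derivative 0) (at 0)"
  shows "(\<tau> has_vector_derivative 0) (at 0)"
proof -
  obtain c where c: "c > 0" "\<forall>\<^sub>F x in nhds (y 0). \<forall>u. c * (norm u)\<^sup>2 \<le> g x u u"
    using inner_form_lower_bound[OF y(2)] by blast
  have yl: "(y \<longlongrightarrow> y 0) (at 0)" using y(1) by (simp add: isCont_def)
  have ev: "\<forall>\<^sub>F t in at 0. (\<forall>u. c * (norm u)\<^sup>2 \<le> g (y t) u u) \<and> y t \<in> U"
    using eventually_compose_filterlim[OF c(2) yl] topological_tendstoD[OF yl open_U y(2)]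
    by eventually_elim simp
  have b: "\<forall>\<^sub>F t in at 0. norm (\<tau> t /\<^sub>R t) \<le> (1 / c) * (\<Sum>b\<in>Basis. \<bar>g (y t) (\<tau> t) b / t\<bar>)"
    using ev
  proof eventually_elim
    case (elim t)
    have "norm (\<tau> t) * (c * norm (\<tau> t)) \<le> norm (\<tau> t) * (\<Sum>b\<in>Basis. \<bar>g (y t) (\<tau> t) b\<bar>)"
    proof -
      have "norm (\<tau> t) * (c * norm (\<tau> t)) \<le> g (y t) (\<tau> t) (\<tau> t)" using elim by (simp add: power2_eq_square algebra_simps)
      also have "\<dots> = g (y t) (\<tau> t) (\<Sum>b\<in>Basis. (\<tau> t \<bullet> b) *\<^sub>R b)" by (simp add: euclidean_representation)
      also have "\<dots> = (\<Sum>b\<in>Basis. (\<tau> t \<bullet> b) * g (y t) (\<tau> t) b)"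
        using elim by (intro bilinear_combination_right bilinear_g) auto
      also have "\<dots> \<le> (\<Sum>b\<in>Basis. norm (\<tau> t) * \<bar>g (y t) (\<tau> t) b\<bar>)"
      proof (intro sum_mono)
        fix b :: 'e assume "b \<in> Basis"
        have "(\<tau> t \<bullet> b) * g (y t) (\<tau> t) b \<le> \<bar>\<tau> t \<bullet> b\<bar> * \<bar>g (y t) (\<tau> t) b\<bar>" by (metis abs_ge_self abs_mult)
        also have "\<dots> \<le> norm (\<tau> t) * \<bar>g (y t) (\<tau> t) b\<bar>"
          using \<open>b \<in> Basis\<close> by (intro mult_right_mono Basis_le_norm) auto
        finally show "(\<tau> t \<bullet> b) * g (y t) (\<tau> t) b \<le> norm (\<tau> t) * \<bar>g (y t) (\<tau> t) b\<bar>" .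
      qed
      finally show ?thesis by (simp add: sum_distrib_left)
    qed
    then have "c * norm (\<tau> t) \<le> (\<Sum>b\<in>Basis. \<bar>g (y t) (\<tau> t) b\<bar>)"
      by (cases "\<tau> t = 0") (auto intro: sum_nonneg)
    then have "norm (\<tau> t) \<le> (1 / c) * (\<Sum>b\<in>Basis. \<bar>g (y t) (\<tau> t) b\<bar>)"
      using c(1) by (simp add: field_simps)
    then have "norm (\<tau> t) / \<bar>t\<bar> \<le> (1 / c) * (\<Sum>b\<in>Basis. \<bar>g (y t) (\<tau> t) b\<bar>) / \<bar>t\<bar>"
      by (intro divide_right_mono) auto
    also have "\<dots> = (1 / c) * (\<Sum>b\<in>Basis. \<bar>g (y t) (\<tau> t) b / t\<bar>)"
      by (simp add: sum_divide_distrib[symmetric] abs_divide)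
    finally show ?case by (simp add: divide_inverse_commute)
  qed
  have "((\<lambda>t. g (y t) (\<tau> t) b / t) \<longlongrightarrow> 0) (at 0)" for b
    using d[of b] bilinear_lzero[OF bilinear_g[OF y(2)]] \<tau> by (simp add: DERIV_def)
  then have "((\<lambda>t. (1 / c) * (\<Sum>b\<in>Basis. \<bar>g (y t) (\<tau> t) b / t\<bar>)) \<longlongrightarrow> (1 / c) * (\<Sum>b\<in>(Basis :: 'e set). \<bar>0\<bar>)) (at 0)"
    by (intro tendsto_intros)
  then have "((\<lambda>t. \<tau> t /\<^sub>R t) \<longlongrightarrow> 0) (at 0)"
    using b by (intro Lim_null_comparison[OF b]) simp
  then have "((\<lambda>t. norm (\<tau> t /\<^sub>R t)) \<longlongrightarrow> 0) (at 0)" by (rule tendsto_norm_zero)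
  moreover have "norm (\<tau> t /\<^sub>R t) = norm (\<tau> (0 + t) - \<tau> 0 - 0) / norm t" for t
    using \<tau> by (simp add: divide_inverse_commute)
  ultimately show ?thesis
    unfolding has_vector_derivative_def has_derivative_at scaleR_zero_right by (simp only: bounded_linear_zero)
qed

text \<open>Source and target are read in the same chart and carry the same metric, hence the same \<open>\<Gamma>\<close>.\<close>

definition second_form :: "('e \<Rightarrow> 'e) \<Rightarrow> 'e \<Rightarrow> 'e \<Rightarrow> 'e \<Rightarrow> 'e" where
  "second_form f y u v = dird u (dird v f) y - dird (gamma y u v) f y + gamma (f y) (dird u f y) (dird v f y)"

lemma tension_variation_eq_0:
  assumes "open V" "z \<in> V" "V \<subseteq> U" "\<And>x u v. x \<in> V \<Longrightarrow> lie_metric \<xi> x u v = 0"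
  shows "tension_variation \<xi> z u v w = 0"
proof -
  have "dird a (\<lambda>x. lie_metric \<xi> x b c) z = 0" for a b c
    using dird_cong_open[OF assms(1,2), of "\<lambda>x. lie_metric \<xi> x b c" "\<lambda>x. 0"] assms(4) by simp
  then show ?thesis using assms by (simp add: tension_variation_def)
qed

text \<open>The pointwise Bochner formula. \<open>B x u\<close> is the derivative at \<open>y\<close>, in the direction \<open>x\<close>, of the
left-invariant field that extends \<open>u\<close>, so that \<open>B u z - B z u\<close> is the bracket \<open>[u,z]\<close>. The assumptions \<open>dgB\<close>, \<open>dSB\<close> and \<open>d\<xi>\<close>
say that \<open>g\<close>, \<open>S\<close> and \<open>\<xi>\<close> are left-invariant to first order. Then \<open>T(e,e,\<xi>) = -S(e,[e,\<xi>]) - S(n\<^sub>e,\<xi>)\<close>, where \<open>n\<^sub>e\<close>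
is the covariant derivative \<open>\<nabla>\<^sub>e e\<close> of the left-invariant field of \<open>e\<close>. The sum \<open>n\<close> of the \<open>n\<^sub>e\<close> vanishes as \<open>g(n, w)\<close> is
minus the trace of \<open>u \<mapsto> [u,w]\<close>. Finally \<open>S(e,f) = g([e,\<xi>],f) + g([f,\<xi>],e)\<close> implies \<open>\<Sum> S(e,[e,\<xi>]) = |S|\<^sup>2/2\<close>.\<close>

lemma lie_metric_eq_0_of_divergence_free:
  assumes y: "y \<in> U" and \<xi>: "smooth_on U \<xi>" and E: "orthonormal_basis (g y) E"
    and dgB: "\<And>x u v. dg y x u v = - g y (B x u) v - g y u (B x v)"
    and dSB: "\<And>x u v. dird x (\<lambda>z. lie_metric \<xi> z u v) y = - lie_metric \<xi> y (B x u) v - lie_metric \<xi> y u (B x v)"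
    and d\<xi>: "\<And>u. dird u \<xi> y = B u (\<xi> y)"
    and unimodular: "\<And>z. (\<Sum>e\<in>E. g y (B e z - B z e) e) = 0"
    and harmonic: "(\<Sum>e\<in>E. tension_variation \<xi> y e e (\<xi> y)) = 0"
  shows "lie_metric \<xi> y u v = 0"
proof -
  define S where "S = lie_metric \<xi> y"
  define a where "a e = B e (\<xi> y) - B (\<xi> y) e" for e
  have fin: "finite E" using E by (simp add: orthonormal_basis_def)
  have bS: "bilinear S"
    unfolding S_def by (rule bilinear_lie_metric[OF y smooth_on_differentiable[OF \<xi> y]])
  have symS: "S u v = S v u" for u v unfolding S_def by (rule lie_metric_commute[OF y])
  note gl = linear_add[OF bilinear_linear_left[OF bilinear_g[OF y]]] linear_diff[OF bilinear_linear_left[OF bilinear_g[OF y]]]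
    linear_add[OF bilinear_linear_right[OF bilinear_g[OF y]]] linear_diff[OF bilinear_linear_right[OF bilinear_g[OF y]]]
  note Sl = linear_add[OF bilinear_linear_left[OF bS]] linear_diff[OF bilinear_linear_left[OF bS]]
    linear_add[OF bilinear_linear_right[OF bS]] linear_diff[OF bilinear_linear_right[OF bS]]
  \<comment> \<open>The sum over the frame of the covariant derivatives \<open>\<nabla>\<^sub>e e\<close> of the left-invariant fields.\<close>
  define n where "n = (\<Sum>e\<in>E. gamma y e e + B e e)"
  have "n = 0"
  proof (rule inner_form_nondegenerate[OF inner_form_g[OF y]])
    fix w
    have "g y (gamma y e e + B e e) w = - g y (B e w - B w e) e" for e
    proof -
      have "g y (gamma y e e) w = koszul y e e w" by (rule gamma(1)[OF y])
      also have "\<dots> = dg y e e w - dg y w e e / 2" by (simp add: koszul_def)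
      finally show ?thesis
        unfolding dgB using g_commute[OF y, of e "B e w"] g_commute[OF y, of e "B w e"] by (simp add: gl)
    qed
    then have "g y n w = - (\<Sum>e\<in>E. g y (B e w - B w e) e)"
      using linear_sum[OF bilinear_linear_left[OF bilinear_g[OF y]], of "\<lambda>e. gamma y e e + B e e" E w]
      by (simp add: n_def sum_negf)
    then show "g y n w = g y 0 w"
      using unimodular[of w] bilinear_lzero[OF bilinear_g[OF y]] by simp
  qed
  have "tension_variation \<xi> y e e (\<xi> y) = - S e (a e) - S (gamma y e e + B e e) (\<xi> y)" for e
    unfolding tension_variation_def dSB S_def[symmetric] a_def Sl
    using symS[of e "B (\<xi> y) e"] by (simp add: field_simps)
  then have "0 = - (\<Sum>e\<in>E. S e (a e)) - (\<Sum>e\<in>E. S (gamma y e e + B e e) (\<xi> y))"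
    using harmonic by (simp add: sum_subtractf sum_negf)
  also have "(\<Sum>e\<in>E. S (gamma y e e + B e e) (\<xi> y)) = S n (\<xi> y)"
    unfolding n_def by (rule linear_sum[OF bilinear_linear_left[OF bS], symmetric])
  also have "\<dots> = 0" using \<open>n = 0\<close> bilinear_lzero[OF bS] by simp
  finally have "(\<Sum>e\<in>E. S e (a e)) = 0" by simp
  moreover have "S e (a e) = (\<Sum>f\<in>E. g y (a e) f * S e f)" for e
    using bilinear_combination_right[OF bS, of e "\<lambda>f. g y (a e) f" "\<lambda>f. f" E]
      orthonormal_basis_expansion[OF bilinear_g[OF y] E, of "a e"] by simp
  ultimately have sum0: "(\<Sum>e\<in>E. \<Sum>f\<in>E. g y (a e) f * S e f) = 0" by simp
  have S_eq: "S e f = g y (a e) f + g y (a f) e" for e f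
    unfolding S_def lie_metric_def dgB d\<xi> a_def
    using g_commute[OF y, of e "B f (\<xi> y)"] g_commute[OF y, of e "B (\<xi> y) f"] by (simp add: gl)
  have "(\<Sum>e\<in>E. \<Sum>f\<in>E. S e f * S e f) =
      (\<Sum>e\<in>E. \<Sum>f\<in>E. g y (a e) f * S e f) + (\<Sum>e\<in>E. \<Sum>f\<in>E. g y (a f) e * S f e)"
  proof -
    have "S e f * S e f = g y (a e) f * S e f + g y (a f) e * S f e" for e f
      using S_eq[of e f] symS[of f e] by (metis distrib_right)
    then show ?thesis by (simp add: sum.distrib)
  qed
  also have "(\<Sum>e\<in>E. \<Sum>f\<in>E. g y (a f) e * S f e) = (\<Sum>e\<in>E. \<Sum>f\<in>E. g y (a e) f * S e f)"
    by (rule sum.swap)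
  finally have "(\<Sum>e\<in>E. \<Sum>f\<in>E. S e f * S e f) = 0" using sum0 by simp
  then have S0: "S e f = 0" if "e \<in> E" "f \<in> E" for e f
    using that fin by (simp add: sum_nonneg_eq_0_iff sum_nonneg)
  have "S u v = S (\<Sum>e\<in>E. g y u e *\<^sub>R e) (\<Sum>e\<in>E. g y v e *\<^sub>R e)"
    using orthonormal_basis_expansion[OF bilinear_g[OF y] E] by metis
  also have "\<dots> = 0"
    by (simp add: bilinear_combination_left[OF bS] bilinear_combination_right[OF bS] S0)
  finally show ?thesis by (simp add: S_def)
qed

end

text \<open>An isometry that relates two vector fields relates the Lie derivatives of the metrics. Both equations are differentiated;
the second derivatives of \<open>f\<close> cancel by their symmetry. For the left translations of a group this shows that \<open>L\<^sub>X h\<close> is left-invariant.\<close>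

lemma lie_metric_natural:
  fixes f :: "'e::euclidean_space \<Rightarrow> 'e"
  assumes g: "coordinate_metric U g" and g': "coordinate_metric U' g'"
    and \<xi>: "smooth_on U \<xi>" and \<xi>': "smooth_on U' \<xi>'"
    and Y: "open Y" "Y \<subseteq> U" and f: "smooth_on Y f" "f ` Y \<subseteq> U'"
    and rel: "\<And>y. y \<in> Y \<Longrightarrow> \<xi>' (f y) = dird (\<xi> y) f y"
    and iso: "\<And>y u v. y \<in> Y \<Longrightarrow> g' (f y) (dird u f y) (dird v f y) = g y u v"
    and y: "y \<in> Y"
  shows "coordinate_metric.lie_metric g' \<xi>' (f y) (dird u f y) (dird v f y) = coordinate_metric.lie_metric g \<xi> y u v"
proof -
  interpret g: coordinate_metric U g by (rule g)
  interpret g': coordinate_metric U' g' by (rule g')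
  have fy: "f y \<in> U'" using f(2) y by auto
  have df: "(f has_derivative (\<lambda>v. dird v f y)) (at y)" by (rule smooth_on_has_derivative[OF f(1) y])
  have ddf: "(dird u f has_derivative (\<lambda>v. dird v (dird u f) y)) (at y)" for u
    by (rule smooth_on_has_derivative[OF smooth_on_dird[OF f(1)] y])
  \<comment> \<open>Differentiate the relation between the fields in the direction \<open>u\<close>.\<close>
  have push: "dird (dird u f y) \<xi>' (f y) = dird (\<xi> y) (dird u f) y + dird (dird u \<xi> y) f y" for u
  proof -
    have "((\<lambda>x. \<xi>' (f x)) has_derivative (\<lambda>u. dird (dird u f y) \<xi>' (f y))) (at y)"
      using diff_chain_at[OF df smooth_on_has_derivative[OF \<xi>' fy]] by (simp add: o_def)
    moreover have "((\<lambda>x. \<xi>' (f x)) has_derivative (\<lambda>u. dird (\<xi> y) (dird u f) y + dird (dird u \<xi> y) f y)) (at y)"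
      using has_derivative_cong_open[OF Y(1) y, of "\<lambda>x. \<xi>' (f x)" "\<lambda>x. dird (\<xi> x) f x"] rel
        dird_along_field_has_derivative[OF f(1) Y(1) y smooth_on_has_derivative[OF \<xi>]] y Y(2) by auto
    ultimately have "(\<lambda>u. dird (dird u f y) \<xi>' (f y)) = (\<lambda>u. dird (\<xi> y) (dird u f) y + dird (dird u \<xi> y) f y)"
      by (rule has_derivative_unique)
    then show ?thesis by (rule fun_cong)
  qed
  have "((\<lambda>x. g' (f x) (dird u f x) (dird v f x)) has_derivative
      (\<lambda>w. g'.dg (f y) (dird w f y) (dird u f y) (dird v f y) + g' (f y) (dird w (dird u f) y) (dird v f y)
         + g' (f y) (dird u f y) (dird w (dird v f) y))) (at y)"
    unfolding g'.dg_def
    by (rule bilinear_family_has_derivative[where q = g' and y = f and u = "dird u f" and v = "dird v f", OF g'.open_U fy g'.bilinear_g g'.g_differentiable[OF fy] df ddf ddf])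
  then have "((\<lambda>x. g x u v) has_derivative
      (\<lambda>w. g'.dg (f y) (dird w f y) (dird u f y) (dird v f y) + g' (f y) (dird w (dird u f) y) (dird v f y)
         + g' (f y) (dird u f y) (dird w (dird v f) y))) (at y)"
    by (rule has_derivative_transform_within_open[OF _ Y(1) y]) (rule iso)
  then have "g.dg y (\<xi> y) u v = g'.dg (f y) (dird (\<xi> y) f y) (dird u f y) (dird v f y)
      + g' (f y) (dird (\<xi> y) (dird u f) y) (dird v f y) + g' (f y) (dird u f y) (dird (\<xi> y) (dird v f) y)"
    unfolding g.dg_def by (rule dird_eqI)
  moreover have "g y (dird u \<xi> y) v = g' (f y) (dird (dird u \<xi> y) f y) (dird v f y)"
    "g y u (dird v \<xi> y) = g' (f y) (dird u f y) (dird (dird v \<xi> y) f y)"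
    using iso[OF y] by auto
  ultimately show ?thesis
    unfolding g.lie_metric_def g'.lie_metric_def rel[OF y] push
    by (simp add: bilinear_ladd[OF g'.bilinear_g[OF fy]] bilinear_radd[OF g'.bilinear_g[OF fy]])
qed

section \<open>Flows in a coordinate domain\<close>

text \<open>The local one-parameter group of \<open>\<xi>\<close> near \<open>{0} \<times> U\<close>. The differential equation enters through its instance at \<open>t = 0\<close>.\<close>

locale coordinate_flow = coordinate_metric U g
  for U :: "'e::euclidean_space set" and g +
  fixes \<xi> :: "'e \<Rightarrow> 'e" and N :: "(real \<times> 'e) set" and F :: "real \<times> 'e \<Rightarrow> 'e"
  assumes smooth_\<xi>: "smooth_on U \<xi>" and open_N: "open N" and smooth_F: "smooth_on N F"
    and F_in: "p \<in> N \<Longrightarrow> F p \<in> U"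
    and F_0: "(0, z) \<in> N \<Longrightarrow> F (0, z) = z"
    and F_generator: "(0, z) \<in> N \<Longrightarrow> dird (1, 0) F (0, z) = \<xi> z"
begin

lemma F_differentiable: "p \<in> N \<Longrightarrow> F differentiable at p"
  by (rule smooth_on_differentiable[OF smooth_F])

lemma dF_differentiable: "p \<in> N \<Longrightarrow> dird a F differentiable at p"
  by (rule smooth_on_differentiable[OF smooth_on_dird[OF smooth_F]])

lemma ddF_differentiable: "p \<in> N \<Longrightarrow> dird b (dird a F) differentiable at p"
  by (rule smooth_on_differentiable[OF smooth_on_dird[OF smooth_on_dird[OF smooth_F]]])

lemma dird_slice:
  assumes "(t, z) \<in> N"
  shows "dird v (\<lambda>x. F (t, x)) z = dird (0, v) F (t, z)"
    and "dird v (\<lambda>x. dird a F (t, x)) z = dird (0, v) (dird a F) (t, z)"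
  using assms dird_eqI[OF has_derivative_slice_right[OF F_differentiable]]
    dird_eqI[OF has_derivative_slice_right[OF dF_differentiable]] by auto

lemma initial_slice_in_U: "(0, z) \<in> N \<Longrightarrow> z \<in> U"
  using F_in F_0 by metis

text \<open>The first derivative in \<open>t\<close> commutes with the space derivatives, and on the slice \<open>t = 0\<close> it is \<open>\<xi>\<close>.\<close>

lemma initial_derivatives:
  assumes z: "(0, z) \<in> N"
  shows "dird (0, v) F (0, z) = v"
    and "dird (0, u) (dird (0, v) F) (0, z) = 0"
    and "dird (1, 0) (dird (0, v) F) (0, z) = dird v \<xi> z"
    and "dird (1, 0) (dird (0, u) (dird (0, v) F)) (0, z) = dird u (dird v \<xi>) z"
proof -
  let ?V = "{z. (0, z) \<in> N}"
  have V: "open ?V" by (rule open_slice_right[OF open_N])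
  have 1: "dird (0, v) F (0, z) = v" if "(0, z) \<in> N" for z v
    using dird_slice(1)[OF that, of v] dird_cong_open[OF V, of z "\<lambda>x. F (0, x)" "\<lambda>x. x" v] F_0 that by simp
  then show "dird (0, v) F (0, z) = v" using z by simp
  have "dird u (\<lambda>x. dird (0, v) F (0, x)) z = 0"
    using dird_cong_open[OF V, of z "\<lambda>x. dird (0, v) F (0, x)" "\<lambda>x. v" u] 1 z by simp
  then show "dird (0, u) (dird (0, v) F) (0, z) = 0" using dird_slice(2)[OF z] by simp
  have 3: "dird (1, 0) (dird (0, v) F) (0, z) = dird v \<xi> z" if "(0, z) \<in> N" for z v
  proof -
    have "dird (1, 0) (dird (0, v) F) (0, z) = dird (0, v) (dird (1, 0) F) (0, z)"
      by (rule dird_commute[OF smooth_F open_N that])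
    also have "\<dots> = dird v (\<lambda>x. dird (1, 0) F (0, x)) z" using dird_slice(2)[OF that] by simp
    also have "\<dots> = dird v \<xi> z" using that F_generator by (intro dird_cong_open[OF V]) auto
    finally show ?thesis .
  qed
  then show "dird (1, 0) (dird (0, v) F) (0, z) = dird v \<xi> z" using z by simp
  have "dird (1, 0) (dird (0, u) (dird (0, v) F)) (0, z) = dird (0, u) (dird (1, 0) (dird (0, v) F)) (0, z)"
    by (rule dird_commute[OF smooth_on_dird[OF smooth_F] open_N z])
  also have "\<dots> = dird u (\<lambda>x. dird (1, 0) (dird (0, v) F) (0, x)) z"
    using dird_eqI[OF has_derivative_slice_right[OF ddF_differentiable[OF z]]] by simp
  also have "\<dots> = dird u (dird v \<xi>) z" using z 3 by (intro dird_cong_open[OF V]) auto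
  finally show "dird (1, 0) (dird (0, u) (dird (0, v) F)) (0, z) = dird u (dird v \<xi>) z" .
qed

lemma second_form_flow:
  assumes "(t, y) \<in> N"
  shows "second_form (\<lambda>x. F (t, x)) y u v = dird (0, u) (dird (0, v) F) (t, y) - dird (0, gamma y u v) F (t, y)
     + gamma (F (t, y)) (dird (0, u) F (t, y)) (dird (0, v) F (t, y))"
proof -
  have "dird u (dird v (\<lambda>x. F (t, x))) y = dird u (\<lambda>x. dird (0, v) F (t, x)) y"
    using assms dird_slice(1) by (intro dird_cong_open[OF open_slice_right[OF open_N]]) auto
  then show ?thesis by (simp add: second_form_def dird_slice[OF assms])
qed

lemma flow_has_vector_derivative:
  assumes "(0, y) \<in> N"
  shows "((\<lambda>t. F (t, y)) has_vector_derivative \<xi> y) (at 0)"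
    and "((\<lambda>t. dird (0, v) F (t, y)) has_vector_derivative dird v \<xi> y) (at 0)"
    and "((\<lambda>t. dird (0, u) (dird (0, v) F) (t, y)) has_vector_derivative dird u (dird v \<xi>) y) (at 0)"
  using has_vector_derivative_slice_left[OF F_differentiable[OF assms]]
    has_vector_derivative_slice_left[OF dF_differentiable[OF assms, of "(0, v)"]]
    has_vector_derivative_slice_left[OF ddF_differentiable[OF assms, of "(0, v)" "(0, u)"]]
  by (simp_all add: F_generator[OF assms] initial_derivatives[OF assms])

lemma pullback_has_real_derivative:
  assumes y: "(0, y) \<in> N"
  shows "((\<lambda>t. g (F (t, y)) (dird (0, u) F (t, y)) (dird (0, v) F (t, y))) has_real_derivative
    lie_metric \<xi> y u v) (at 0)"
proof -
  have yU: "F (0, y) \<in> U" using F_in[OF y] .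
  show ?thesis
    using bilinear_family_has_real_derivative[where q = g and y = "\<lambda>t. F (t, y)" and t = 0, OF open_U yU bilinear_g
        g_differentiable[OF yU] flow_has_vector_derivative(1)[OF y] flow_has_vector_derivative(2)[OF y]
        flow_has_vector_derivative(2)[OF y]]
    by (simp add: lie_metric_def dg_def F_0[OF y] initial_derivatives[OF y])
qed

text \<open>Lowering the index with the metric at the image point replaces \<open>\<Gamma>\<close> there by the Christoffel symbols of the first kind, which are
explicit in the first derivatives of \<open>g\<close> and therefore smooth.\<close>

lemma second_form_has_real_derivative:
  assumes y: "(0, y) \<in> N"
  shows "((\<lambda>t. g (F (t, y)) (second_form (\<lambda>x. F (t, x)) y u v) w) has_real_derivative
    tension_variation \<xi> y u v w) (at 0)"
proof -
  have yU: "F (0, y) \<in> U" "y \<in> U" using F_in[OF y] initial_slice_in_U[OF y] by auto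
  \<comment> \<open>The part of the second fundamental form without \<open>\<Gamma>\<close> at the image point; it is \<open>- gamma y u v\<close> at \<open>t = 0\<close>.\<close>
  define a where "a t = dird (0, u) (dird (0, v) F) (t, y) - dird (0, gamma y u v) F (t, y)" for t
  have da: "(a has_vector_derivative dird u (dird v \<xi>) y - dird (gamma y u v) \<xi> y) (at 0)"
    unfolding a_def by (intro has_vector_derivative_diff flow_has_vector_derivative[OF y])
  have a0: "a 0 = - gamma y u v" by (simp add: a_def initial_derivatives[OF y])
  have "((\<lambda>t. g (F (t, y)) (a t) w) has_real_derivative
     dg y (\<xi> y) (- gamma y u v) w + g y (dird u (dird v \<xi>) y - dird (gamma y u v) \<xi> y) w) (at 0)"
    using bilinear_family_has_real_derivative[where q = g and y = "\<lambda>t. F (t, y)" and t = 0, OF open_U yU(1) bilinear_g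
        g_differentiable[OF yU(1)] flow_has_vector_derivative(1)[OF y] da has_vector_derivative_const[of w]]
    by (simp add: dg_def F_0[OF y] a0 bilinear_rzero[OF bilinear_g[OF yU(2)]])
  moreover have "((\<lambda>t. koszul (F (t, y)) (dird (0, u) F (t, y)) (dird (0, v) F (t, y)) w) has_real_derivative
     dird (\<xi> y) (\<lambda>x. koszul x u v w) y + koszul y (dird u \<xi> y) v w + koszul y u (dird v \<xi> y) w) (at 0)"
    using bilinear_family_has_real_derivative[where q = "\<lambda>x u v. koszul x u v w" and y = "\<lambda>t. F (t, y)" and t = 0,
        OF open_U yU(1) bilinear_koszul smooth_on_differentiable[OF smooth_koszul yU(1)]
        flow_has_vector_derivative(1)[OF y] flow_has_vector_derivative(2)[OF y] flow_has_vector_derivative(2)[OF y]]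
    by (simp add: F_0[OF y] initial_derivatives[OF y])
  ultimately have "((\<lambda>t. g (F (t, y)) (a t) w + koszul (F (t, y)) (dird (0, u) F (t, y)) (dird (0, v) F (t, y)) w)
      has_real_derivative dg y (\<xi> y) (- gamma y u v) w + g y (dird u (dird v \<xi>) y - dird (gamma y u v) \<xi> y) w +
     (dird (\<xi> y) (\<lambda>x. koszul x u v w) y + koszul y (dird u \<xi> y) v w + koszul y u (dird v \<xi> y) w)) (at 0)"
    by (rule DERIV_add)
  moreover have "dird (\<xi> y) (\<lambda>x. koszul x u v w) y =
      (ddg y (\<xi> y) u v w + ddg y (\<xi> y) v u w - ddg y (\<xi> y) w u v) / 2"
    unfolding koszul_def ddg_def
    by (rule dird_eqI, rule bounded_linear.has_derivative[OF bounded_linear_divide])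
      (intro has_derivative_add has_derivative_diff dird_has_derivative dg_differentiable yU(2))
  ultimately have "((\<lambda>t. g (F (t, y)) (a t) w + koszul (F (t, y)) (dird (0, u) F (t, y)) (dird (0, v) F (t, y)) w)
      has_real_derivative tension_variation \<xi> y u v w) (at 0)"
    unfolding tension_variation_eq[OF yU(2) smooth_\<xi>]
    by (simp add: bilinear_lneg[OF bilinear_dg[OF yU(2)]] bilinear_lsub[OF bilinear_g[OF yU(2)]] algebra_simps)
  note deriv = this
  have eq: "g (F (t, y)) (a t) w + koszul (F (t, y)) (dird (0, u) F (t, y)) (dird (0, v) F (t, y)) w
      = g (F (t, y)) (second_form (\<lambda>x. F (t, x)) y u v) w" if "t \<in> {t. (t, y) \<in> N}" for t
  proof -
    have tN: "(t, y) \<in> N" using that by simp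
    show ?thesis
      by (simp add: second_form_flow[OF tN] a_def bilinear_ladd[OF bilinear_g[OF F_in[OF tN]]] gamma(1)[OF F_in[OF tN]])
  qed
  show ?thesis
    by (rule has_field_derivative_transform_within_open[OF deriv open_slice_left[OF open_N] _ eq]) (use y in auto)
qed

text \<open>The tension field vanishes at \<open>t = 0\<close>, so the derivative of \<open>g(\<tau>, w)\<close> there is \<open>g(\<tau>', w)\<close>. This lets one pass between
\<open>\<tau>\<close> and its explicit components with lowered index.\<close>

lemma tension_derivative_zero_iff:
  assumes y: "(0, y) \<in> N"
  shows "((\<lambda>t. \<Sum>e\<in>E. second_form (\<lambda>x. F (t, x)) y e e) has_vector_derivative 0) (at 0) \<longleftrightarrow>
     (\<forall>w. (\<Sum>e\<in>E. tension_variation \<xi> y e e w) = 0)"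
proof -
  have yU: "F (0, y) \<in> U" "y \<in> U" using F_in[OF y] initial_slice_in_U[OF y] by auto
  define \<tau> where "\<tau> t = (\<Sum>e\<in>E. second_form (\<lambda>x. F (t, x)) y e e)" for t
  have \<tau>0: "\<tau> 0 = 0"
    by (simp add: \<tau>_def second_form_flow[OF y] initial_derivatives[OF y] F_0[OF y])
  have d: "((\<lambda>t. g (F (t, y)) (\<tau> t) w) has_real_derivative (\<Sum>e\<in>E. tension_variation \<xi> y e e w)) (at 0)" for w
  proof (rule has_field_derivative_transform_within_open[OF _ open_slice_left[OF open_N]])
    show "((\<lambda>t. \<Sum>e\<in>E. g (F (t, y)) (second_form (\<lambda>x. F (t, x)) y e e) w) has_real_derivative
        (\<Sum>e\<in>E. tension_variation \<xi> y e e w)) (at 0)"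
      by (intro DERIV_sum second_form_has_real_derivative[OF y])
    show "0 \<in> {t. (t, y) \<in> N}" using y by simp
    fix t assume "t \<in> {t. (t, y) \<in> N}"
    then show "(\<Sum>e\<in>E. g (F (t, y)) (second_form (\<lambda>x. F (t, x)) y e e) w) = g (F (t, y)) (\<tau> t) w"
      unfolding \<tau>_def
      using linear_sum[OF bilinear_linear_left[OF bilinear_g[OF F_in]], of "(t, y)" "\<lambda>e. second_form (\<lambda>x. F (t, x)) y e e" E w]
      by simp
  qed
  have "(\<tau> has_vector_derivative 0) (at 0) \<longleftrightarrow> (\<forall>w. (\<Sum>e\<in>E. tension_variation \<xi> y e e w) = 0)"
  proof
    assume \<tau>': "(\<tau> has_vector_derivative 0) (at 0)"
    have "dird (\<xi> y) (\<lambda>x. g x 0 w) y = 0" for w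
      using bilinear_lzero[OF bilinear_dg[OF yU(2)], of "\<xi> y" w] by (simp add: dg_def)
    then have "((\<lambda>t. g (F (t, y)) (\<tau> t) w) has_real_derivative 0) (at 0)" for w
      using bilinear_family_has_real_derivative[where q = g and y = "\<lambda>t. F (t, y)" and t = 0, OF open_U yU(1) bilinear_g
          g_differentiable[OF yU(1)] flow_has_vector_derivative(1)[OF y] \<tau>' has_vector_derivative_const[of w]]
      by (simp add: F_0[OF y] \<tau>0 bilinear_rzero[OF bilinear_g[OF yU(2)]] bilinear_lzero[OF bilinear_g[OF yU(2)]])
    then show "\<forall>w. (\<Sum>e\<in>E. tension_variation \<xi> y e e w) = 0" using d DERIV_unique by blast
  next
    assume "\<forall>w. (\<Sum>e\<in>E. tension_variation \<xi> y e e w) = 0"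
    then have "((\<lambda>t. g (F (t, y)) (\<tau> t) w) has_real_derivative 0) (at 0)" for w using d by metis
    moreover have "isCont (\<lambda>t. F (t, y)) 0"
      using has_vector_derivative_continuous[OF flow_has_vector_derivative(1)[OF y]] .
    ultimately show "(\<tau> has_vector_derivative 0) (at 0)"
      using raise_index_derivative_zero[of "\<lambda>t. F (t, y)" \<tau>, OF _ yU(1) \<tau>0] by blast
  qed
  then show ?thesis by (simp add: \<tau>_def[abs_def])
qed

end

section \<open>Charts and smooth maps\<close>

abbreviation chart_image :: "('a, 'e) chart \<Rightarrow> 'e set" where
  "chart_image c \<equiv> snd c ` fst c"

text \<open>The part of the definition of an atlas that concerns single charts; a product of atlases inherits it chart by chart.\<close>

definition charted :: "('a::topological_space, 'e::euclidean_space) chart set \<Rightarrow> bool" where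
  "charted A \<longleftrightarrow> (\<forall>c\<in>A. is_chart c) \<and> (\<Union>c\<in>A. fst c) = UNIV"

lemma charted_chart: "charted A \<Longrightarrow> c \<in> A \<Longrightarrow> is_chart c"
  by (simp add: charted_def)

lemma charted_cover: "charted A \<Longrightarrow> \<exists>c\<in>A. p \<in> fst c"
  unfolding charted_def by blast

lemma smooth_atlas_charted: "smooth_atlas A \<Longrightarrow> charted A"
  by (simp add: charted_def smooth_atlas_def)

lemma chart_homeomorphism:
  "is_chart c \<Longrightarrow> homeomorphism (fst c) (chart_image c) (snd c) (chart_inv c)"
  by (simp only: is_chart_def)

lemma chart_open_domain: "is_chart c \<Longrightarrow> open (fst c)"
  by (simp only: is_chart_def)

lemma chart_open_image: "is_chart c \<Longrightarrow> open (chart_image c)"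
  by (simp only: is_chart_def)

lemma chart_continuous: "is_chart c \<Longrightarrow> continuous_on (fst c) (snd c)"
  using chart_homeomorphism unfolding homeomorphism_def by blast

lemma chart_inv_continuous: "is_chart c \<Longrightarrow> continuous_on (chart_image c) (chart_inv c)"
  using chart_homeomorphism unfolding homeomorphism_def by blast

lemma chart_inv_chart [simp]: "is_chart c \<Longrightarrow> p \<in> fst c \<Longrightarrow> chart_inv c (snd c p) = p"
  using chart_homeomorphism unfolding homeomorphism_def by blast

lemma chart_inv_in: "is_chart c \<Longrightarrow> y \<in> chart_image c \<Longrightarrow> chart_inv c y \<in> fst c"
  by auto

lemma chart_chart_inv: "is_chart c \<Longrightarrow> y \<in> chart_image c \<Longrightarrow> snd c (chart_inv c y) = y"
  by auto

lemma chart_image_inter: "is_chart c \<Longrightarrow> snd c ` (fst c \<inter> W) = chart_image c \<inter> chart_inv c -` W"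
  by auto

lemma open_chart_image_inter:
  assumes "is_chart c" "open W"
  shows "open (snd c ` (fst c \<inter> W))"
  unfolding chart_image_inter[OF assms(1)]
  by (rule continuous_open_preimage[OF chart_inv_continuous[OF assms(1)] chart_open_image[OF assms(1)] assms(2)])

lemma open_local_domain:
  assumes "is_chart c" "open W" "continuous_on W f" "open V"
  shows "open (snd c ` (fst c \<inter> W \<inter> f -` V))"
  using open_chart_image_inter[OF assms(1) continuous_open_preimage[OF assms(3,2,4)]]
  by (simp add: Int_assoc)

lemma smooth_map_onD:
  assumes "smooth_map_on A B W f"
  shows smooth_map_on_continuous: "continuous_on W f"
    and smooth_map_on_local_rep: "c \<in> A \<Longrightarrow> d \<in> B \<Longrightarrow>
      smooth_on (snd c ` (fst c \<inter> W \<inter> f -` fst d)) (local_rep c d f)"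
  using assms by (auto simp: smooth_map_on_def)

lemma smooth_map_on_subset:
  assumes "smooth_map_on A B W f" "V \<subseteq> W"
  shows "smooth_map_on A B V f"
  unfolding smooth_map_on_def
proof (intro conjI ballI)
  show "continuous_on V f"
    using continuous_on_subset[OF smooth_map_on_continuous[OF assms(1)] assms(2)] .
  show "smooth_on (snd c ` (fst c \<inter> V \<inter> f -` fst d)) (local_rep c d f)" if "c \<in> A" "d \<in> B" for c d
    by (rule smooth_on_subset[OF smooth_map_on_local_rep[OF assms(1) that]]) (use assms(2) in auto)
qed

text \<open>Smoothness is a local property, and near a given point one chart of the intermediate manifold suffices.\<close>

lemma smooth_map_on_compose:
  assumes A: "charted A" and B: "charted B" and C: "charted C"
    and f: "smooth_map_on A B W f" and g: "smooth_map_on B C V g"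
    and W: "open W" and V: "open V" and fW: "f ` W \<subseteq> V"
  shows "smooth_map_on A C W (\<lambda>x. g (f x))"
  unfolding smooth_map_on_def
proof (intro conjI ballI)
  show "continuous_on W (\<lambda>x. g (f x))"
    using continuous_on_compose2[OF smooth_map_on_continuous[OF g] smooth_map_on_continuous[OF f] fW] .
  fix c d assume c: "c \<in> A" and d: "d \<in> C"
  note cc = charted_chart[OF A c] and dd = charted_chart[OF C d]
  show "smooth_on (snd c ` (fst c \<inter> W \<inter> (\<lambda>x. g (f x)) -` fst d)) (local_rep c d (\<lambda>x. g (f x)))"
  proof (rule smooth_on_local)
    fix y assume "y \<in> snd c ` (fst c \<inter> W \<inter> (\<lambda>x. g (f x)) -` fst d)"
    then obtain x where x: "x \<in> fst c" "x \<in> W" "g (f x) \<in> fst d" "y = snd c x" by auto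
    obtain b where b: "b \<in> B" "f x \<in> fst b" using charted_cover[OF B] by blast
    note bb = charted_chart[OF B b(1)]
    define Q where "Q = fst b \<inter> (V \<inter> g -` fst d)"
    have Q: "open Q"
      unfolding Q_def using V chart_open_domain[OF bb] chart_open_domain[OF dd] smooth_map_on_continuous[OF g]
      by (intro open_Int continuous_open_preimage)
    define T where "T = snd c ` (fst c \<inter> W \<inter> f -` Q)"
    have T: "open T" unfolding T_def
      by (rule open_local_domain[OF cc W smooth_map_on_continuous[OF f] Q])
    have yT: "y \<in> T" unfolding T_def Q_def using x b fW by auto
    have sf: "smooth_on T (local_rep c b f)"
      by (rule smooth_on_subset[OF smooth_map_on_local_rep[OF f c b(1)]]) (auto simp: T_def Q_def)
    have T2: "open (snd b ` (fst b \<inter> V \<inter> g -` fst d))"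
      by (rule open_local_domain[OF bb V smooth_map_on_continuous[OF g] chart_open_domain[OF dd]])
    have im: "local_rep c b f ` T \<subseteq> snd b ` (fst b \<inter> V \<inter> g -` fst d)"
      unfolding T_def Q_def using cc by (auto simp: local_rep_def)
    have "smooth_on T (\<lambda>z. local_rep b d g (local_rep c b f z))"
      by (rule smooth_on_compose[OF T T2 im sf smooth_map_on_local_rep[OF g b(1) d]])
    moreover have "local_rep b d g (local_rep c b f z) = local_rep c d (\<lambda>x. g (f x)) z" if "z \<in> T" for z
      using that cc bb by (auto simp: T_def Q_def local_rep_def)
    ultimately have "smooth_on T (local_rep c d (\<lambda>x. g (f x)))"
      using smooth_on_cong[OF T, of "\<lambda>z. local_rep b d g (local_rep c b f z)" "local_rep c d (\<lambda>x. g (f x))"] by simp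
    then show "\<exists>T. open T \<and> y \<in> T \<and> smooth_on T (local_rep c d (\<lambda>x. g (f x)))"
      using T yT by blast
  qed
qed

lemma smooth_map_on_id: "smooth_atlas A \<Longrightarrow> smooth_map_on A A UNIV id"
  by (auto simp: smooth_map_on_def smooth_atlas_def continuous_on_id)

lemma chart_inv_euclidean [simp]: "chart_inv (UNIV, id) = id"
  by (auto simp: chart_inv_def fun_eq_iff)

lemma is_chart_euclidean: "is_chart (UNIV, id)"
  by (simp add: is_chart_def homeomorphism_def)

lemma charted_euclidean_atlas: "charted euclidean_atlas"
  by (auto simp: charted_def euclidean_atlas_def is_chart_euclidean)

lemma chart_inv_prod:
  assumes "is_chart c" "is_chart d" "y \<in> chart_image c" "z \<in> chart_image d"
  shows "chart_inv (fst c \<times> fst d, map_prod (snd c) (snd d)) (y, z) = (chart_inv c y, chart_inv d z)"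
proof -
  have "inj_on (map_prod (snd c) (snd d)) (fst c \<times> fst d)"
    using assms(1,2) by (intro map_prod_inj_on inj_on_inverseI[of _ "chart_inv c"] inj_on_inverseI[of _ "chart_inv d"]) auto
  moreover have "(chart_inv c y, chart_inv d z) \<in> fst c \<times> fst d"
    using assms by (auto intro: chart_inv_in)
  ultimately have "inv_into (fst c \<times> fst d) (map_prod (snd c) (snd d)) (map_prod (snd c) (snd d) (chart_inv c y, chart_inv d z))
      = (chart_inv c y, chart_inv d z)"
    by (rule inv_into_f_f)
  then show ?thesis using assms by (simp add: chart_inv_def[of "(fst c \<times> fst d, map_prod (snd c) (snd d))"] chart_chart_inv)
qed

lemma is_chart_prod:
  fixes c :: "('a::topological_space, 'e::euclidean_space) chart" and d :: "('b::topological_space, 'f::euclidean_space) chart"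
  assumes c: "is_chart c" and d: "is_chart d"
  shows "is_chart (fst c \<times> fst d, map_prod (snd c) (snd d))" (is "is_chart ?p")
proof -
  have im: "map_prod (snd c) (snd d) ` (fst c \<times> fst d) = chart_image c \<times> chart_image d"
    by (rule map_prod_surj_on[OF refl refl])
  have inv: "chart_inv ?p x = (chart_inv c (fst x), chart_inv d (snd x))" if "x \<in> chart_image c \<times> chart_image d" for x
    using that chart_inv_prod[OF c d] by auto
  have "continuous_on (fst c \<times> fst d) (map_prod (snd c) (snd d))"
    unfolding map_prod_def case_prod_beta
    by (intro continuous_on_Pair continuous_on_compose2[OF chart_continuous[OF c] continuous_on_fst]
        continuous_on_compose2[OF chart_continuous[OF d] continuous_on_snd] continuous_on_id) auto
  moreover have "continuous_on (chart_image c \<times> chart_image d) (\<lambda>x. (chart_inv c (fst x), chart_inv d (snd x)))"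
    by (intro continuous_on_Pair continuous_on_compose2[OF chart_inv_continuous[OF c] continuous_on_fst]
        continuous_on_compose2[OF chart_inv_continuous[OF d] continuous_on_snd] continuous_on_id) auto
  then have "continuous_on (chart_image c \<times> chart_image d) (chart_inv ?p)"
    using inv by (simp cong: continuous_on_cong)
  moreover have "(\<lambda>x. (chart_inv c (fst x), chart_inv d (snd x))) ` (chart_image c \<times> chart_image d) = fst c \<times> fst d"
  proof
    show "fst c \<times> fst d \<subseteq> (\<lambda>x. (chart_inv c (fst x), chart_inv d (snd x))) ` (chart_image c \<times> chart_image d)"
    proof
      fix x assume "x \<in> fst c \<times> fst d"
      then show "x \<in> (\<lambda>x. (chart_inv c (fst x), chart_inv d (snd x))) ` (chart_image c \<times> chart_image d)"
        using c d by (intro image_eqI[of _ _ "(snd c (fst x), snd d (snd x))"]) auto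
    qed
  qed (use c d in \<open>auto intro: chart_inv_in\<close>)
  then have "chart_inv ?p ` (chart_image c \<times> chart_image d) = fst c \<times> fst d"
    using inv by (simp cong: image_cong)
  moreover have "chart_inv ?p (map_prod (snd c) (snd d) x) = x" if "x \<in> fst c \<times> fst d" for x
    using that c d inv[of "map_prod (snd c) (snd d) x"] by auto
  moreover have "map_prod (snd c) (snd d) (chart_inv ?p x) = x" if "x \<in> chart_image c \<times> chart_image d" for x
    using that c d inv[OF that] by (auto simp: chart_chart_inv)
  ultimately show ?thesis
    unfolding is_chart_def homeomorphism_def fst_conv snd_conv im
    using open_Times[OF chart_open_domain[OF c] chart_open_domain[OF d]]
      open_Times[OF chart_open_image[OF c] chart_open_image[OF d]] by simp
qed

lemma charted_prod_atlas:
  assumes "charted A" "charted B"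
  shows "charted (prod_atlas A B)"
  unfolding charted_def
proof (intro conjI ballI)
  fix p assume "p \<in> prod_atlas A B"
  then obtain c d where "p = (fst c \<times> fst d, map_prod (snd c) (snd d))" "c \<in> A" "d \<in> B"
    unfolding prod_atlas_def by blast
  then show "is_chart p" using is_chart_prod[of c d] assms by (simp add: charted_def)
next
  have "\<exists>p\<in>prod_atlas A B. x \<in> fst p" for x
  proof -
    obtain c d where "c \<in> A" "fst x \<in> fst c" "d \<in> B" "snd x \<in> fst d"
      using charted_cover[OF assms(1)] charted_cover[OF assms(2)] by blast
    then have "(fst c \<times> fst d, map_prod (snd c) (snd d)) \<in> prod_atlas A B"
      unfolding prod_atlas_def by blast
    moreover have "x \<in> fst (fst c \<times> fst d, map_prod (snd c) (snd d))"
      using \<open>fst x \<in> fst c\<close> \<open>snd x \<in> fst d\<close> by (simp add: mem_Times_iff)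
    ultimately show ?thesis by blast
  qed
  then show "(\<Union>c\<in>prod_atlas A B. fst c) = UNIV" by blast
qed

lemma smooth_map_on_slice:
  fixes A :: "('a::topological_space, 'e::euclidean_space) chart set"
    and B :: "('b::{t2_space,second_countable_topology}, 'f::euclidean_space) chart set"
  assumes A: "charted A" and B: "smooth_atlas B" and C: "charted C" and D: "open D"
    and f: "smooth_map_on (prod_atlas A B) C D (\<lambda>(x, y). f x y)"
  shows "smooth_map_on B C {y. (a, y) \<in> D} (f a)"
proof -
  note B' = smooth_atlas_charted[OF B]
  have W: "open {y. (a, y) \<in> D}" by (rule open_slice_right[OF D])
  have "smooth_map_on B (prod_atlas A B) {y. (a, y) \<in> D} (Pair a)"
    unfolding smooth_map_on_def
  proof (intro conjI ballI)
    show cont: "continuous_on {y. (a, y) \<in> D} (Pair a)" by (intro continuous_intros)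
    fix c p assume c: "c \<in> B" and p: "p \<in> prod_atlas A B"
    then obtain d e where p_eq: "p = (fst d \<times> fst e, map_prod (snd d) (snd e))" and d: "d \<in> A" and e: "e \<in> B"
      by (auto simp: prod_atlas_def)
    let ?S = "snd c ` (fst c \<inter> {y. (a, y) \<in> D} \<inter> Pair a -` fst p)"
    have S: "open ?S"
      using charted_prod_atlas[OF A B'] p
      by (intro open_local_domain charted_chart[OF B' c] W cont chart_open_domain charted_chart)
    have "smooth_on (snd c ` (fst c \<inter> fst e)) (local_rep c e id)"
      using B c e by (simp add: smooth_atlas_def)
    then have "smooth_on ?S (local_rep c e id)"
      by (rule smooth_on_subset) (auto simp: p_eq)
    from smooth_on_Pair[OF S smooth_on_const[of _ "snd d a"] this]
    show "smooth_on ?S (local_rep c p (Pair a))"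
      by (simp add: local_rep_def p_eq o_def)
  qed
  from smooth_map_on_compose[OF B' charted_prod_atlas[OF A B'] C this f W D]
  show ?thesis by auto
qed

section \<open>Tangent vectors in charts\<close>

lemma smooth_near_iff:
  "smooth_near A p f \<longleftrightarrow> (\<exists>W. open W \<and> p \<in> W \<and> continuous_on W f \<and>
     (\<forall>c\<in>A. smooth_on (snd c ` (fst c \<inter> W)) (f \<circ> chart_inv c)))"
  by (simp add: smooth_near_def smooth_map_on_def euclidean_atlas_def local_rep_def)

lemma smooth_near_differentiable:
  assumes "smooth_near A p f" "c \<in> A" "p \<in> fst c"
  shows "(f \<circ> chart_inv c) differentiable at (snd c p)"
proof -
  obtain W where W: "p \<in> W" "smooth_on (snd c ` (fst c \<inter> W)) (f \<circ> chart_inv c)"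
    using assms(1,2) unfolding smooth_near_iff by blast
  show ?thesis
    by (rule smooth_on_differentiable[OF W(2)]) (use W(1) assms(3) in blast)
qed

lemma smooth_near_compose:
  assumes A: "charted A" and B: "charted B" and \<psi>: "smooth_map_on A B W \<psi>" "open W" "p \<in> W"
    and f: "smooth_near B (\<psi> p) f"
  shows "smooth_near A p (f \<circ> \<psi>)"
proof -
  obtain V where V: "open V" "\<psi> p \<in> V" "smooth_map_on B euclidean_atlas V f"
    using f by (auto simp: smooth_near_def)
  have o: "open (W \<inter> \<psi> -` V)"
    using continuous_open_preimage[OF smooth_map_on_continuous[OF \<psi>(1)] \<psi>(2) V(1)] .
  have "smooth_map_on A euclidean_atlas (W \<inter> \<psi> -` V) (\<lambda>x. f (\<psi> x))"
    by (rule smooth_map_on_compose[OF A B charted_euclidean_atlas smooth_map_on_subset[OF \<psi>(1)] V(3) o V(1)]) auto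
  then show ?thesis
    unfolding smooth_near_def o_def using o \<psi>(3) V(2) by (intro exI[of _ "W \<inter> \<psi> -` V"]) auto
qed

lemma smooth_near_coordinate:
  assumes A: "smooth_atlas A" and c: "c \<in> A" "p \<in> fst c"
  shows "smooth_near A p (\<lambda>x. snd c x \<bullet> b)"
  unfolding smooth_near_iff
proof (intro exI[of _ "fst c"] conjI ballI c(2))
  note ch = charted_chart[OF smooth_atlas_charted[OF A]]
  show "open (fst c)" "continuous_on (fst c) (\<lambda>x. snd c x \<bullet> b)"
    using chart_open_domain[OF ch[OF c(1)]] chart_continuous[OF ch[OF c(1)]] by (auto intro: continuous_intros)
  fix d assume d: "d \<in> A"
  have "smooth_on (snd d ` (fst d \<inter> fst c)) (local_rep d c id)"
    using A c d by (simp add: smooth_atlas_def)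
  then have "smooth_on (snd d ` (fst d \<inter> fst c)) (\<lambda>z. local_rep d c id z \<bullet> b)"
    using open_chart_image_inter[OF ch[OF d] chart_open_domain[OF ch[OF c(1)]]]
    by (intro smooth_on_linear[OF _ bounded_linear_inner_left])
  then show "smooth_on (snd d ` (fst d \<inter> fst c)) ((\<lambda>x. snd c x \<bullet> b) \<circ> chart_inv d)"
    by (simp add: local_rep_def o_def)
qed

lemma coord_vec_coordinate:
  assumes A: "smooth_atlas A" and c: "c \<in> A" "p \<in> fst c"
  shows "coord_vec A c p u (\<lambda>x. snd c x \<bullet> b) = u \<bullet> b"
proof -
  note ch = charted_chart[OF smooth_atlas_charted[OF A] c(1)]
  have "dird u ((\<lambda>x. snd c x \<bullet> b) \<circ> chart_inv c) (snd c p) = dird u (\<lambda>y. y \<bullet> b) (snd c p)"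
    by (rule dird_cong_open[OF chart_open_image[OF ch]]) (use c ch in auto)
  also have "\<dots> = u \<bullet> b"
    by (rule dird_eqI) (intro bounded_linear_imp_has_derivative bounded_linear_inner_left)
  finally show ?thesis
    unfolding coord_vec_def using smooth_near_coordinate[OF A c] by simp
qed

text \<open>The coordinate functions of the chart recover the components.\<close>

lemma coord_vec_inject:
  assumes A: "smooth_atlas A" and c: "c \<in> A" "p \<in> fst c"
  shows "coord_vec A c p u = coord_vec A c p v \<longleftrightarrow> u = v"
proof
  assume "coord_vec A c p u = coord_vec A c p v"
  then have "u \<bullet> b = v \<bullet> b" for b
    using coord_vec_coordinate[OF A c, of u b] coord_vec_coordinate[OF A c, of v b] by simp
  then show "u = v" by (rule euclidean_eqI)
qed simp

lemma coord_vec_combination: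
  assumes c: "c \<in> A" "p \<in> fst c"
  shows "coord_vec A c p (a *\<^sub>R u + b *\<^sub>R v) = (\<lambda>f. a * coord_vec A c p u f + b * coord_vec A c p v f)"
proof
  fix f
  show "coord_vec A c p (a *\<^sub>R u + b *\<^sub>R v) f = a * coord_vec A c p u f + b * coord_vec A c p v f"
    using dird_linear[OF smooth_near_differentiable[OF _ c, of f]]
    by (simp add: coord_vec_def linear_add linear_scale)
qed

lemma coord_vec_0:
  assumes c: "c \<in> A" "p \<in> fst c"
  shows "coord_vec A c p 0 = (\<lambda>f. 0)"
  using linear_0[OF dird_linear[OF smooth_near_differentiable[OF _ c]]] by (simp add: coord_vec_def fun_eq_iff)

text \<open>The differential of a map in charts. The content is the chain rule and that \<open>f \<circ> \<psi>\<close> is smooth near \<open>p\<close>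
whenever \<open>f\<close> is smooth near \<open>\<psi> p\<close>, which matters because tangent vectors are 0 on other functions.\<close>

lemma pushforward_coord_vec:
  assumes A: "charted A" and B: "charted B" and \<psi>: "smooth_map_on A B W \<psi>" "open W" "p \<in> W"
    and c: "c \<in> A" "p \<in> fst c" and d: "d \<in> B" "\<psi> p \<in> fst d"
  shows "pushforward B \<psi> p (coord_vec A c p u) = coord_vec B d (\<psi> p) (dird u (local_rep c d \<psi>) (snd c p))"
proof
  fix f
  show "pushforward B \<psi> p (coord_vec A c p u) f = coord_vec B d (\<psi> p) (dird u (local_rep c d \<psi>) (snd c p)) f"
  proof (cases "smooth_near B (\<psi> p) f")
    case True
    note cc = charted_chart[OF A c(1)] and dd = charted_chart[OF B d(1)]
    let ?S = "snd c ` (fst c \<inter> W \<inter> \<psi> -` fst d)"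
    have S: "open ?S" "snd c p \<in> ?S"
      using open_local_domain[OF cc \<psi>(2) smooth_map_on_continuous[OF \<psi>(1)] chart_open_domain[OF dd]] \<psi>(3) c d by auto
    have p: "local_rep c d \<psi> (snd c p) = snd d (\<psi> p)" using cc c by (simp add: local_rep_def)
    have der: "local_rep c d \<psi> differentiable at (snd c p)"
      by (rule smooth_on_differentiable[OF smooth_map_on_local_rep[OF \<psi>(1) c(1) d(1)] S(2)])
    have "dird u ((f \<circ> \<psi>) \<circ> chart_inv c) (snd c p) = dird u ((f \<circ> chart_inv d) \<circ> local_rep c d \<psi>) (snd c p)"
      by (rule dird_cong_open[OF S]) (use cc dd in \<open>auto simp: local_rep_def\<close>)
    also have "\<dots> = dird (dird u (local_rep c d \<psi>) (snd c p)) (f \<circ> chart_inv d) (snd d (\<psi> p))"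
      using frechet_derivative_compose[OF der, of "f \<circ> chart_inv d"] smooth_near_differentiable[OF True d] p by simp
    finally show ?thesis
      using True smooth_near_compose[OF A B \<psi> True] by (simp add: pushforward_def coord_vec_def)
  qed (simp add: pushforward_def coord_vec_def)
qed

lemma tangent_space_chart:
  assumes A: "smooth_atlas A" and c: "c \<in> A" "p \<in> fst c"
  shows "tangent_space A p = range (coord_vec A c p)"
proof
  show "range (coord_vec A c p) \<subseteq> tangent_space A p" using c unfolding tangent_space_def by blast
  show "tangent_space A p \<subseteq> range (coord_vec A c p)"
  proof
    fix v assume "v \<in> tangent_space A p"
    then obtain d u where d: "d \<in> A" "p \<in> fst d" and v: "v = coord_vec A d p u"
      unfolding tangent_space_def by blast
    have "pushforward A id p v = coord_vec A c (id p) (dird u (local_rep d c id) (snd d p))"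
      unfolding v using c d
      by (intro pushforward_coord_vec[OF smooth_atlas_charted[OF A] smooth_atlas_charted[OF A] smooth_map_on_id[OF A]]) auto
    moreover have "pushforward A id p v = v"
      unfolding v by (auto simp: pushforward_def coord_vec_def fun_eq_iff)
    ultimately show "v \<in> range (coord_vec A c p)" by auto
  qed
qed

lemma components_coord_vec:
  assumes "smooth_atlas A" "c \<in> A" "p \<in> fst c"
  shows "components A c p (coord_vec A c p u) = u"
  unfolding components_def coord_vec_inject[OF assms] by simp

definition field_rep ::
    "('a::topological_space, 'e::euclidean_space) chart set \<Rightarrow> ('a, 'e) chart \<Rightarrow> ('a \<Rightarrow> 'a tvec) \<Rightarrow> 'e \<Rightarrow> 'e" where
  "field_rep A c X y = components A c (chart_inv c y) (X (chart_inv c y))"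

lemma vector_field_rep:
  assumes A: "smooth_atlas A" and X: "vector_field A X" and c: "c \<in> A"
  shows "smooth_on (chart_image c) (field_rep A c X)"
    and "p \<in> fst c \<Longrightarrow> X p = coord_vec A c p (field_rep A c X (snd c p))"
proof -
  show "smooth_on (chart_image c) (field_rep A c X)"
    using X c unfolding vector_field_def field_rep_def[abs_def] by blast
  assume p: "p \<in> fst c"
  have "X p \<in> range (coord_vec A c p)"
    using X tangent_space_chart[OF A c p] unfolding vector_field_def by blast
  then obtain u where "X p = coord_vec A c p u" by auto
  then show "X p = coord_vec A c p (field_rep A c X (snd c p))"
    using components_coord_vec[OF A c p] p charted_chart[OF smooth_atlas_charted[OF A] c]
    by (simp add: field_rep_def)
qed

lemma coordinate_metric_chart:
  assumes A: "smooth_atlas A" and h: "riemannian_metric A h" and c: "c \<in> A"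
  shows "coordinate_metric (chart_image c) (metric_rep A h c)"
proof
  note ch = charted_chart[OF smooth_atlas_charted[OF A] c]
  show "open (chart_image c)" by (rule chart_open_image[OF ch])
  show "smooth_on (chart_image c) (\<lambda>z. metric_rep A h c z u v)" for u v
    using h c by (simp add: riemannian_metric_def)
  fix z assume z: "z \<in> chart_image c"
  define p where "p = chart_inv c z"
  have p: "p \<in> fst c" unfolding p_def by (rule chart_inv_in[OF ch z])
  let ?v = "coord_vec A c p"
  have T: "?v u \<in> tangent_space A p" for u using tangent_space_chart[OF A c p] by auto
  have sym: "h p (?v u) (?v v) = h p (?v v) (?v u)" for u v
    using h T by (simp add: riemannian_metric_def)
  have comb: "h p (?v (a *\<^sub>R u + b *\<^sub>R v)) (?v w) = a * h p (?v u) (?v w) + b * h p (?v v) (?v w)" for a b u v w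
    using h T unfolding coord_vec_combination[OF c p] riemannian_metric_def by blast
  have lin: "linear (\<lambda>u. h p (?v u) (?v w))" for w
    using comb[where a = 1 and b = 1] comb[where b = 0 and v = 0] by (intro linearI) auto
  then have "linear (\<lambda>u. h p (?v w) (?v u))" for w
    unfolding sym[of w] .
  moreover have "h p (?v u) (?v u) > 0" if "u \<noteq> 0" for u
  proof -
    have "?v u \<noteq> (\<lambda>f. 0)"
      using that coord_vec_inject[OF A c p, of u 0] coord_vec_0[OF c p] by simp
    then show ?thesis using h T by (simp add: riemannian_metric_def)
  qed
  ultimately show "inner_form (metric_rep A h c z)"
    using lin sym by (simp add: inner_form_def bilinear_def metric_rep_def p_def)
qed

section \<open>Local flows in charts\<close>

definition flow_domain ::
    "('a, 'e) chart \<Rightarrow> (real \<times> 'a) set \<Rightarrow> (real \<Rightarrow> 'a \<Rightarrow> 'a) \<Rightarrow> (real \<times> 'e) set" where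
  "flow_domain c D \<phi> = {(t, y). y \<in> chart_image c \<and> (t, chart_inv c y) \<in> D \<and> \<phi> t (chart_inv c y) \<in> fst c}"

definition flow_rep :: "('a, 'e) chart \<Rightarrow> (real \<Rightarrow> 'a \<Rightarrow> 'a) \<Rightarrow> real \<times> 'e \<Rightarrow> 'e" where
  "flow_rep c \<phi> = (\<lambda>(t, y). snd c (\<phi> t (chart_inv c y)))"

lemma flow_rep_slice: "(\<lambda>x. flow_rep c \<phi> (t, x)) = local_rep c c (\<phi> t)"
  by (simp add: flow_rep_def local_rep_def o_def)

lemma local_flowD:
  assumes "local_flow A X D \<phi>"
  shows "open D" and "(0, x) \<in> D" and "\<phi> 0 x = x"
    and "smooth_map_on (prod_atlas euclidean_atlas A) A D (\<lambda>(t, x). \<phi> t x)"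
    and "(t, x) \<in> D \<Longrightarrow> smooth_near A (\<phi> t x) f \<Longrightarrow> ((\<lambda>s. f (\<phi> s x)) has_real_derivative X (\<phi> t x) f) (at t)"
  using assms unfolding local_flow_def by blast+

lemma flow_domain_initial:
  assumes "is_chart c" "local_flow A X D \<phi>" "p \<in> fst c"
  shows "(0, snd c p) \<in> flow_domain c D \<phi>"
  using assms local_flowD(2,3)[OF assms(2)] by (simp add: flow_domain_def)

lemma product_rep_smooth:
  fixes A :: "('a::topological_space, 'e::euclidean_space) chart set"
    and B :: "('b::topological_space, 'f::euclidean_space) chart set"
  assumes A: "charted A" and B: "charted B" and C: "charted C" and D: "open D"
    and f: "smooth_map_on (prod_atlas A B) C D (\<lambda>(x, y). f x y)"
    and c: "c \<in> A" and d: "d \<in> B" and e: "e \<in> C"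
  defines "S \<equiv> {(y, z). y \<in> chart_image c \<and> z \<in> chart_image d \<and> (chart_inv c y, chart_inv d z) \<in> D \<and>
      f (chart_inv c y) (chart_inv d z) \<in> fst e}"
  shows "open S" and "smooth_on S (\<lambda>(y, z). snd e (f (chart_inv c y) (chart_inv d z)))"
proof -
  note cc = charted_chart[OF A c] and dd = charted_chart[OF B d] and ee = charted_chart[OF C e]
  define P where "P = (fst c \<times> fst d, map_prod (snd c) (snd d))"
  have P: "P \<in> prod_atlas A B"
    unfolding prod_atlas_def P_def using c d by blast
  have inv: "chart_inv P (y, z) = (chart_inv c y, chart_inv d z)" if "y \<in> chart_image c" "z \<in> chart_image d" for y z
    unfolding P_def using chart_inv_prod[OF cc dd that] .
  let ?f = "\<lambda>(x, y). f x y"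
  have dom: "S = snd P ` (fst P \<inter> D \<inter> ?f -` fst e)"
  proof
    show "snd P ` (fst P \<inter> D \<inter> ?f -` fst e) \<subseteq> S"
      using cc dd by (auto simp: P_def S_def)
    show "S \<subseteq> snd P ` (fst P \<inter> D \<inter> ?f -` fst e)"
    proof
      fix q assume "q \<in> S"
      then obtain y z where q: "q = (y, z)" "y \<in> chart_image c" "z \<in> chart_image d"
          "(chart_inv c y, chart_inv d z) \<in> D" "f (chart_inv c y) (chart_inv d z) \<in> fst e"
        by (auto simp: S_def)
      then show "q \<in> snd P ` (fst P \<inter> D \<inter> ?f -` fst e)"
        using chart_inv_in[OF cc q(2)] chart_chart_inv[OF cc q(2)] chart_inv_in[OF dd q(3)] chart_chart_inv[OF dd q(3)]
        by (intro image_eqI[of _ _ "(chart_inv c y, chart_inv d z)"]) (auto simp: P_def)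
    qed
  qed
  show o: "open S"
    unfolding dom
    by (rule open_local_domain[OF charted_chart[OF charted_prod_atlas[OF A B] P] D
          smooth_map_on_continuous[OF f] chart_open_domain[OF ee]])
  have "smooth_on S (local_rep P e ?f)"
    unfolding dom by (rule smooth_map_on_local_rep[OF f P e])
  moreover have "local_rep P e ?f q = (\<lambda>(y, z). snd e (f (chart_inv c y) (chart_inv d z))) q" if "q \<in> S" for q
    using that inv by (auto simp: S_def local_rep_def)
  ultimately show "smooth_on S (\<lambda>(y, z). snd e (f (chart_inv c y) (chart_inv d z)))"
    using smooth_on_cong[OF o, of "local_rep P e ?f"] by blast
qed

lemma flow_rep_smooth:
  assumes A: "smooth_atlas A" and \<phi>: "local_flow A X D \<phi>" and c: "c \<in> A"
  shows "open (flow_domain c D \<phi>)" and "smooth_on (flow_domain c D \<phi>) (flow_rep c \<phi>)"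
proof -
  have "(UNIV, id) \<in> euclidean_atlas" by (simp add: euclidean_atlas_def)
  from product_rep_smooth[OF charted_euclidean_atlas smooth_atlas_charted[OF A] smooth_atlas_charted[OF A]
      local_flowD(1)[OF \<phi>] local_flowD(4)[OF \<phi>] this c c]
  show "open (flow_domain c D \<phi>)" "smooth_on (flow_domain c D \<phi>) (flow_rep c \<phi>)"
    by (simp_all add: flow_domain_def flow_rep_def)
qed

text \<open>The differential equation of a local flow is stated for test functions; the coordinate functions turn it into
the equation for the generator.\<close>

lemma coordinate_flow_chart:
  assumes A: "smooth_atlas A" and h: "riemannian_metric A h" and X: "vector_field A X"
    and \<phi>: "local_flow A X D \<phi>" and c: "c \<in> A"
  shows "coordinate_flow (chart_image c) (metric_rep A h c) (field_rep A c X) (flow_domain c D \<phi>) (flow_rep c \<phi>)"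
proof -
  note cc = charted_chart[OF smooth_atlas_charted[OF A] c]
  note sm = flow_rep_smooth[OF A \<phi> c]
  show ?thesis
  proof (intro coordinate_flow.intro coordinate_metric_chart[OF A h c] coordinate_flow_axioms.intro)
    show "smooth_on (chart_image c) (field_rep A c X)" by (rule vector_field_rep(1)[OF A X c])
    show "open (flow_domain c D \<phi>)" "smooth_on (flow_domain c D \<phi>) (flow_rep c \<phi>)" by (rule sm)+
    show "flow_rep c \<phi> q \<in> chart_image c" if "q \<in> flow_domain c D \<phi>" for q
      using that by (auto simp: flow_domain_def flow_rep_def)
    fix z assume z: "(0, z) \<in> flow_domain c D \<phi>"
    then have zc: "z \<in> chart_image c" by (auto simp: flow_domain_def)
    define x where "x = chart_inv c z"
    have x: "x \<in> fst c" "snd c x = z" unfolding x_def using chart_inv_in[OF cc zc] chart_chart_inv[OF cc zc] .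
    show "flow_rep c \<phi> (0, z) = z"
      using local_flowD(3)[OF \<phi>] x by (simp add: flow_rep_def x_def)
    show "dird (1, 0) (flow_rep c \<phi>) (0, z) = field_rep A c X z"
    proof (rule euclidean_eqI)
      fix b :: 'b
      have "((\<lambda>s. flow_rep c \<phi> (s, z)) has_vector_derivative dird (1, 0) (flow_rep c \<phi>) (0, z)) (at 0)"
        by (rule has_vector_derivative_slice_left[OF smooth_on_differentiable[OF sm(2) z]])
      from bounded_linear.has_vector_derivative[OF bounded_linear_inner_left this]
      have "((\<lambda>s. snd c (\<phi> s x) \<bullet> b) has_real_derivative dird (1, 0) (flow_rep c \<phi>) (0, z) \<bullet> b) (at 0)"
        by (simp add: has_real_derivative_iff_has_vector_derivative flow_rep_def x_def)
      moreover have "((\<lambda>s. snd c (\<phi> s x) \<bullet> b) has_real_derivative X x (\<lambda>x. snd c x \<bullet> b)) (at 0)"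
        using local_flowD(5)[OF \<phi> local_flowD(2)[OF \<phi>], of x "\<lambda>x. snd c x \<bullet> b"]
          smooth_near_coordinate[OF A c x(1), of b] local_flowD(3)[OF \<phi>] by simp
      moreover have "X x (\<lambda>x. snd c x \<bullet> b) = field_rep A c X z \<bullet> b"
        using vector_field_rep(2)[OF A X c x(1)] coord_vec_coordinate[OF A c x(1)] x(2) by simp
      ultimately show "dird (1, 0) (flow_rep c \<phi>) (0, z) \<bullet> b = field_rep A c X z \<bullet> b"
        using DERIV_unique by metis
    qed
  qed
qed

abbreviation lie_rep ::
    "('a::topological_space, 'e::euclidean_space) chart set \<Rightarrow> 'a metric \<Rightarrow> ('a \<Rightarrow> 'a tvec) \<Rightarrow> ('a, 'e) chart \<Rightarrow>
     'e \<Rightarrow> 'e \<Rightarrow> 'e \<Rightarrow> real" where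
  "lie_rep A h X c \<equiv> coordinate_metric.lie_metric (metric_rep A h c) (field_rep A c X)"

abbreviation tension_rep ::
    "('a::topological_space, 'e::euclidean_space) chart set \<Rightarrow> 'a metric \<Rightarrow> ('a \<Rightarrow> 'a tvec) \<Rightarrow> ('a, 'e) chart \<Rightarrow>
     'e \<Rightarrow> 'e \<Rightarrow> 'e \<Rightarrow> 'e \<Rightarrow> real" where
  "tension_rep A h X c \<equiv> coordinate_metric.tension_variation (metric_rep A h c) (field_rep A c X)"

lemma pullback_flow_has_real_derivative:
  assumes A: "smooth_atlas A" and h: "riemannian_metric A h" and X: "vector_field A X"
    and \<phi>: "local_flow A X D \<phi>" and c: "c \<in> A" "p \<in> fst c"
  shows "((\<lambda>t. pullback_metric A (\<phi> t) h p (coord_vec A c p u) (coord_vec A c p v)) has_real_derivative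
     lie_rep A h X c (snd c p) u v) (at 0)"
proof -
  interpret coordinate_flow "chart_image c" "metric_rep A h c" "field_rep A c X" "flow_domain c D \<phi>" "flow_rep c \<phi>"
    by (rule coordinate_flow_chart[OF A h X \<phi> c(1)])
  note A' = smooth_atlas_charted[OF A]
  note cc = charted_chart[OF A' c(1)]
  have init: "(0, snd c p) \<in> flow_domain c D \<phi>" by (rule flow_domain_initial[OF cc \<phi> c(2)])
  have eq: "metric_rep A h c (flow_rep c \<phi> (t, snd c p)) (dird (0, u) (flow_rep c \<phi>) (t, snd c p))
      (dird (0, v) (flow_rep c \<phi>) (t, snd c p)) =
      pullback_metric A (\<phi> t) h p (coord_vec A c p u) (coord_vec A c p v)"
    if "t \<in> {t. (t, snd c p) \<in> flow_domain c D \<phi>}" for t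
  proof -
    have t: "(t, snd c p) \<in> flow_domain c D \<phi>" "(t, p) \<in> D" "\<phi> t p \<in> fst c"
      using that cc c by (auto simp: flow_domain_def)
    have "pushforward A (\<phi> t) p (coord_vec A c p u) = coord_vec A c (\<phi> t p) (dird (0, u) (flow_rep c \<phi>) (t, snd c p))" for u
      unfolding dird_slice(1)[OF t(1), symmetric] flow_rep_slice
      using t(2,3) c
      by (intro pushforward_coord_vec[OF A' A' smooth_map_on_slice[OF charted_euclidean_atlas A A' local_flowD(1)[OF \<phi>] local_flowD(4)[OF \<phi>]]]
          open_slice_right local_flowD(1)[OF \<phi>]) auto
    then show ?thesis
      using t(3) cc c by (simp add: pullback_metric_def metric_rep_def flow_rep_def)
  qed
  show ?thesis
    by (rule has_field_derivative_transform_within_open[OF pullback_has_real_derivative[OF init]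
          open_slice_left[OF open_N] _ eq]) (use init in auto)
qed

text \<open>The derivative of the pulled back metric is the same for every local flow, so the choice of the flow drops out.\<close>

lemma killing_field_iff:
  assumes A: "smooth_atlas A" and h: "riemannian_metric A h"
  shows "killing_field A h X \<longleftrightarrow> vector_field A X \<and> (\<exists>D \<phi>. local_flow A X D \<phi>) \<and>
     (\<forall>c\<in>A. \<forall>y\<in>chart_image c. \<forall>u v. lie_rep A h X c y u v = 0)"
    (is "_ \<longleftrightarrow> ?V \<and> ?F \<and> ?L")
proof -
  have "(\<forall>p. \<forall>u\<in>tangent_space A p. \<forall>v\<in>tangent_space A p.
        ((\<lambda>t. pullback_metric A (\<phi> t) h p u v) has_real_derivative 0) (at 0)) \<longleftrightarrow> ?L" (is "?K \<longleftrightarrow> ?L")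
    if X: "vector_field A X" and \<phi>: "local_flow A X D \<phi>" for D \<phi>
  proof
    assume K: ?K
    show ?L
    proof (intro ballI allI)
      fix c y u v assume c: "c \<in> A" and "y \<in> chart_image c"
      then obtain p where p: "p \<in> fst c" "y = snd c p" by auto
      have "coord_vec A c p u \<in> tangent_space A p" for u using tangent_space_chart[OF A c p(1)] by blast
      then have "((\<lambda>t. pullback_metric A (\<phi> t) h p (coord_vec A c p u) (coord_vec A c p v)) has_real_derivative 0) (at 0)"
        using K by blast
      then show "lie_rep A h X c y u v = 0"
        using pullback_flow_has_real_derivative[OF A h X \<phi> c p(1)] p(2) DERIV_unique by blast
    qed
  next
    assume L: ?L
    show ?K
    proof (intro allI ballI)
      fix p u v assume uv: "u \<in> tangent_space A p" "v \<in> tangent_space A p"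
      obtain c where c: "c \<in> A" "p \<in> fst c" using charted_cover[OF smooth_atlas_charted[OF A]] by blast
      obtain u' v' where "u = coord_vec A c p u'" "v = coord_vec A c p v'"
        using uv unfolding tangent_space_chart[OF A c] by blast
      moreover have "lie_rep A h X c (snd c p) u' v' = 0" using L c by blast
      ultimately show "((\<lambda>t. pullback_metric A (\<phi> t) h p u v) has_real_derivative 0) (at 0)"
        using pullback_flow_has_real_derivative[OF A h X \<phi> c, of u' v'] by simp
    qed
  qed
  then show ?thesis unfolding killing_field_def by blast
qed

lemma one_harmonic_field_iff:
  assumes A: "smooth_atlas A" and h: "riemannian_metric A h"
  shows "one_harmonic_field A h X \<longleftrightarrow> vector_field A X \<and> (\<exists>D \<phi>. local_flow A X D \<phi>) \<and>
     (\<forall>c\<in>A. \<forall>y\<in>chart_image c. \<forall>w.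
        (\<Sum>e\<in>(SOME E. orthonormal_basis (metric_rep A h c y) E). tension_rep A h X c y e e w) = 0)"
    (is "_ \<longleftrightarrow> ?V \<and> ?F \<and> ?L")
proof -
  have eq: "((\<lambda>t. tension_field A h A h c c (\<phi> t) p) has_vector_derivative 0) (at 0) \<longleftrightarrow>
     (\<forall>w. (\<Sum>e\<in>(SOME E. orthonormal_basis (metric_rep A h c (snd c p)) E). tension_rep A h X c (snd c p) e e w) = 0)"
    if X: "vector_field A X" and \<phi>: "local_flow A X D \<phi>" and c: "c \<in> A" "p \<in> fst c" for D \<phi> c p
  proof -
    interpret coordinate_flow "chart_image c" "metric_rep A h c" "field_rep A c X" "flow_domain c D \<phi>" "flow_rep c \<phi>"
      by (rule coordinate_flow_chart[OF A h X \<phi> c(1)])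
    have init: "(0, snd c p) \<in> flow_domain c D \<phi>"
      by (rule flow_domain_initial[OF charted_chart[OF smooth_atlas_charted[OF A] c(1)] \<phi> c(2)])
    have \<Gamma>: "christoffel A h c = gamma"
      by (simp add: fun_eq_iff christoffel_def gamma_def dg_def)
    have "second_fundamental_form A h A h c c (\<phi> t) (snd c p) u v = second_form (\<lambda>x. flow_rep c \<phi> (t, x)) (snd c p) u v" for t u v
      unfolding flow_rep_slice by (simp add: second_fundamental_form_def second_form_def \<Gamma> Let_def)
    then show ?thesis
      unfolding tension_field_def metric_trace_def using tension_derivative_zero_iff[OF init] by simp
  qed
  have "(\<forall>p. \<forall>c\<in>A. p \<in> fst c \<longrightarrow>
        ((\<lambda>t. tension_field A h A h c c (\<phi> t) p) has_vector_derivative 0) (at 0)) \<longleftrightarrow> ?L"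
    if "vector_field A X" and "local_flow A X D \<phi>" for D \<phi>
    using eq[OF that] by blast
  then show ?thesis unfolding one_harmonic_field_def by blast
qed

lemma killing_field_imp_one_harmonic_field:
  assumes A: "smooth_atlas A" and h: "riemannian_metric A h" and X: "killing_field A h X"
  shows "one_harmonic_field A h X"
proof -
  have L: "vector_field A X" "\<exists>D \<phi>. local_flow A X D \<phi>"
    "\<forall>c\<in>A. \<forall>y\<in>chart_image c. \<forall>u v. lie_rep A h X c y u v = 0"
    using X killing_field_iff[OF A h] by blast+
  have "tension_rep A h X c y u v w = 0" if c: "c \<in> A" and y: "y \<in> chart_image c" for c y u v w
  proof -
    interpret coordinate_metric "chart_image c" "metric_rep A h c" by (rule coordinate_metric_chart[OF A h c])
    show ?thesis by (rule tension_variation_eq_0[OF open_U y order_refl]) (use L(3) c in blast)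
  qed
  then show ?thesis using L(1,2) one_harmonic_field_iff[OF A h] by simp
qed

section \<open>Lie groups in charts\<close>

lemma lie_groupD:
  assumes "lie_group G A"
  shows "group G" and "carrier G = UNIV" and "smooth_atlas A"
    and "smooth_map_on (prod_atlas A A) A UNIV (\<lambda>(x, y). x \<otimes>\<^bsub>G\<^esub> y)"
    and "smooth_map_on A A UNIV (\<lambda>x. inv\<^bsub>G\<^esub> x)"
  using assms unfolding lie_group_def by blast+

lemma smooth_left_translation:
  assumes "lie_group G A"
  shows "smooth_map_on A A UNIV (\<lambda>x. a \<otimes>\<^bsub>G\<^esub> x)"
  using smooth_map_on_slice[OF smooth_atlas_charted[OF lie_groupD(3)[OF assms]] lie_groupD(3)[OF assms]
      smooth_atlas_charted[OF lie_groupD(3)[OF assms]] open_UNIV lie_groupD(4)[OF assms]]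
  by simp

text \<open>A left translation, read in charts, is an isometry that relates the field \<open>X\<close> to itself.\<close>

lemma left_translation_rep:
  fixes G :: "'a::{t2_space,second_countable_topology} monoid" and A :: "('a, 'e::euclidean_space) chart set" and a :: 'a
  assumes G: "lie_group G A" and h: "left_invariant_metric G A h" and X: "left_invariant_field G A X"
    and c: "c \<in> A" and d: "d \<in> A"
  defines "f \<equiv> local_rep c d (\<lambda>x. a \<otimes>\<^bsub>G\<^esub> x)" and "Y \<equiv> snd c ` (fst c \<inter> (\<lambda>x. a \<otimes>\<^bsub>G\<^esub> x) -` fst d)"
  shows "open Y" and "Y \<subseteq> chart_image c" and "smooth_on Y f" and "f ` Y \<subseteq> chart_image d"
    and "y \<in> Y \<Longrightarrow> field_rep A d X (f y) = dird (field_rep A c X y) f y"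
    and "y \<in> Y \<Longrightarrow> metric_rep A h d (f y) (dird u f y) (dird v f y) = metric_rep A h c y u v"
proof -
  note A = lie_groupD(3)[OF G] and L = smooth_left_translation[OF G, of a]
  note A' = smooth_atlas_charted[OF A]
  note cc = charted_chart[OF A' c] and dd = charted_chart[OF A' d]
  have Y_eq: "Y = snd c ` (fst c \<inter> UNIV \<inter> (\<lambda>x. a \<otimes>\<^bsub>G\<^esub> x) -` fst d)" by (simp add: Y_def)
  show "open Y" unfolding Y_eq
    by (rule open_local_domain[OF cc open_UNIV smooth_map_on_continuous[OF L] chart_open_domain[OF dd]])
  show "Y \<subseteq> chart_image c" by (auto simp: Y_def)
  show "smooth_on Y f" unfolding Y_eq f_def by (rule smooth_map_on_local_rep[OF L c d])
  show "f ` Y \<subseteq> chart_image d" using cc by (auto simp: Y_def f_def local_rep_def)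
  have vX: "vector_field A X" using X by (simp add: left_invariant_field_def)
  {
    assume "y \<in> Y"
    then obtain x where x: "y = snd c x" "x \<in> fst c" "a \<otimes>\<^bsub>G\<^esub> x \<in> fst d" by (auto simp: Y_def)
    have fy: "f y = snd d (a \<otimes>\<^bsub>G\<^esub> x)" using x cc by (simp add: f_def local_rep_def)
    have push: "pushforward A (\<lambda>x. a \<otimes>\<^bsub>G\<^esub> x) x (coord_vec A c x u) = coord_vec A d (a \<otimes>\<^bsub>G\<^esub> x) (dird u f y)" for u
      unfolding f_def x(1) using x c d by (intro pushforward_coord_vec[OF A' A' L]) auto
    have "coord_vec A d (a \<otimes>\<^bsub>G\<^esub> x) (field_rep A d X (f y)) = X (a \<otimes>\<^bsub>G\<^esub> x)"
      using vector_field_rep(2)[OF A vX d x(3)] fy by simp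
    also have "\<dots> = pushforward A (\<lambda>x. a \<otimes>\<^bsub>G\<^esub> x) x (X x)"
      using X by (simp add: left_invariant_field_def)
    also have "\<dots> = coord_vec A d (a \<otimes>\<^bsub>G\<^esub> x) (dird (field_rep A c X y) f y)"
      using vector_field_rep(2)[OF A vX c x(2)] push x(1) by simp
    finally show "field_rep A d X (f y) = dird (field_rep A c X y) f y"
      using coord_vec_inject[OF A d x(3)] by simp
    have T: "coord_vec A c x u \<in> tangent_space A x" for u
      using tangent_space_chart[OF A c x(2)] by blast
    have "metric_rep A h d (f y) (dird u f y) (dird v f y) =
        pullback_metric A (\<lambda>x. a \<otimes>\<^bsub>G\<^esub> x) h x (coord_vec A c x u) (coord_vec A c x v)"
      unfolding metric_rep_def pullback_metric_def push fy using dd x(3) by simp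
    also have "\<dots> = h x (coord_vec A c x u) (coord_vec A c x v)"
      using h T unfolding left_invariant_metric_def by blast
    also have "\<dots> = metric_rep A h c y u v"
      using x cc by (simp add: metric_rep_def)
    finally show "metric_rep A h d (f y) (dird u f y) (dird v f y) = metric_rep A h c y u v" .
  }
qed

lemma lie_rep_left_translation:
  assumes G: "lie_group G A" and h: "left_invariant_metric G A h" and X: "left_invariant_field G A X"
    and c: "c \<in> A" and d: "d \<in> A" and x: "x \<in> fst c" "a \<otimes>\<^bsub>G\<^esub> x \<in> fst d"
  shows "lie_rep A h X d (snd d (a \<otimes>\<^bsub>G\<^esub> x)) (dird u (local_rep c d (\<lambda>x. a \<otimes>\<^bsub>G\<^esub> x)) (snd c x))
      (dird v (local_rep c d (\<lambda>x. a \<otimes>\<^bsub>G\<^esub> x)) (snd c x)) = lie_rep A h X c (snd c x) u v"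
proof -
  note A = lie_groupD(3)[OF G]
  have h': "riemannian_metric A h" and X': "vector_field A X"
    using h X by (auto simp: left_invariant_metric_def left_invariant_field_def)
  note tr = left_translation_rep[OF G h X c d, where a = a]
  have "local_rep c d (\<lambda>x. a \<otimes>\<^bsub>G\<^esub> x) (snd c x) = snd d (a \<otimes>\<^bsub>G\<^esub> x)"
    using charted_chart[OF smooth_atlas_charted[OF A] c] x by (simp add: local_rep_def)
  moreover have "snd c x \<in> snd c ` (fst c \<inter> (\<lambda>x. a \<otimes>\<^bsub>G\<^esub> x) -` fst d)" using x by auto
  ultimately show ?thesis
    using lie_metric_natural[OF coordinate_metric_chart[OF A h' c] coordinate_metric_chart[OF A h' d]
        vector_field_rep(1)[OF A X' c] vector_field_rep(1)[OF A X' d] tr(1-4) tr(5,6), of "snd c x" u v]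
    by simp
qed

text \<open>A chart at the unit, in which \<open>unit_coord\<close> are the coordinates of the unit and \<open>mult_rep\<close> is the multiplication.\<close>

locale lie_group_chart =
  fixes G :: "'a::{t2_space,second_countable_topology} monoid"
    and A :: "('a, 'e::euclidean_space) chart set" and c :: "('a, 'e) chart"
  assumes lie: "lie_group G A" and c: "c \<in> A" and one_in: "\<one>\<^bsub>G\<^esub> \<in> fst c"
begin

sublocale group G by (rule lie_groupD(1)[OF lie])

lemma carrier_UNIV [simp]: "carrier G = UNIV" by (rule lie_groupD(2)[OF lie])

lemma atlas: "smooth_atlas A" by (rule lie_groupD(3)[OF lie])

lemma chart: "is_chart c" by (rule charted_chart[OF smooth_atlas_charted[OF atlas] c])

abbreviation pt :: "'e \<Rightarrow> 'a" where "pt \<equiv> chart_inv c"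

definition unit_coord :: 'e where "unit_coord = snd c \<one>\<^bsub>G\<^esub>"

lemma unit_coord_in: "unit_coord \<in> chart_image c" using one_in by (simp add: unit_coord_def)

lemma pt_unit_coord [simp]: "pt unit_coord = \<one>\<^bsub>G\<^esub>" using chart one_in by (simp add: unit_coord_def)

definition mult_dom :: "('e \<times> 'e) set" where
  "mult_dom = {(y, z). y \<in> chart_image c \<and> z \<in> chart_image c \<and> pt y \<otimes>\<^bsub>G\<^esub> pt z \<in> fst c}"

definition mult_rep :: "'e \<times> 'e \<Rightarrow> 'e" where
  "mult_rep = (\<lambda>(y, z). snd c (pt y \<otimes>\<^bsub>G\<^esub> pt z))"

lemma open_mult_dom: "open mult_dom" and smooth_mult_rep: "smooth_on mult_dom mult_rep"
  using product_rep_smooth[OF smooth_atlas_charted[OF atlas] smooth_atlas_charted[OF atlas] smooth_atlas_charted[OF atlas]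
      open_UNIV lie_groupD(4)[OF lie] c c c]
  by (simp_all add: mult_dom_def mult_rep_def)

lemma pt_mult_rep: "(y, z) \<in> mult_dom \<Longrightarrow> pt (mult_rep (y, z)) = pt y \<otimes>\<^bsub>G\<^esub> pt z"
  using chart by (simp add: mult_dom_def mult_rep_def)

lemma mult_rep_unit:
  assumes "y \<in> chart_image c"
  shows "(y, unit_coord) \<in> mult_dom" "(unit_coord, y) \<in> mult_dom" "mult_rep (y, unit_coord) = y" "mult_rep (unit_coord, y) = y"
  using assms chart_inv_in[OF chart assms] chart_chart_inv[OF chart assms] unit_coord_in by (auto simp: mult_dom_def mult_rep_def)

lemma dird_mult_rep_unit:
  assumes "y \<in> chart_image c"
  shows "dird (v, 0) mult_rep (y, unit_coord) = v" and "dird (0, v) mult_rep (unit_coord, y) = v"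
proof -
  have "dird (v, 0) mult_rep (y, unit_coord) = dird v (\<lambda>x. mult_rep (x, unit_coord)) y"
    using dird_eqI[OF has_derivative_slice_left[OF smooth_on_differentiable[OF smooth_mult_rep mult_rep_unit(1)[OF assms]]]]
    by simp
  also have "\<dots> = dird v (\<lambda>x. x) y"
    by (rule dird_cong_open[OF chart_open_image[OF chart] assms mult_rep_unit(3)])
  finally show "dird (v, 0) mult_rep (y, unit_coord) = v" by simp
  have "dird (0, v) mult_rep (unit_coord, y) = dird v (\<lambda>x. mult_rep (unit_coord, x)) y"
    using dird_eqI[OF has_derivative_slice_right[OF smooth_on_differentiable[OF smooth_mult_rep mult_rep_unit(2)[OF assms]]]]
    by simp
  also have "\<dots> = dird v (\<lambda>x. x) y"
    by (rule dird_cong_open[OF chart_open_image[OF chart] assms mult_rep_unit(4)])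
  finally show "dird (0, v) mult_rep (unit_coord, y) = v" by simp
qed

text \<open>The left-invariant vector field with the value \<open>u\<close> at the unit.\<close>

definition frame :: "'e \<Rightarrow> 'e \<Rightarrow> 'e" where
  "frame y u = dird (0, u) mult_rep (y, unit_coord)"

text \<open>The bracket of left-invariant fields is \<open>[u,z] = frame_derivative u z - frame_derivative z u\<close>.\<close>

definition frame_derivative :: "'e \<Rightarrow> 'e \<Rightarrow> 'e" where
  "frame_derivative x u = dird (x, 0) (dird (0, u) mult_rep) (unit_coord, unit_coord)"

lemma frame_at_unit [simp]: "frame unit_coord u = u"
  using dird_mult_rep_unit(2)[OF unit_coord_in] by (simp add: frame_def)

lemma frame_has_derivative: "((\<lambda>y. frame y u) has_derivative (\<lambda>x. frame_derivative x u)) (at unit_coord)"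
  unfolding frame_def frame_derivative_def
  by (rule has_derivative_slice_left[OF smooth_on_differentiable[OF smooth_on_dird[OF smooth_mult_rep] mult_rep_unit(1)[OF unit_coord_in]]])

lemma frame_eq_left_translation:
  assumes "y \<in> chart_image c"
  shows "frame y u = dird u (local_rep c c (\<lambda>x. pt y \<otimes>\<^bsub>G\<^esub> x)) unit_coord"
proof -
  have "frame y u = dird u (\<lambda>z. mult_rep (y, z)) unit_coord"
    unfolding frame_def
    using dird_eqI[OF has_derivative_slice_right[OF smooth_on_differentiable[OF smooth_mult_rep mult_rep_unit(1)[OF assms]]]]
    by simp
  then show ?thesis by (simp add: mult_rep_def local_rep_def o_def)
qed

lemma frame_derivative_commute: "frame_derivative x u = dird (0, u) (dird (x, 0) mult_rep) (unit_coord, unit_coord)"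
  unfolding frame_derivative_def by (rule dird_commute[OF smooth_mult_rep open_mult_dom mult_rep_unit(1)[OF unit_coord_in]])

lemma linear_frame_derivative_left: "linear (\<lambda>x. frame_derivative x u)"
  using has_derivative_linear[OF frame_has_derivative] .

lemma linear_frame_derivative_right: "linear (frame_derivative x)"
proof -
  have "linear (\<lambda>u. dird u (dird (x, 0) mult_rep) (unit_coord, unit_coord))"
    by (rule dird_linear[OF smooth_on_differentiable[OF smooth_on_dird[OF smooth_mult_rep] mult_rep_unit(1)[OF unit_coord_in]]])
  from linear_compose[OF _ this, of "\<lambda>u. (0, u)"] show ?thesis
    by (simp add: o_def frame_derivative_commute linear_iff)
qed

section \<open>Commutators and unimodularity\<close>

text \<open>The commutator \<open>x a x\<^sup>-\<^sup>1 a\<^sup>-\<^sup>1\<close>, in a form that uses inversion only once.\<close>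

definition commutator :: "'a \<Rightarrow> 'a \<Rightarrow> 'a" where
  "commutator a x = x \<otimes>\<^bsub>G\<^esub> a \<otimes>\<^bsub>G\<^esub> inv\<^bsub>G\<^esub> (a \<otimes>\<^bsub>G\<^esub> x)"

definition commutator_rep :: "'e \<times> 'e \<Rightarrow> 'e" where
  "commutator_rep = (\<lambda>(x, a). snd c (commutator (pt a) (pt x)))"

lemma commutator_one [simp]: "commutator a \<one>\<^bsub>G\<^esub> = \<one>\<^bsub>G\<^esub>" "commutator \<one>\<^bsub>G\<^esub> x = \<one>\<^bsub>G\<^esub>"
  by (simp_all add: commutator_def)

lemma commutator_mult: "commutator a x \<otimes>\<^bsub>G\<^esub> (a \<otimes>\<^bsub>G\<^esub> x) = x \<otimes>\<^bsub>G\<^esub> a"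
  by (simp add: commutator_def m_assoc)

lemma commutator_power_in_lower_central: "(commutator a ^^ k) x \<in> lower_central G k"
proof (induction k)
  case (Suc k)
  let ?y = "(commutator a ^^ k) x"
  have "commutator a ?y = ?y \<otimes>\<^bsub>G\<^esub> a \<otimes>\<^bsub>G\<^esub> inv\<^bsub>G\<^esub> ?y \<otimes>\<^bsub>G\<^esub> inv\<^bsub>G\<^esub> a"
    by (simp add: commutator_def inv_mult_group m_assoc)
  then have "commutator a ?y \<in> {x \<otimes>\<^bsub>G\<^esub> y \<otimes>\<^bsub>G\<^esub> inv\<^bsub>G\<^esub> x \<otimes>\<^bsub>G\<^esub> inv\<^bsub>G\<^esub> y | x y. x \<in> lower_central G k \<and> y \<in> carrier G}"
    using Suc carrier_UNIV by blast
  then show ?case by (simp add: generate.incl)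
qed simp

lemma commutator_rep_unit:
  shows "commutator_rep (unit_coord, a) = unit_coord" "commutator_rep (x, unit_coord) = unit_coord"
  by (simp_all add: commutator_rep_def flip: unit_coord_def)

text \<open>Multiplication and inversion are only available in the chart where their values stay in its domain. The commutator is composed of
them on a neighbourhood of \<open>(unit_coord, unit_coord)\<close> that is shrunk once for each composition. The last property,
\<open>[x,a] (a x) = x a\<close>, links the differential of the commutator to those of left and right translation.\<close>

lemma commutator_rep_smooth:
  obtains N where "open N" "(unit_coord, unit_coord) \<in> N" "N \<subseteq> mult_dom" "smooth_on N commutator_rep"
    "\<And>x a. (x, a) \<in> N \<Longrightarrow> (a, x) \<in> mult_dom"
    "\<And>x a. (x, a) \<in> N \<Longrightarrow> commutator (pt a) (pt x) \<in> fst c"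
    "\<And>x a. (x, a) \<in> N \<Longrightarrow> mult_rep (commutator_rep (x, a), mult_rep (a, x)) = mult_rep (x, a)"
proof -
  define I where "I = snd c ` (fst c \<inter> UNIV \<inter> (\<lambda>x. inv\<^bsub>G\<^esub> x) -` fst c)"
  define inv_rep where "inv_rep = local_rep c c (\<lambda>x. inv\<^bsub>G\<^esub> x)"
  note inv_smooth = lie_groupD(5)[OF lie]
  have I: "open I" unfolding I_def
    by (rule open_local_domain[OF chart open_UNIV smooth_map_on_continuous[OF inv_smooth] chart_open_domain[OF chart]])
  have sI: "smooth_on I inv_rep"
    unfolding I_def inv_rep_def by (rule smooth_map_on_local_rep[OF inv_smooth c c])
  define swap where "swap = (\<lambda>q :: 'e \<times> 'e. (snd q, fst q))"
  have s_swap: "smooth_on S swap" if "open S" for S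
    unfolding swap_def
    by (intro smooth_on_Pair that smooth_on_linear[OF that bounded_linear_snd smooth_on_ident]
        smooth_on_linear[OF that bounded_linear_fst smooth_on_ident])
  define N1 where "N1 = mult_dom \<inter> swap -` mult_dom"
  have N1: "open N1" unfolding N1_def
    by (rule continuous_open_preimage[OF smooth_on_continuous[OF s_swap[OF open_mult_dom]] open_mult_dom open_mult_dom])
  have s1: "smooth_on N1 (\<lambda>q. mult_rep (swap q))"
    by (rule smooth_on_compose[OF N1 open_mult_dom _ s_swap[OF N1] smooth_mult_rep]) (auto simp: N1_def)
  have s1': "smooth_on N1 mult_rep" by (rule smooth_on_subset[OF smooth_mult_rep]) (auto simp: N1_def)
  define N2 where "N2 = N1 \<inter> (\<lambda>q. mult_rep (swap q)) -` I"
  have N2: "open N2" unfolding N2_def by (rule continuous_open_preimage[OF smooth_on_continuous[OF s1] N1 I])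
  have N21: "N2 \<subseteq> N1" by (auto simp: N2_def)
  have "smooth_on N2 (\<lambda>q. inv_rep (mult_rep (swap q)))"
    by (rule smooth_on_compose[OF N2 I _ smooth_on_subset[OF s1 N21] sI]) (auto simp: N2_def)
  from smooth_on_Pair[OF N2 smooth_on_subset[OF s1' N21] this]
  have s2: "smooth_on N2 (\<lambda>q. (mult_rep q, inv_rep (mult_rep (swap q))))" .
  define N where "N = N2 \<inter> (\<lambda>q. (mult_rep q, inv_rep (mult_rep (swap q)))) -` mult_dom"
  have N: "open N" unfolding N_def by (rule continuous_open_preimage[OF smooth_on_continuous[OF s2] N2 open_mult_dom])
  have s3: "smooth_on N (\<lambda>q. mult_rep (mult_rep q, inv_rep (mult_rep (swap q))))"
    by (rule smooth_on_compose[OF N open_mult_dom _ smooth_on_subset[OF s2] smooth_mult_rep]) (auto simp: N_def)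
  have elem: "(x, a) \<in> mult_dom \<and> (a, x) \<in> mult_dom \<and> commutator (pt a) (pt x) \<in> fst c \<and>
     commutator_rep (x, a) = mult_rep (mult_rep (x, a), inv_rep (mult_rep (a, x)))" if "(x, a) \<in> N" for x a
  proof -
    have d: "(x, a) \<in> mult_dom" "(a, x) \<in> mult_dom" "mult_rep (a, x) \<in> I"
        "(mult_rep (x, a), inv_rep (mult_rep (a, x))) \<in> mult_dom"
      using that by (auto simp: N_def N2_def N1_def swap_def)
    have i: "pt (inv_rep (mult_rep (a, x))) = inv\<^bsub>G\<^esub> (pt a \<otimes>\<^bsub>G\<^esub> pt x)"
      using d(3) chart pt_mult_rep[OF d(2)] by (auto simp: I_def inv_rep_def local_rep_def)
    have "commutator (pt a) (pt x) = pt (mult_rep (x, a)) \<otimes>\<^bsub>G\<^esub> pt (inv_rep (mult_rep (a, x)))"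
      by (simp add: commutator_def i pt_mult_rep[OF d(1)])
    then show ?thesis using d by (simp add: mult_dom_def commutator_rep_def mult_rep_def)
  qed
  show ?thesis
  proof (rule that[OF N])
    have "inv_rep unit_coord = unit_coord" by (simp add: inv_rep_def local_rep_def flip: unit_coord_def)
    moreover have "unit_coord \<in> I"
      unfolding I_def using one_in by (intro image_eqI[of _ _ "\<one>\<^bsub>G\<^esub>"]) (auto simp: unit_coord_def)
    ultimately show "(unit_coord, unit_coord) \<in> N"
      using mult_rep_unit[OF unit_coord_in] by (simp add: N_def N2_def N1_def swap_def)
    show "N \<subseteq> mult_dom" using elem by auto
    show "smooth_on N commutator_rep"
      using s3 smooth_on_cong[OF N, of commutator_rep "\<lambda>q. mult_rep (mult_rep q, inv_rep (mult_rep (swap q)))"] elem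
      by (auto simp: swap_def)
    fix x a assume xa: "(x, a) \<in> N"
    show "(a, x) \<in> mult_dom" "commutator (pt a) (pt x) \<in> fst c" using elem[OF xa] by auto
    have "pt (commutator_rep (x, a)) = commutator (pt a) (pt x)"
      using elem[OF xa] chart unfolding commutator_rep_def prod.case by (blast intro: chart_inv_chart)
    moreover have "pt (mult_rep (a, x)) = pt a \<otimes>\<^bsub>G\<^esub> pt x"
      using pt_mult_rep elem[OF xa] by blast
    moreover have "mult_rep (y, z) = snd c (pt y \<otimes>\<^bsub>G\<^esub> pt z)" for y z
      by (simp add: mult_rep_def)
    note this[of "commutator_rep (x, a)" "mult_rep (a, x)"]
    ultimately have "mult_rep (commutator_rep (x, a), mult_rep (a, x)) = snd c (commutator (pt a) (pt x) \<otimes>\<^bsub>G\<^esub> (pt a \<otimes>\<^bsub>G\<^esub> pt x))"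
      by (simp only:)
    then show "mult_rep (commutator_rep (x, a), mult_rep (a, x)) = mult_rep (x, a)"
      by (simp add: commutator_mult mult_rep_def)
  qed
qed

text \<open>Nilpotent groups are unimodular. Let \<open>K\<^sub>a\<close> be the differential of \<open>x \<mapsto> [x,a]\<close> at the unit, which is nilpotent.
Differentiation of \<open>[x,a] (a x) = x a\<close> with respect to \<open>x\<close> at the unit gives \<open>R\<^sub>a K\<^sub>a = R\<^sub>a - L\<^sub>a\<close> with the differentials \<open>R\<^sub>a\<close> and \<open>L\<^sub>a\<close> of the
translations at the unit. As \<open>K\<^sub>a = 0\<close> and \<open>R\<^sub>a = id\<close> at the unit, differentiation with respect to \<open>a\<close> identifies the
derivative of \<open>K\<^sub>a\<close> with that of \<open>R\<^sub>a - L\<^sub>a\<close>, which is the bracket.\<close>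

lemma linear_trace_bracket_eq_0:
  assumes nil: "nilpotent_group G"
  shows "linear_trace (\<lambda>u. frame_derivative u z - frame_derivative z u) = 0"
proof -
  obtain N where N: "open N" "(unit_coord, unit_coord) \<in> N" "N \<subseteq> mult_dom" "smooth_on N commutator_rep"
    and N_swap: "\<And>x a. (x, a) \<in> N \<Longrightarrow> (a, x) \<in> mult_dom"
    and N_comm: "\<And>x a. (x, a) \<in> N \<Longrightarrow> commutator (pt a) (pt x) \<in> fst c"
    and N_eq: "\<And>x a. (x, a) \<in> N \<Longrightarrow> mult_rep (commutator_rep (x, a), mult_rep (a, x)) = mult_rep (x, a)"
    using commutator_rep_smooth by blast
  define V where "V = {a. (unit_coord, a) \<in> N}"
  have V: "open V" "unit_coord \<in> V" using open_slice_right[OF N(1)] N(2) by (auto simp: V_def)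
  have V_dom: "(unit_coord, a) \<in> mult_dom" "(a, unit_coord) \<in> mult_dom" "a \<in> chart_image c" if "a \<in> V" for a
  proof -
    show "(unit_coord, a) \<in> mult_dom" "(a, unit_coord) \<in> mult_dom" using that N(3) N_swap by (auto simp: V_def)
    then show "a \<in> chart_image c" by (simp add: mult_dom_def)
  qed
  define K where "K a u = dird (u, 0) commutator_rep (unit_coord, a)" for a u
  have dK: "((\<lambda>x. commutator_rep (x, a)) has_derivative K a) (at unit_coord)" if "a \<in> V" for a
    using has_derivative_slice_left[OF smooth_on_differentiable[OF N(4)], of unit_coord a] that
    by (simp add: K_def[abs_def] V_def)
  obtain k where k: "lower_central G k = {\<one>\<^bsub>G\<^esub>}" using nil by (auto simp: nilpotent_group_def)

  have trace_K: "linear_trace (K a) = 0" if a: "a \<in> V" for a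
  proof (rule linear_trace_nilpotent)
    show "linear (K a)" using has_derivative_linear[OF dK[OF a]] .
    let ?f = "\<lambda>x. commutator_rep (x, a)"
    have "\<forall>\<^sub>F x in nhds unit_coord. (?f ^^ j) x = snd c ((commutator (pt a) ^^ j) (pt x)) \<and> (commutator (pt a) ^^ j) (pt x) \<in> fst c" for j
    proof (induction j)
      case 0
      have "\<forall>\<^sub>F x in nhds unit_coord. x \<in> chart_image c"
        by (rule eventually_nhds_in_open[OF chart_open_image[OF chart] unit_coord_in])
      then show ?case
        by eventually_elim (use chart_inv_in[OF chart] chart_chart_inv[OF chart] in auto)
    next
      case (Suc j)
      \<comment> \<open>The iterates stay near the unit, hence in the domain where one further step can be read in the chart.\<close>
      have "isCont (?f ^^ j) unit_coord \<and> (?f ^^ j) unit_coord = unit_coord"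
      proof (induction j)
        case (Suc j)
        have "isCont ?f ((?f ^^ j) unit_coord)" using has_derivative_continuous[OF dK[OF a]] Suc by simp
        then show ?case using Suc isCont_o2[of unit_coord "?f ^^ j" ?f] by (simp add: commutator_rep_unit o_def)
      qed simp
      then have "((?f ^^ j) \<longlongrightarrow> unit_coord) (nhds unit_coord)"
        by (metis isCont_def tendsto_at_iff_tendsto_nhds)
      then have "\<forall>\<^sub>F x in nhds unit_coord. (?f ^^ j) x \<in> {x. (x, a) \<in> N}"
        using open_slice_left[OF N(1)] a by (intro topological_tendstoD) (auto simp: V_def)
      with Suc show ?case
      proof eventually_elim
        case (elim x)
        have p: "pt ((?f ^^ j) x) = (commutator (pt a) ^^ j) (pt x)" using elim(1) chart by simp
        then have "commutator (pt a) ((commutator (pt a) ^^ j) (pt x)) \<in> fst c" using elim(2) N_comm by force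
        then show ?case using p by (simp add: commutator_rep_def)
      qed
    qed
    from this[of k] have "\<forall>\<^sub>F x in nhds unit_coord. (?f ^^ k) x = unit_coord"
    proof eventually_elim
      case (elim x)
      have "(commutator (pt a) ^^ k) (pt x) = \<one>\<^bsub>G\<^esub>" using commutator_power_in_lower_central[where a = "pt a" and k = k and x = "pt x"] k by simp
      then show ?case using elim by (simp add: unit_coord_def)
    qed
    then show "(K a ^^ k) x = 0" for x
      using funpow_derivative_zero[OF dK[OF a]] commutator_rep_unit by simp
  qed

  have mult_diff: "mult_rep differentiable at q" if "q \<in> mult_dom" for q
    by (rule smooth_on_differentiable[OF smooth_mult_rep that])
  have K_eq: "dird (K a u, 0) mult_rep (unit_coord, a) = dird (u, 0) mult_rep (unit_coord, a) - frame a u" if a: "a \<in> V" for a u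
  proof -
    have "((\<lambda>x. mult_rep (a, x)) has_derivative frame a) (at unit_coord)"
      using has_derivative_slice_right[OF mult_diff[OF V_dom(2)[OF a]]] by (simp add: frame_def[abs_def])
    from has_derivative_Pair[OF dK[OF a] this]
    have i: "((\<lambda>x. (commutator_rep (x, a), mult_rep (a, x))) has_derivative (\<lambda>u. (K a u, frame a u))) (at unit_coord)" .
    have "(mult_rep has_derivative (\<lambda>v. dird v mult_rep (unit_coord, a))) (at (commutator_rep (unit_coord, a), mult_rep (a, unit_coord)))"
      using dird_has_derivative[OF mult_diff[OF V_dom(1)[OF a]]] commutator_rep_unit mult_rep_unit(3)[OF V_dom(3)[OF a]] by simp
    from diff_chain_at[OF i this]
    have "((\<lambda>x. mult_rep (commutator_rep (x, a), mult_rep (a, x))) has_derivative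
        (\<lambda>u. dird (K a u, frame a u) mult_rep (unit_coord, a))) (at unit_coord)" by (simp add: o_def)
    then have "((\<lambda>x. mult_rep (x, a)) has_derivative (\<lambda>u. dird (K a u, frame a u) mult_rep (unit_coord, a))) (at unit_coord)"
      by (rule has_derivative_transform_within_open[OF _ open_slice_left[OF N(1), of a]]) (use a N_eq in \<open>auto simp: V_def\<close>)
    then have "(\<lambda>u. dird (K a u, frame a u) mult_rep (unit_coord, a)) = (\<lambda>u. dird (u, 0) mult_rep (unit_coord, a))"
      using has_derivative_slice_left[OF mult_diff[OF V_dom(1)[OF a]]] by (rule has_derivative_unique)
    then have "dird (K a u, frame a u) mult_rep (unit_coord, a) = dird (u, 0) mult_rep (unit_coord, a)" by (rule fun_cong)
    moreover have "dird (K a u, frame a u) mult_rep (unit_coord, a) = dird (K a u, 0) mult_rep (unit_coord, a) + dird (0, frame a u) mult_rep (unit_coord, a)"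
      using linear_add[OF dird_linear[OF mult_diff[OF V_dom(1)[OF a]]], of "(K a u, 0)" "(0, frame a u)"] by simp
    ultimately show ?thesis using dird_mult_rep_unit(2)[OF V_dom(3)[OF a]] by (simp add: eq_diff_eq)
  qed

  have DK: "((\<lambda>a. K a u) has_derivative (\<lambda>z. frame_derivative u z - frame_derivative z u)) (at unit_coord)" for u
  proof -
    \<comment> \<open>\<open>D (0, z)\<close> is the derivative of \<open>K a u\<close> in the direction \<open>z\<close>, computed once directly and once from \<open>K_eq\<close>.\<close>
    define D where "D = (\<lambda>v. dird v (dird (u, 0) commutator_rep) (unit_coord, unit_coord))"
    have dw: "(dird (u, 0) commutator_rep has_derivative D) (at (unit_coord, unit_coord))"
      unfolding D_def by (rule smooth_on_has_derivative[OF smooth_on_dird[OF N(4)] N(2)])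
    have slice: "((\<lambda>a. H (unit_coord, a)) has_derivative (\<lambda>z. H' (0, z))) (at unit_coord)"
      if "(H has_derivative H') (at (unit_coord, unit_coord))" for H H' :: "'e \<times> 'e \<Rightarrow> 'e"
    proof -
      have "((\<lambda>x. (unit_coord, x)) has_derivative (\<lambda>v. (0, v))) (at unit_coord)" by (auto intro!: derivative_eq_intros)
      from diff_chain_at[OF this that] show ?thesis by (simp add: o_def)
    qed
    \<comment> \<open>Since \<open>[x,1] = 1\<close>; it removes the term with a second derivative of the multiplication.\<close>
    have w0: "dird (u, 0) commutator_rep (unit_coord, unit_coord) = 0"
    proof -
      have "((\<lambda>x. commutator_rep (x, unit_coord)) has_derivative (\<lambda>v. 0)) (at unit_coord)" by (simp add: commutator_rep_unit)
      then have "K unit_coord = (\<lambda>v. 0)" using dK[OF V(2)] has_derivative_unique by blast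
      then show ?thesis by (simp add: K_def fun_eq_iff)
    qed
    have "((\<lambda>q. (dird (u, 0) commutator_rep q, 0 :: 'e)) has_derivative (\<lambda>v. (D v, 0))) (at (unit_coord, unit_coord))"
      by (intro has_derivative_Pair dw has_derivative_const)
    from dird_along_field_has_derivative[OF smooth_mult_rep open_mult_dom mult_rep_unit(1)[OF unit_coord_in] this]
    have "((\<lambda>q. dird (dird (u, 0) commutator_rep q, 0) mult_rep q) has_derivative D) (at (unit_coord, unit_coord))"
      using dird_mult_rep_unit(1)[OF unit_coord_in] linear_0[OF dird_linear[OF smooth_on_differentiable[OF
            smooth_on_dird[OF smooth_mult_rep] mult_rep_unit(1)[OF unit_coord_in]]]]
      by (simp add: w0 zero_prod_def)
    from slice[OF this]
    have "((\<lambda>a. dird (K a u, 0) mult_rep (unit_coord, a)) has_derivative (\<lambda>z. D (0, z))) (at unit_coord)"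
      by (simp add: K_def)
    moreover have "((\<lambda>a. dird (K a u, 0) mult_rep (unit_coord, a)) has_derivative (\<lambda>z. frame_derivative u z - frame_derivative z u)) (at unit_coord)"
    proof (rule has_derivative_transform_within_open[OF _ V K_eq[symmetric]])
      have "((\<lambda>a. dird (u, 0) mult_rep (unit_coord, a)) has_derivative (\<lambda>z. frame_derivative u z)) (at unit_coord)"
        unfolding frame_derivative_commute
        by (rule has_derivative_slice_right[OF smooth_on_differentiable[OF smooth_on_dird[OF smooth_mult_rep] mult_rep_unit(1)[OF unit_coord_in]]])
      then show "((\<lambda>a. dird (u, 0) mult_rep (unit_coord, a) - frame a u) has_derivative (\<lambda>z. frame_derivative u z - frame_derivative z u)) (at unit_coord)"
        by (intro has_derivative_diff frame_has_derivative)
    qed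
    ultimately have "(\<lambda>z. D (0, z)) = (\<lambda>z. frame_derivative u z - frame_derivative z u)" by (rule has_derivative_unique)
    then show ?thesis using slice[OF dw] by (simp add: K_def)
  qed

  have "((\<lambda>a. linear_trace (K a)) has_derivative (\<lambda>z. linear_trace (\<lambda>u. frame_derivative u z - frame_derivative z u))) (at unit_coord)"
    unfolding linear_trace_def by (intro has_derivative_sum has_derivative_inner_left DK)
  moreover have "((\<lambda>a. linear_trace (K a)) has_derivative (\<lambda>z. 0)) (at unit_coord)"
    using has_derivative_cong_open[OF V, of "\<lambda>a. linear_trace (K a)" "\<lambda>a. 0"] trace_K by simp
  ultimately have "(\<lambda>z. linear_trace (\<lambda>u. frame_derivative u z - frame_derivative z u)) = (\<lambda>z. 0)" by (rule has_derivative_unique)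
  then show ?thesis by (rule fun_cong)
qed

section \<open>One-harmonic left-invariant fields are Killing fields\<close>

text \<open>Forms that are constant on left-invariant fields are differentiated by the product rule.\<close>

lemma frame_derivative_of_invariant:
  fixes q :: "'e \<Rightarrow> 'e \<Rightarrow> 'e \<Rightarrow> real"
  assumes bil: "\<And>y. y \<in> chart_image c \<Longrightarrow> bilinear (q y)"
    and dif: "\<And>u v. (\<lambda>y. q y u v) differentiable at unit_coord"
    and inv: "\<And>y u v. y \<in> chart_image c \<Longrightarrow> q y (frame y u) (frame y v) = q unit_coord u v"
  shows "dird x (\<lambda>y. q y u v) unit_coord = - q unit_coord (frame_derivative x u) v - q unit_coord u (frame_derivative x v)"
proof -
  have "((\<lambda>y. q y (frame y u) (frame y v)) has_derivative
      (\<lambda>x. dird x (\<lambda>y. q y (frame unit_coord u) (frame unit_coord v)) unit_coord + q unit_coord (frame_derivative x u) (frame unit_coord v) + q unit_coord (frame unit_coord u) (frame_derivative x v))) (at unit_coord)"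
    by (rule bilinear_family_has_derivative[where q = q and y = "\<lambda>y. y" and u = "\<lambda>y. frame y u" and v = "\<lambda>y. frame y v",
        OF chart_open_image[OF chart] unit_coord_in bil dif has_derivative_ident frame_has_derivative frame_has_derivative])
  moreover have "((\<lambda>y. q y (frame y u) (frame y v)) has_derivative (\<lambda>x. 0)) (at unit_coord)"
    using has_derivative_cong_open[OF chart_open_image[OF chart] unit_coord_in, of "\<lambda>y. q y (frame y u) (frame y v)" "\<lambda>y. q unit_coord u v"] inv
    by simp
  ultimately have "(\<lambda>x. dird x (\<lambda>y. q y (frame unit_coord u) (frame unit_coord v)) unit_coord + q unit_coord (frame_derivative x u) (frame unit_coord v) + q unit_coord (frame unit_coord u) (frame_derivative x v)) = (\<lambda>x. 0)"
    by (rule has_derivative_unique)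
  from fun_cong[OF this, of x] show ?thesis by simp
qed

text \<open>The left-invariant frame supplies the structure constants required by the pointwise Bochner formula, which uses the one-harmonic equation only at the unit and paired with the field itself.\<close>

lemma lie_rep_eq_0_at_unit:
  assumes nil: "nilpotent_group G" and h: "left_invariant_metric G A h" and X: "left_invariant_field G A X"
    and harm: "one_harmonic_field A h X"
  shows "lie_rep A h X c unit_coord u v = 0"
proof -
  have h': "riemannian_metric A h" and X': "vector_field A X"
    using h X by (auto simp: left_invariant_metric_def left_invariant_field_def)
  interpret coordinate_metric "chart_image c" "metric_rep A h c"
    by (rule coordinate_metric_chart[OF atlas h' c])
  note \<xi> = vector_field_rep(1)[OF atlas X' c]
  let ?\<xi> = "field_rep A c X"
  have pt: "pt y \<in> fst c" "snd c (pt y) = y" if "y \<in> chart_image c" for y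
    using chart_inv_in[OF chart that] chart_chart_inv[OF chart that] .
  have rep: "local_rep c c (\<lambda>x. pt y \<otimes>\<^bsub>G\<^esub> x) unit_coord = y" "unit_coord \<in> snd c ` (fst c \<inter> (\<lambda>x. pt y \<otimes>\<^bsub>G\<^esub> x) -` fst c)"
    if "y \<in> chart_image c" for y
    using pt[OF that] one_in by (auto simp: local_rep_def unit_coord_def[symmetric]) (auto simp: unit_coord_def)
  have g_inv: "metric_rep A h c y (frame y u) (frame y v) = metric_rep A h c unit_coord u v" if "y \<in> chart_image c" for y u v
    using left_translation_rep(6)[OF lie h X c c rep(2)[OF that], of u v] rep(1)[OF that]
    by (simp add: frame_eq_left_translation[OF that])
  have S_inv: "lie_rep A h X c y (frame y u) (frame y v) = lie_rep A h X c unit_coord u v" if "y \<in> chart_image c" for y u v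
    using lie_rep_left_translation[OF lie h X c c one_in, of "pt y" u v] pt[OF that]
    by (simp add: frame_eq_left_translation[OF that] flip: unit_coord_def)
  have \<xi>_inv: "?\<xi> y = frame y (?\<xi> unit_coord)" if "y \<in> chart_image c" for y
    using left_translation_rep(5)[OF lie h X c c rep(2)[OF that]] rep(1)[OF that]
    by (simp add: frame_eq_left_translation[OF that])
  define E where "E = (SOME E. orthonormal_basis (metric_rep A h c unit_coord) E)"
  have E: "orthonormal_basis (metric_rep A h c unit_coord) E"
    unfolding E_def using orthonormal_basis_exists[OF inner_form_g[OF unit_coord_in]] by (rule someI_ex)
  show ?thesis
  proof (rule lie_metric_eq_0_of_divergence_free[OF unit_coord_in \<xi> E])
    show "dg unit_coord x u v = - metric_rep A h c unit_coord (frame_derivative x u) v - metric_rep A h c unit_coord u (frame_derivative x v)" for x u v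
      unfolding dg_def by (rule frame_derivative_of_invariant[where q = "metric_rep A h c", OF bilinear_g g_differentiable[OF unit_coord_in] g_inv])
    show "dird x (\<lambda>z. lie_rep A h X c z u v) unit_coord = - lie_rep A h X c unit_coord (frame_derivative x u) v - lie_rep A h X c unit_coord u (frame_derivative x v)" for x u v
    proof (rule frame_derivative_of_invariant[where q = "lie_rep A h X c", OF _ _ S_inv])
      show "bilinear (lie_rep A h X c y)" if "y \<in> chart_image c" for y
        by (rule bilinear_lie_metric[OF that smooth_on_differentiable[OF \<xi> that]])
      show "(\<lambda>y. lie_rep A h X c y u v) differentiable at unit_coord" for u v
        using lie_metric_has_derivative[OF unit_coord_in \<xi>] by (rule differentiableI)
    qed
    show "dird u ?\<xi> unit_coord = frame_derivative u (?\<xi> unit_coord)" for u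
    proof -
      have "dird u ?\<xi> unit_coord = dird u (\<lambda>y. frame y (?\<xi> unit_coord)) unit_coord"
        using \<xi>_inv by (rule dird_cong_open[OF open_U unit_coord_in])
      then show ?thesis using dird_eqI[OF frame_has_derivative] by simp
    qed
    show "(\<Sum>e\<in>E. metric_rep A h c unit_coord (frame_derivative e z - frame_derivative z e) e) = 0" for z
    proof -
      have "linear (\<lambda>u. frame_derivative u z - frame_derivative z u)"
        by (intro linear_compose_sub linear_frame_derivative_left linear_frame_derivative_right)
      then show ?thesis
        using linear_trace_orthonormal_basis[OF inner_form_g[OF unit_coord_in] E] linear_trace_bracket_eq_0[OF nil] by simp
    qed
    show "(\<Sum>e\<in>E. tension_rep A h X c unit_coord e e (?\<xi> unit_coord)) = 0"
      using harm one_harmonic_field_iff[OF atlas h'] c unit_coord_in unfolding E_def by blast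
  qed
qed

end

theorem theorem2:
  fixes G :: "'a::{t2_space,second_countable_topology} monoid"
    and A :: "('a, 'e::euclidean_space) chart set"
    and h :: "'a metric"
    and X :: "'a \<Rightarrow> 'a tvec"
  assumes "lie_group G A"
    and "simply_connected (UNIV :: 'a set)"
    and "nilpotent_group G"
    and "left_invariant_metric G A h"
    and "left_invariant_field G A X"
  shows "one_harmonic_field A h X \<longleftrightarrow> killing_field A h X"
proof
  note G = assms(1) and h = assms(4) and X = assms(5)
  note A = lie_groupD(3)[OF G]
  have h': "riemannian_metric A h" using h by (simp add: left_invariant_metric_def)
  show "killing_field A h X \<Longrightarrow> one_harmonic_field A h X"
    by (rule killing_field_imp_one_harmonic_field[OF A h'])
  assume harm: "one_harmonic_field A h X"
  obtain c where cA: "c \<in> A" and c1: "\<one>\<^bsub>G\<^esub> \<in> fst c"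
    using charted_cover[OF smooth_atlas_charted[OF A]] by blast
  interpret lie_group_chart G A c
    using G cA c1 by (rule lie_group_chart.intro)
  have "lie_rep A h X d y u v = 0" if d: "d \<in> A" and y: "y \<in> chart_image d" for d y u v
  proof -
    obtain x where x: "x \<in> fst d" "y = snd d x" using y by auto
    \<comment> \<open>Translation by the inverse carries \<open>x\<close> to the unit.\<close>
    have "inv\<^bsub>G\<^esub> x \<otimes>\<^bsub>G\<^esub> x = \<one>\<^bsub>G\<^esub>" by simp
    then show ?thesis
      using lie_rep_left_translation[OF G h X d cA x(1), of "inv\<^bsub>G\<^esub> x" u v] c1 x(2)
        lie_rep_eq_0_at_unit[OF assms(3) h X harm] by (simp flip: unit_coord_def)
  qed
  moreover have "vector_field A X \<and> (\<exists>D \<phi>. local_flow A X D \<phi>)"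
    using harm unfolding one_harmonic_field_iff[OF A h'] by (elim conjE) (intro conjI)
  ultimately show "killing_field A h X"
    unfolding killing_field_iff[OF A h'] by simp
qed

end
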